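(* Fix an integer $n\ge1$ and a sign pattern $\epsilon\in\{\pm1\}^n$. (1) The sets $LPM^{\mathbb{C}}_n(\delta)$, $\delta\in\{\pm1\}^n$, are all nonempty and pairwise disjoint, and their union over all $\delta$ is open and dense in the $n\times n$ Hermitian matrices. (2) Given any $B_\epsilon\in LPM^{\mathbb{C}}_n(\epsilon)$, the map $\Phi^{\mathbb{C}}_{B_\epsilon}:\mathbf{L}^{\mathbb{C}}_n\to LPM^{\mathbb{C}}_n(\epsilon)$, $L\mapsto L\,B_\epsilon\,L^*$, is a smooth (real) diffeomorphism onto $LPM^{\mathbb{C}}_n(\epsilon)$ with $(\Phi^{\mathbb{C}}_{B_\epsilon})^{-1}$ algorithmic. (3) The analogue for trailing minors holds: the sets $TPM_n^{\mathbb{C}}(\delta)$ are nonempty, pairwise disjoint, with union open and dense in the Hermitian matrices; for each $C_\epsilon\in TPM_n^{\mathbb{C}}(\epsilon)$ the map $\mathbf{L}_n^{\mathbb{C}}\to TPM_n^{\mathbb{C}}(\epsilon)$, $L\mapsto L^*C_\epsilon L$, is a smooth (real) diffeomorphism with algorithmic inverse; the reversal map $A\mapsto\overleftarrow A=(P_nAP_n)^*$ is a (real-)linear diffeomorphism $LPM_n^{\mathbb{C}}(\epsilon)\leftrightarrow TPM_n^{\mathbb{C}}(\epsilon)$, maps $\mathbf{L}_n^{\mathbb{C}}$ diffeomorphically onto itself, and satisfies $\overleftarrow{LB_\epsilon L^*}=\overleftarrow L^{\,*}\,\overleftarrow{B_\epsilon}\,\overleftarrow L$ for all $L\in\mathbf{L}_n^{\mathbb{C}}$,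 $B_\epsilon\in LPM_n^{\mathbb{C}}(\epsilon)$. (4) $\mathbf{L}_n^{\mathbb{C}}$ (and hence each $LPM_n^{\mathbb{C}}(\epsilon)$, $TPM_n^{\mathbb{C}}(\epsilon)$ with the transported structure) is isometrically isomorphic to the real Euclidean space $\mathbb{R}^{n^2}$. For every $\boldsymbol\epsilon\in\{\pm1\}^\infty$, $\mathbf{L}_{00}^{\mathbb{C}}$ and $LPM_{00}^{\mathbb{C}}(\boldsymbol\epsilon)$ are the direct limits of the spaces $\mathbf{L}^{\mathbb{C}}_n$ and $LPM^{\mathbb{C}}_n((\epsilon_1,\dots,\epsilon_n))$ under the inclusions $L\mapsto\begin{pmatrix}L&0\\0&1\end{pmatrix}$ and $A\mapsto\begin{pmatrix}A&0\\0&\epsilon_n\epsilon_{n+1}\end{pmatrix}$ respectively, and are isomorphic to $c_{00}^{\mathbb{R}}\oplus c_{00}^{\mathbb{C}}$ (for the diagonal and off-diagonal entries, respectively) as real inner product spaces. Similarly, $\mathbf{L}^{\mathbb{C}}_{\mathcal H}$ (and its transfer under $L\mapsto L\mathbb{D}_{\boldsymbol\epsilon}L^*$) is linearly and isometrically isomorphic to $\ell^2_{\mathbb{R}}\oplus\ell^2_{\mathbb{C}}$ as a real Hilbert space.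
   Context: $\mathbf{L}^{\mathbb{C}}_n$: lower triangular matrices in $\mathbb{C}^{n\times n}$ with positive real diagonal entries. $LPM^{\mathbb{C}}_n(\epsilon)$ (resp. $TPM^{\mathbb{C}}_n(\epsilon)$): Hermitian $n\times n$ matrices whose leading (resp. trailing) principal $k\times k$ minor is nonzero of sign $\epsilon_k$, $1\le k\le n$. $P_n$ is the anti-diagonal permutation matrix. For a finite or infinite sign sequence $\delta$, $\mathbb{D}_\delta=\mathrm{diag}(\delta_1,\delta_1\delta_2,\delta_2\delta_3,\dots)$. "Algorithmic" means that $L$ is computed from the entries of the given matrices by an explicit finite procedure using field operations, complex conjugation, and positive square roots of positive reals. $\mathbf{L}^{\mathbb{C}}_{00}$: semi-infinite complex lower triangular matrices with diagonal entries in $(0,\infty)$, all but finitely many equal to $1$, and all but finitely many below-diagonal entries zero. $\mathbf{L}^{\mathbb{C}}_{\mathcal H}$: semi-infinite complex lower triangular matrices with diagonal entries in $(0,\infty)$, $\sum_j(\log l_{jj})^2<\infty$, and $\sum_{i>j}|l_{ij}|^2<\infty$. $LPM^{\mathbb{C}}_{00}(\boldsymbol\epsilon)$: semi-infinite Hermitian matrices $\begin{pmatrix}A&0\\0&\mathrm{diag}(\epsilon_n\epsilon_{n+1},\epsilon_{n+1}\epsilon_{n+2},\dots)\end{pmatrix}$ with $n\ge1$ and $A\in LPM^{\mathbb{C}}_n((\epsilon_1,\dots,\epsilon_n))$; it equals the image of $\mathbf{L}^{\mathbb{C}}_{00}$ under $L\mapsto L\mathbb{D}_{\boldsymbol\epsilon}L^*$.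 Writing $\lfloor L\rfloor,\mathbb{D}(L)$ for the strictly lower triangular and diagonal parts, each $\mathbf{L}^{\mathbb{C}}$-space has the real inner product space structure: addition $L\circledcirc K=\lfloor L\rfloor+\lfloor K\rfloor+\mathbb{D}(L)\mathbb{D}(K)$, real scalar multiplication $\alpha\cdot L=\alpha\lfloor L\rfloor+\mathbb{D}(L)^\alpha$, and inner product $\langle L,K\rangle=\mathrm{Re}\sum_{i>j}\overline{l_{ij}}k_{ij}+\sum_j\log(l_{jj})\log(k_{jj})$. Structures on LPM spaces are transported along $L\mapsto L\mathbb{D}_\epsilon L^*$ (or $\mathbb{D}_{\boldsymbol\epsilon}$), and on $TPM_n^{\mathbb{C}}(\epsilon)$ along $L\mapsto L^*(P_n\mathbb{D}_\epsilon P_n)L$. $c_{00}^{\mathbb{R}},c_{00}^{\mathbb{C}}$ are finitely supported real/complex sequences with the $\ell^2$ inner product (real part taken in the complex case). *)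

theory Defs
  imports
    "HOL-Analysis.Analysis"
    "Jordan_Normal_Form.Schur_Decomposition"
    "Jordan_Normal_Form.DL_Submatrix"
    "Jordan_Normal_Form.VS_Connect"
begin

section \<open>Sign patterns, minors and the matrix classes\<close>

text \<open>Matrix entries are indexed from 0, sign patterns from 1: entry \<open>k\<close> of a pattern belongs to
  the \<open>k \<times> k\<close> minor. An infinite pattern is a function whose value at 0 is never used, so it
  can be passed unchanged wherever only its first \<open>n\<close> entries matter.\<close>

definition sign_patterns :: "nat \<Rightarrow> (nat \<Rightarrow> real) set" where
  "sign_patterns n = {1..n} \<rightarrow>\<^sub>E {-1, 1}"

definition inf_sign_pattern :: "(nat \<Rightarrow> real) \<Rightarrow> bool" where
  "inf_sign_pattern e \<longleftrightarrow> (\<forall>k\<ge>1. e k \<in> {-1, 1})"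

definition herm :: "nat \<Rightarrow> complex mat set" where
  "herm n = {A \<in> carrier_mat n n. mat_adjoint A = A}"

definition leading_minor :: "complex mat \<Rightarrow> nat \<Rightarrow> complex" where
  "leading_minor A k = det (submatrix A {..<k} {..<k})"

definition trailing_minor :: "complex mat \<Rightarrow> nat \<Rightarrow> complex" where
  "trailing_minor A k = det (submatrix A {dim_row A - k..<dim_row A} {dim_row A - k..<dim_row A})"

text \<open>On the complex numbers \<open>sgn z = z / cmod z\<close>, so the conditions below say that the minors
  are nonzero reals of the prescribed sign.\<close>

definition LPM :: "nat \<Rightarrow> (nat \<Rightarrow> real) \<Rightarrow> complex mat set" where
  "LPM n e = {A \<in> herm n. \<forall>k\<in>{1..n}. sgn (leading_minor A k) = complex_of_real (e k)}"

definition TPM :: "nat \<Rightarrow> (nat \<Rightarrow> real) \<Rightarrow> complex mat set" where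
  "TPM n e = {A \<in> herm n. \<forall>k\<in>{1..n}. sgn (trailing_minor A k) = complex_of_real (e k)}"

definition low :: "nat \<Rightarrow> complex mat set" where
  "low n = {L \<in> carrier_mat n n.
     (\<forall>i<n. \<forall>j<n. i < j \<longrightarrow> L $$ (i,j) = 0) \<and> (\<forall>i<n. L $$ (i,i) \<in> \<real>)}"

definition Lmat :: "nat \<Rightarrow> complex mat set" where
  "Lmat n = {L \<in> low n. \<forall>i<n. 0 < Re (L $$ (i,i))}"

definition dsign :: "(nat \<Rightarrow> real) \<Rightarrow> nat \<Rightarrow> real" where
  "dsign e i = (if i = 0 then e 1 else e i * e (Suc i))"

definition Dmat :: "nat \<Rightarrow> (nat \<Rightarrow> real) \<Rightarrow> complex mat" where
  "Dmat n e = mat_diag n (\<lambda>i. complex_of_real (dsign e i))"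

definition Pmat :: "nat \<Rightarrow> complex mat" where
  "Pmat n = mat n n (\<lambda>(i,j). if i + j + 1 = n then 1 else 0)"

definition reversal :: "nat \<Rightarrow> complex mat \<Rightarrow> complex mat" where
  "reversal n A = mat_adjoint (Pmat n * A * Pmat n)"


section \<open>Topology and smoothness for matrices\<close>

definition mat_dist :: "nat \<Rightarrow> complex mat \<Rightarrow> complex mat \<Rightarrow> real" where
  "mat_dist n A B = sqrt (\<Sum>i<n. \<Sum>j<n. (cmod (A $$ (i,j) - B $$ (i,j)))\<^sup>2)"

definition mat_topology :: "nat \<Rightarrow> complex mat topology" where
  "mat_topology n = Metric_space.mtopology (carrier_mat n n) (mat_dist n)"

definition open_dense_in :: "'a topology \<Rightarrow> 'a set \<Rightarrow> bool" where
  "open_dense_in X U \<longleftrightarrow> openin X U \<and> X closure_of U = topspace X"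

text \<open>Let \<open>V\<close> be a real subspace of the \<open>n \<times> n\<close> matrices and \<open>S\<close> a relatively open subset of
  \<open>V\<close>. Then \<open>Ck n V S k g\<close> says that on \<open>S\<close> the function \<open>g\<close> has iterated directional derivatives
  along \<open>V\<close> up to order \<open>k\<close>, those of order \<open>k\<close> being continuous. As \<open>V\<close> has finite dimension,
  this is the usual notion of being \<open>k\<close> times continuously differentiable over the reals.\<close>

primrec Ck :: "nat \<Rightarrow> complex mat set \<Rightarrow> complex mat set \<Rightarrow> nat \<Rightarrow> (complex mat \<Rightarrow> complex) \<Rightarrow> bool"
  where
    "Ck n V S 0 g \<longleftrightarrow> continuous_map (subtopology (mat_topology n) S) euclidean g"
  | "Ck n V S (Suc k) g \<longleftrightarrow>
       (\<forall>H\<in>V. \<exists>g'.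
          (\<forall>A\<in>S. ((\<lambda>t::real. g (A + complex_of_real t \<cdot>\<^sub>m H)) has_vector_derivative g' A) (at 0)) \<and>
          Ck n V S k g')"

definition smooth_map ::
  "nat \<Rightarrow> complex mat set \<Rightarrow> complex mat set \<Rightarrow> (complex mat \<Rightarrow> complex mat) \<Rightarrow> bool" where
  "smooth_map n V S f \<longleftrightarrow>
     openin (subtopology (mat_topology n) V) S \<and>
     (\<forall>i<n. \<forall>j<n. \<forall>k. Ck n V S k (\<lambda>A. f A $$ (i,j)))"

definition smooth_diffeo ::
  "nat \<Rightarrow> complex mat set \<Rightarrow> complex mat set \<Rightarrow> complex mat set \<Rightarrow> complex mat set
    \<Rightarrow> (complex mat \<Rightarrow> complex mat) \<Rightarrow> bool" where
  "smooth_diffeo n V S W T f \<longleftrightarrow>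
     bij_betw f S T \<and> smooth_map n V S f \<and> smooth_map n W T (inv_into S f)"


section \<open>Algorithmic maps\<close>

text \<open>\<open>Entry m i j\<close> reads entry \<open>(i,j)\<close> of the \<open>m\<close>-th given matrix. A run fails (\<open>None\<close>) if it
  divides by zero or takes the root of anything but a positive real.\<close>

datatype procedure =
    Entry nat nat nat
  | Unit
  | Plus procedure procedure
  | Minus procedure procedure
  | Times procedure procedure
  | Divide procedure procedure
  | Conj procedure
  | Root procedure

primrec run :: "complex mat list \<Rightarrow> procedure \<Rightarrow> complex option" where
  "run Ms (Entry m i j) =
     (if m < length Ms \<and> i < dim_row (Ms ! m) \<and> j < dim_col (Ms ! m)
      then Some ((Ms ! m) $$ (i,j)) else None)"
| "run Ms Unit = Some 1"
| "run Ms (Plus p q) =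
     (case (run Ms p, run Ms q) of (Some x, Some y) \<Rightarrow> Some (x + y) | _ \<Rightarrow> None)"
| "run Ms (Minus p q) =
     (case (run Ms p, run Ms q) of (Some x, Some y) \<Rightarrow> Some (x - y) | _ \<Rightarrow> None)"
| "run Ms (Times p q) =
     (case (run Ms p, run Ms q) of (Some x, Some y) \<Rightarrow> Some (x * y) | _ \<Rightarrow> None)"
| "run Ms (Divide p q) =
     (case (run Ms p, run Ms q) of
        (Some x, Some y) \<Rightarrow> if y = 0 then None else Some (x / y) | _ \<Rightarrow> None)"
| "run Ms (Conj p) = (case run Ms p of Some x \<Rightarrow> Some (cnj x) | None \<Rightarrow> None)"
| "run Ms (Root p) =
     (case run Ms p of
        Some x \<Rightarrow> if x \<in> \<real> \<and> 0 < Re x then Some (complex_of_real (sqrt (Re x))) else None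
      | None \<Rightarrow> None)"

text \<open>For a family of bijections \<open>F B : S \<rightarrow> T\<close> with parameter \<open>B \<in> T\<close>: one procedure per entry,
  the same for all inputs, computes \<open>(F B)\<^sup>-\<^sup>1 A\<close> from the entries of \<open>A\<close> and \<open>B\<close>.\<close>

definition algorithmic_inverse ::
  "nat \<Rightarrow> complex mat set \<Rightarrow> complex mat set \<Rightarrow> (complex mat \<Rightarrow> complex mat \<Rightarrow> complex mat) \<Rightarrow> bool"
  where
  "algorithmic_inverse n S T F \<longleftrightarrow>
     (\<exists>p :: nat \<Rightarrow> nat \<Rightarrow> procedure. \<forall>B\<in>T. \<forall>A\<in>T. \<forall>i<n. \<forall>j<n.
        run [A, B] (p i j) = Some (inv_into S (F B) A $$ (i,j)))"


section \<open>Real inner product spaces on carrier sets\<close>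

record 'a ips = "(real, 'a) module" +
  ip :: "'a \<Rightarrow> 'a \<Rightarrow> real"

locale real_ips = vectorspace "class_ring :: real ring" X for X :: "'a ips" +
  assumes ip_commute: "x \<in> carrier X \<Longrightarrow> y \<in> carrier X \<Longrightarrow> ip X x y = ip X y x"
    and ip_add: "x \<in> carrier X \<Longrightarrow> y \<in> carrier X \<Longrightarrow> z \<in> carrier X \<Longrightarrow>
      ip X (x \<oplus>\<^bsub>X\<^esub> y) z = ip X x z + ip X y z"
    and ip_smult: "x \<in> carrier X \<Longrightarrow> y \<in> carrier X \<Longrightarrow> ip X (a \<odot>\<^bsub>X\<^esub> x) y = a * ip X x y"
    and ip_pos: "x \<in> carrier X \<Longrightarrow> x \<noteq> \<zero>\<^bsub>X\<^esub> \<Longrightarrow> 0 < ip X x x"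

text \<open>\<open>Metric_space\<close> asks for symmetry and nonnegativity also outside the carrier, hence the cut-off.\<close>

definition ip_dist :: "'a ips \<Rightarrow> 'a \<Rightarrow> 'a \<Rightarrow> real" where
  "ip_dist X x y =
     (if x \<in> carrier X \<and> y \<in> carrier X then sqrt (ip X (x \<ominus>\<^bsub>X\<^esub> y) (x \<ominus>\<^bsub>X\<^esub> y)) else 0)"

locale real_hilbert_space = real_ips +
  assumes complete: "Metric_space.mcomplete (carrier X) (ip_dist X)"

definition isometric_map :: "'a ips \<Rightarrow> 'b ips \<Rightarrow> ('a \<Rightarrow> 'b) \<Rightarrow> bool" where
  "isometric_map X Y f \<longleftrightarrow>
     real_ips X \<and> real_ips Y \<and> linear_map (class_ring :: real ring) X Y f \<and>
     (\<forall>x\<in>carrier X. \<forall>y\<in>carrier X. ip Y (f x) (f y) = ip X x y)"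

definition isometric_iso :: "'a ips \<Rightarrow> 'b ips \<Rightarrow> ('a \<Rightarrow> 'b) \<Rightarrow> bool" where
  "isometric_iso X Y f \<longleftrightarrow> isometric_map X Y f \<and> bij_betw f (carrier X) (carrier Y)"

definition isometrically_isomorphic :: "'a ips \<Rightarrow> 'b ips \<Rightarrow> bool" where
  "isometrically_isomorphic X Y \<longleftrightarrow> (\<exists>f. isometric_iso X Y f)"

definition transport :: "('a \<Rightarrow> 'b) \<Rightarrow> 'a ips \<Rightarrow> 'b set \<Rightarrow> 'b ips" where
  "transport f X T =
     (let g = inv_into (carrier X) f in
      \<lparr>carrier = T, mult = undefined, one = undefined, zero = f \<zero>\<^bsub>X\<^esub>,
       add = (\<lambda>a b. f (g a \<oplus>\<^bsub>X\<^esub> g b)), smult = (\<lambda>r a. f (r \<odot>\<^bsub>X\<^esub> g a)),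
       ip = (\<lambda>a b. ip X (g a) (g b))\<rparr>)"

text \<open>\<open>X\<close> with the maps \<open>\<iota> n\<close> is the direct limit of \<open>S 1 \<rightarrow> S 2 \<rightarrow> \<dots>\<close> (connecting maps \<open>j n\<close>): every
  compatible family of linear maps into a real vector space \<open>Y\<close> factors uniquely through \<open>X\<close>, and
  the factorisation is isometric if all members of the family are. The type argument is the
  element type of the test spaces \<open>Y\<close>.\<close>

definition direct_limit ::
  "'c itself \<Rightarrow> (nat \<Rightarrow> 'a ips) \<Rightarrow> (nat \<Rightarrow> 'a \<Rightarrow> 'a) \<Rightarrow> 'b ips \<Rightarrow> (nat \<Rightarrow> 'a \<Rightarrow> 'b) \<Rightarrow> bool" where
  "direct_limit ty S j X \<iota> \<longleftrightarrow>
     (\<forall>n\<ge>1. isometric_map (S n) (S (Suc n)) (j n)) \<and>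
     (\<forall>n\<ge>1. isometric_map (S n) X (\<iota> n)) \<and>
     (\<forall>n\<ge>1. \<forall>x\<in>carrier (S n). \<iota> (Suc n) (j n x) = \<iota> n x) \<and>
     (\<forall>(Y :: 'c ips) g.
        (\<forall>n\<ge>1. linear_map (class_ring :: real ring) (S n) Y (g n)) \<and>
        (\<forall>n\<ge>1. \<forall>x\<in>carrier (S n). g (Suc n) (j n x) = g n x) \<longrightarrow>
        (\<exists>!h. h \<in> extensional (carrier X) \<and> linear_map (class_ring :: real ring) X Y h \<and>
              (\<forall>n\<ge>1. \<forall>x\<in>carrier (S n). h (\<iota> n x) = g n x))) \<and>
     (\<forall>(Y :: 'c ips) h.
        linear_map (class_ring :: real ring) X Y h \<and>
        (\<forall>n\<ge>1. isometric_map (S n) Y (h \<circ> \<iota> n)) \<longrightarrow> isometric_map X Y h)"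

definition Euclid :: "nat \<Rightarrow> real vec ips" where
  "Euclid m = module.extend (module_vec TYPE(real) m) (ips.fields scalar_prod)"

text \<open>For complex sequences, \<open>inner z w\<close> is \<open>Re (cnj z * w)\<close>.\<close>

definition seq_space :: "(nat \<Rightarrow> 'v::real_inner) set \<Rightarrow> (nat \<Rightarrow> 'v) ips" where
  "seq_space S =
     \<lparr>carrier = S, mult = undefined, one = undefined, zero = (\<lambda>_. 0),
      add = (\<lambda>x y i. x i + y i), smult = (\<lambda>r x i. r *\<^sub>R x i),
      ip = (\<lambda>x y. \<Sum>\<^sub>\<infinity>i. inner (x i) (y i))\<rparr>"

definition c00 :: "(nat \<Rightarrow> 'v::real_inner) ips" where
  "c00 = seq_space {x. finite {i. x i \<noteq> 0}}"

definition ell2 :: "(nat \<Rightarrow> 'v::real_inner) ips" where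
  "ell2 = seq_space {x. (\<lambda>i. (norm (x i))\<^sup>2) summable_on UNIV}"

definition ips_sum :: "'a ips \<Rightarrow> 'b ips \<Rightarrow> ('a \<times> 'b) ips" where
  "ips_sum X Y =
     module.extend (direct_sum X Y)
       (ips.fields (\<lambda>v w. ip X (fst v) (fst w) + ip Y (snd v) (snd w)))"


section \<open>The spaces of finite triangular and LPM/TPM matrices\<close>

definition Lspace :: "nat \<Rightarrow> complex mat ips" where
  "Lspace n =
     \<lparr>carrier = Lmat n, mult = undefined, one = undefined, zero = 1\<^sub>m n,
      add = (\<lambda>L K. mat n n (\<lambda>(i,j).
        if j < i then L $$ (i,j) + K $$ (i,j)
        else if i = j then L $$ (i,i) * K $$ (i,i) else 0)),
      smult = (\<lambda>r L. mat n n (\<lambda>(i,j).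
        if j < i then complex_of_real r * L $$ (i,j)
        else if i = j then complex_of_real (Re (L $$ (i,i)) powr r) else 0)),
      ip = (\<lambda>L K. Re (\<Sum>i<n. \<Sum>j<i. cnj (L $$ (i,j)) * K $$ (i,j)) +
        (\<Sum>j<n. ln (Re (L $$ (j,j))) * ln (Re (K $$ (j,j)))))\<rparr>"

definition LDL :: "nat \<Rightarrow> (nat \<Rightarrow> real) \<Rightarrow> complex mat \<Rightarrow> complex mat" where
  "LDL n e L = L * Dmat n e * mat_adjoint L"

definition LPDPL :: "nat \<Rightarrow> (nat \<Rightarrow> real) \<Rightarrow> complex mat \<Rightarrow> complex mat" where
  "LPDPL n e L = mat_adjoint L * (Pmat n * Dmat n e * Pmat n) * L"

definition LPMspace :: "nat \<Rightarrow> (nat \<Rightarrow> real) \<Rightarrow> complex mat ips" where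
  "LPMspace n e = transport (LDL n e) (Lspace n) (LPM n e)"

definition TPMspace :: "nat \<Rightarrow> (nat \<Rightarrow> real) \<Rightarrow> complex mat ips" where
  "TPMspace n e = transport (LPDPL n e) (Lspace n) (TPM n e)"

definition bordered :: "nat \<Rightarrow> complex \<Rightarrow> complex mat \<Rightarrow> complex mat" where
  "bordered n c A = four_block_mat A (0\<^sub>m n 1) (0\<^sub>m 1 n) (mat 1 1 (\<lambda>_. c))"


section \<open>Semi-infinite matrices\<close>

type_synonym smat = "nat \<Rightarrow> nat \<Rightarrow> complex"

definition smat_mult :: "smat \<Rightarrow> smat \<Rightarrow> smat" where
  "smat_mult A B = (\<lambda>i j. \<Sum>\<^sub>\<infinity>k. A i k * B k j)"

definition smat_adjoint :: "smat \<Rightarrow> smat" where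
  "smat_adjoint A = (\<lambda>i j. cnj (A j i))"

definition Dsmat :: "(nat \<Rightarrow> real) \<Rightarrow> smat" where
  "Dsmat e = (\<lambda>i j. if i = j then complex_of_real (dsign e i) else 0)"

definition sLDL :: "(nat \<Rightarrow> real) \<Rightarrow> smat \<Rightarrow> smat" where
  "sLDL e L = smat_mult (smat_mult L (Dsmat e)) (smat_adjoint L)"

definition pad :: "nat \<Rightarrow> (nat \<Rightarrow> complex) \<Rightarrow> complex mat \<Rightarrow> smat" where
  "pad n d A = (\<lambda>i j. if i < n \<and> j < n then A $$ (i,j) else if i = j then d i else 0)"

definition Lsmat :: "smat set" where
  "Lsmat = {L. (\<forall>i j. i < j \<longrightarrow> L i j = 0) \<and> (\<forall>i. L i i \<in> \<real> \<and> 0 < Re (L i i))}"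

definition L00 :: "smat set" where
  "L00 = {L \<in> Lsmat. finite {j. L j j \<noteq> 1} \<and> finite {(i,j). j < i \<and> L i j \<noteq> 0}}"

definition LH :: "smat set" where
  "LH = {L \<in> Lsmat. (\<lambda>j. (ln (Re (L j j)))\<^sup>2) summable_on UNIV \<and>
           (\<lambda>(i,j). (cmod (L i j))\<^sup>2) summable_on {(i,j). j < i}}"

definition LPM00 :: "(nat \<Rightarrow> real) \<Rightarrow> smat set" where
  "LPM00 e = {pad n (\<lambda>i. complex_of_real (dsign e i)) A | n A. 1 \<le> n \<and> A \<in> LPM n e}"

definition sLspace :: "smat set \<Rightarrow> smat ips" where
  "sLspace S =
     \<lparr>carrier = S, mult = undefined, one = undefined, zero = (\<lambda>i j. if i = j then 1 else 0),
      add = (\<lambda>L K i j.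
        if j < i then L i j + K i j else if i = j then L i i * K i i else 0),
      smult = (\<lambda>r L i j.
        if j < i then complex_of_real r * L i j
        else if i = j then complex_of_real (Re (L i i) powr r) else 0),
      ip = (\<lambda>L K. Re (\<Sum>\<^sub>\<infinity>(i,j)\<in>{(i,j). j < i}. cnj (L i j) * K i j) +
        (\<Sum>\<^sub>\<infinity>j. ln (Re (L j j)) * ln (Re (K j j))))\<rparr>"

definition L00space :: "smat ips" where
  "L00space = sLspace L00"

definition LHspace :: "smat ips" where
  "LHspace = sLspace LH"

definition LPM00space :: "(nat \<Rightarrow> real) \<Rightarrow> smat ips" where
  "LPM00space e = transport (sLDL e) L00space (LPM00 e)"

definition LPMHspace :: "(nat \<Rightarrow> real) \<Rightarrow> smat ips" where
  "LPMHspace e = transport (sLDL e) LHspace (sLDL e ` LH)"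

text \<open>The first component of \<open>f L\<close> depends only on the diagonal of \<open>L\<close>, the second one only on the
  strictly lower triangular part.\<close>

definition splits_entries :: "smat set \<Rightarrow> (smat \<Rightarrow> 'a \<times> 'b) \<Rightarrow> bool" where
  "splits_entries S f \<longleftrightarrow>
     (\<forall>L\<in>S. \<forall>K\<in>S.
        ((\<forall>j. L j j = K j j) \<longrightarrow> fst (f L) = fst (f K)) \<and>
        ((\<forall>i j. j < i \<longrightarrow> L i j = K i j) \<longrightarrow> snd (f L) = snd (f K)))"

end

theory Submission imports Defs begin

text \<open>The idea behind parts (1) to (3) is a signed Cholesky factorization: a Hermitian matrix with
  leading minors of signs \<open>\<epsilon>\<^sub>1, \<dots>, \<epsilon>\<^sub>n\<close> is \<open>L D L\<^sup>*\<close> for exactly one \<open>L\<close>, because the pivot met in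
  column \<open>j\<close> is the quotient of two consecutive leading minors and so has the sign of \<open>D\<^sub>j\<^sub>j\<close>.
  All entries of \<open>L\<close> are computed with field operations, conjugation and roots of positive reals.
  A function computed by such a procedure is smooth wherever the procedure succeeds, so smoothness
  of the inverse maps comes for free from their being algorithmic. Trailing minors reduce to leading
  ones by reversal, an anti-multiplicative involution, and density of the strata holds since
  \<open>A + t I\<close> has a vanishing leading minor for finitely many \<open>t\<close> only.

  For part (4), logarithms of the diagonal entries and the entries below the diagonal are coordinates
  that turn the operations into those of a Euclidean or sequence space.\<close>

section \<open>Real inner product spaces on carrier sets\<close>

text \<open>An arbitrary base point \<open>B\<close> is no harder than the diagonal one: if A = X D
  X^* and B = M D M^* with triangular X and M, then L = X M^{-1} is the solution of L B L^* = A. So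
  part (2) needs only the factorization and the group \<open>Lmat n\<close>, and forward
  substitution keeps the inverse within field operations. Smoothness can be read off a procedure
  because one procedure has to succeed on the whole open domain: success of all its divisions and
  roots is the very nonvanishing and positivity under which reciprocals and roots can be
  differentiated. The recursion branches on indices and never on entries, so one straight-line
  program per entry serves all inputs. For semi-infinite matrices the product L D L^* raises no
  question of convergence: row i of L ends at column i, so each entry is a finite sum and lives in a
  finite leading block, to which finite uniqueness applies. The direct limits rest on a chain of
  isometries that exhausts the limit space; injectivity makes a compatible family well defined on
  the union.\<close>

lemma real_ipsI:
  fixes X :: "'a ips"
  assumes "\<And>x y. x \<in> carrier X \<Longrightarrow> y \<in> carrier X \<Longrightarrow> x \<oplus>\<^bsub>X\<^esub> y \<in> carrier X"
    and "\<zero>\<^bsub>X\<^esub> \<in> carrier X"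
    and "\<And>x y z. x \<in> carrier X \<Longrightarrow> y \<in> carrier X \<Longrightarrow> z \<in> carrier X \<Longrightarrow>
      x \<oplus>\<^bsub>X\<^esub> y \<oplus>\<^bsub>X\<^esub> z = x \<oplus>\<^bsub>X\<^esub> (y \<oplus>\<^bsub>X\<^esub> z)"
    and "\<And>x y. x \<in> carrier X \<Longrightarrow> y \<in> carrier X \<Longrightarrow> x \<oplus>\<^bsub>X\<^esub> y = y \<oplus>\<^bsub>X\<^esub> x"
    and "\<And>x. x \<in> carrier X \<Longrightarrow> \<zero>\<^bsub>X\<^esub> \<oplus>\<^bsub>X\<^esub> x = x"
    and smult_closed: "\<And>a x. x \<in> carrier X \<Longrightarrow> a \<odot>\<^bsub>X\<^esub> x \<in> carrier X"
    and smult_left: "\<And>a b x. x \<in> carrier X \<Longrightarrow> (a + b) \<odot>\<^bsub>X\<^esub> x = a \<odot>\<^bsub>X\<^esub> x \<oplus>\<^bsub>X\<^esub> b \<odot>\<^bsub>X\<^esub> x"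
    and "\<And>a x y. x \<in> carrier X \<Longrightarrow> y \<in> carrier X \<Longrightarrow>
      a \<odot>\<^bsub>X\<^esub> (x \<oplus>\<^bsub>X\<^esub> y) = a \<odot>\<^bsub>X\<^esub> x \<oplus>\<^bsub>X\<^esub> a \<odot>\<^bsub>X\<^esub> y"
    and "\<And>a b x. x \<in> carrier X \<Longrightarrow> (a * b) \<odot>\<^bsub>X\<^esub> x = a \<odot>\<^bsub>X\<^esub> (b \<odot>\<^bsub>X\<^esub> x)"
    and smult_one: "\<And>x. x \<in> carrier X \<Longrightarrow> 1 \<odot>\<^bsub>X\<^esub> x = x"
    and smult_zero: "\<And>x. x \<in> carrier X \<Longrightarrow> 0 \<odot>\<^bsub>X\<^esub> x = \<zero>\<^bsub>X\<^esub>"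
    and "\<And>x y. x \<in> carrier X \<Longrightarrow> y \<in> carrier X \<Longrightarrow> ip X x y = ip X y x"
    and "\<And>x y z. x \<in> carrier X \<Longrightarrow> y \<in> carrier X \<Longrightarrow> z \<in> carrier X \<Longrightarrow>
      ip X (x \<oplus>\<^bsub>X\<^esub> y) z = ip X x z + ip X y z"
    and "\<And>a x y. x \<in> carrier X \<Longrightarrow> y \<in> carrier X \<Longrightarrow> ip X (a \<odot>\<^bsub>X\<^esub> x) y = a * ip X x y"
    and "\<And>x. x \<in> carrier X \<Longrightarrow> x \<noteq> \<zero>\<^bsub>X\<^esub> \<Longrightarrow> 0 < ip X x x"
  shows "real_ips X"
proof -
  \<comment> \<open>Additive inverses come from the scalars: (-1) x + 1 x = 0 x = 0.\<close>
  have "\<exists>y\<in>carrier X. y \<oplus>\<^bsub>X\<^esub> x = \<zero>\<^bsub>X\<^esub>" if "x \<in> carrier X" for x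
  proof
    show "(-1) \<odot>\<^bsub>X\<^esub> x \<oplus>\<^bsub>X\<^esub> x = \<zero>\<^bsub>X\<^esub>"
      using smult_left[OF that, of "-1" 1] by (simp add: smult_one smult_zero that)
  qed (rule smult_closed[OF that])
  then have "abelian_group X"
    using assms by (intro abelian_groupI) auto
  then show ?thesis
    unfolding real_ips_def real_ips_axioms_def vectorspace_def module_def module_axioms_def
    using assms class_field by (simp add: field_def domain_def)
qed

context real_ips
begin

lemma smult_closed' [simp]: "x \<in> carrier X \<Longrightarrow> a \<odot>\<^bsub>X\<^esub> x \<in> carrier X"
  using smult_closed[of a x] by simp

lemma smult_zero' [simp]: "x \<in> carrier X \<Longrightarrow> 0 \<odot>\<^bsub>X\<^esub> x = \<zero>\<^bsub>X\<^esub>"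
  using lmult_0[of x] by simp

lemma smult_one' [simp]: "x \<in> carrier X \<Longrightarrow> 1 \<odot>\<^bsub>X\<^esub> x = x"
  using smult_one[of x] by simp

lemma smult_add_left: "x \<in> carrier X \<Longrightarrow> (a + b) \<odot>\<^bsub>X\<^esub> x = a \<odot>\<^bsub>X\<^esub> x \<oplus>\<^bsub>X\<^esub> b \<odot>\<^bsub>X\<^esub> x"
  using smult_l_distr[of a b x] by simp

lemma smult_add_right:
  "x \<in> carrier X \<Longrightarrow> y \<in> carrier X \<Longrightarrow> a \<odot>\<^bsub>X\<^esub> (x \<oplus>\<^bsub>X\<^esub> y) = a \<odot>\<^bsub>X\<^esub> x \<oplus>\<^bsub>X\<^esub> a \<odot>\<^bsub>X\<^esub> y"
  using smult_r_distr[of a x y] by simp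

lemma smult_smult: "x \<in> carrier X \<Longrightarrow> (a * b) \<odot>\<^bsub>X\<^esub> x = a \<odot>\<^bsub>X\<^esub> (b \<odot>\<^bsub>X\<^esub> x)"
  using smult_assoc1[of a b x] by simp

lemma uminus_eq_smult: "x \<in> carrier X \<Longrightarrow> \<ominus>\<^bsub>X\<^esub> x = (-1) \<odot>\<^bsub>X\<^esub> x"
  using smult_add_left[of x "-1" 1] by (intro M.minus_equality) auto

lemma minus_eq_smult:
  "x \<in> carrier X \<Longrightarrow> y \<in> carrier X \<Longrightarrow> x \<ominus>\<^bsub>X\<^esub> y = x \<oplus>\<^bsub>X\<^esub> (-1) \<odot>\<^bsub>X\<^esub> y"
  by (simp add: a_minus_def uminus_eq_smult)

lemma ip_zero_left [simp]: "y \<in> carrier X \<Longrightarrow> ip X \<zero>\<^bsub>X\<^esub> y = 0"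
  using ip_smult[of y y 0] by simp

lemma ip_add_right:
  "x \<in> carrier X \<Longrightarrow> y \<in> carrier X \<Longrightarrow> z \<in> carrier X \<Longrightarrow>
    ip X z (x \<oplus>\<^bsub>X\<^esub> y) = ip X z x + ip X z y"
  by (metis M.add.m_closed ip_add ip_commute)

lemma ip_smult_right:
  "x \<in> carrier X \<Longrightarrow> y \<in> carrier X \<Longrightarrow> ip X y (a \<odot>\<^bsub>X\<^esub> x) = a * ip X y x"
  by (metis smult_closed' ip_smult ip_commute)

lemma ip_self_nonneg: "x \<in> carrier X \<Longrightarrow> 0 \<le> ip X x x"
  using ip_pos[of x] by (cases "x = \<zero>\<^bsub>X\<^esub>") auto

lemma ip_self_zero_iff: "x \<in> carrier X \<Longrightarrow> ip X x x = 0 \<longleftrightarrow> x = \<zero>\<^bsub>X\<^esub>"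
  by (metis ip_pos ip_zero_left less_irrefl)

lemma Cauchy_Schwarz:
  assumes [simp]: "x \<in> carrier X" "y \<in> carrier X"
  shows "(ip X x y)\<^sup>2 \<le> ip X x x * ip X y y"
proof (cases "y = \<zero>\<^bsub>X\<^esub>")
  case True
  then show ?thesis by (simp add: ip_commute[of x "\<zero>\<^bsub>X\<^esub>"])
next
  case False
  define c where "c = ip X y y"
  \<comment> \<open>The minimizer of the quadratic t \<mapsto> |x + t y|^2.\<close>
  define t where "t = - ip X x y / c"
  have c: "0 < c" using False by (simp add: c_def ip_pos)
  have "0 \<le> ip X (x \<oplus>\<^bsub>X\<^esub> t \<odot>\<^bsub>X\<^esub> y) (x \<oplus>\<^bsub>X\<^esub> t \<odot>\<^bsub>X\<^esub> y)"
    by (simp add: ip_self_nonneg)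
  also have "\<dots> = ip X x x + 2 * t * ip X x y + t * t * c"
    by (simp add: ip_add ip_add_right ip_smult ip_smult_right ip_commute[of y x] c_def algebra_simps)
  also have "\<dots> = ip X x x - (ip X x y)\<^sup>2 / c"
    using c by (simp add: t_def power2_eq_square)
  finally show ?thesis
    using c by (simp add: pos_divide_le_eq c_def)
qed

lemma sqrt_ip_triangle:
  assumes [simp]: "x \<in> carrier X" "y \<in> carrier X"
  shows "sqrt (ip X (x \<oplus>\<^bsub>X\<^esub> y) (x \<oplus>\<^bsub>X\<^esub> y)) \<le> sqrt (ip X x x) + sqrt (ip X y y)"
proof (rule real_le_lsqrt)
  have "ip X x y \<le> sqrt (ip X x x * ip X y y)"
    using Cauchy_Schwarz[of x y] by (intro real_le_rsqrt) auto
  then have "ip X x y \<le> sqrt (ip X x x) * sqrt (ip X y y)"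
    by (simp add: real_sqrt_mult)
  then show "ip X (x \<oplus>\<^bsub>X\<^esub> y) (x \<oplus>\<^bsub>X\<^esub> y) \<le> (sqrt (ip X x x) + sqrt (ip X y y))\<^sup>2"
    by (simp add: ip_add ip_add_right ip_commute[of y x] power2_sum ip_self_nonneg)
qed (simp add: ip_self_nonneg)

lemma Metric_space_ip_dist: "Metric_space (carrier X) (ip_dist X)"
proof
  show "0 \<le> ip_dist X x y" for x y
    by (simp add: ip_dist_def ip_self_nonneg)
  show "ip_dist X x y = ip_dist X y x" for x y
    by (simp add: ip_dist_def minus_eq_smult ip_add ip_add_right ip_smult ip_smult_right
        ip_commute[of y x])
  show "ip_dist X x y = 0 \<longleftrightarrow> x = y" if "x \<in> carrier X" "y \<in> carrier X" for x y
    using that by (simp add: ip_dist_def ip_self_zero_iff)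
  show "ip_dist X x z \<le> ip_dist X x y + ip_dist X y z"
    if "x \<in> carrier X" "y \<in> carrier X" "z \<in> carrier X" for x y z
  proof -
    have "x \<ominus>\<^bsub>X\<^esub> z = (x \<ominus>\<^bsub>X\<^esub> y) \<oplus>\<^bsub>X\<^esub> (y \<ominus>\<^bsub>X\<^esub> z)"
      using that by (simp add: a_minus_def M.add.m_assoc) (simp add: M.add.m_assoc[symmetric] M.l_neg)
    then show ?thesis
      using that sqrt_ip_triangle[of "x \<ominus>\<^bsub>X\<^esub> y" "y \<ominus>\<^bsub>X\<^esub> z"] by (simp add: ip_dist_def)
  qed
qed

end

text \<open>Completeness spelled out with \<epsilon> and N, so that Cauchy sequences can be moved
  along isometries and into components without entering a metric space locale each time.\<close>

lemma real_hilbert_space_iff: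
  "real_hilbert_space X \<longleftrightarrow> real_ips X \<and>
    (\<forall>\<sigma>. (\<forall>i::nat. \<sigma> i \<in> carrier X) \<and>
      (\<forall>\<epsilon>>0. \<exists>N. \<forall>i\<ge>N. \<forall>j\<ge>N. ip_dist X (\<sigma> i) (\<sigma> j) < \<epsilon>) \<longrightarrow>
      (\<exists>x\<in>carrier X. \<forall>\<epsilon>>0. \<exists>N. \<forall>i\<ge>N. ip_dist X (\<sigma> i) x < \<epsilon>))"
proof (cases "real_ips X")
  case True
  then interpret real_ips X .
  interpret Metric_space "carrier X" "ip_dist X" by (rule Metric_space_ip_dist)
  have "MCauchy \<sigma> \<longleftrightarrow> (\<forall>i. \<sigma> i \<in> carrier X) \<and>
      (\<forall>\<epsilon>>0. \<exists>N. \<forall>i\<ge>N. \<forall>j\<ge>N. ip_dist X (\<sigma> i) (\<sigma> j) < \<epsilon>)" for \<sigma>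
    unfolding MCauchy_def image_subset_iff by blast
  moreover have "(\<exists>x. limitin mtopology \<sigma> x sequentially) \<longleftrightarrow>
      (\<exists>x\<in>carrier X. \<forall>\<epsilon>>0. \<exists>N. \<forall>i\<ge>N. ip_dist X (\<sigma> i) x < \<epsilon>)"
    if "\<forall>i. \<sigma> i \<in> carrier X" for \<sigma>
    using that by (simp add: limit_metric_sequentially Bex_def)
  ultimately have "mcomplete \<longleftrightarrow> (\<forall>\<sigma>. (\<forall>i::nat. \<sigma> i \<in> carrier X) \<and>
      (\<forall>\<epsilon>>0. \<exists>N. \<forall>i\<ge>N. \<forall>j\<ge>N. ip_dist X (\<sigma> i) (\<sigma> j) < \<epsilon>) \<longrightarrow>
      (\<exists>x\<in>carrier X. \<forall>\<epsilon>>0. \<exists>N. \<forall>i\<ge>N. ip_dist X (\<sigma> i) x < \<epsilon>))"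
    unfolding mcomplete_def by (intro all_cong1) auto
  then show ?thesis
    using True by (simp add: real_hilbert_space_def real_hilbert_space_axioms_def)
qed (simp add: real_hilbert_space_def)

section \<open>Isometric maps and transport of structure\<close>

lemma isometric_mapI:
  assumes "real_ips X" "real_ips Y"
    and "\<And>x. x \<in> carrier X \<Longrightarrow> f x \<in> carrier Y"
    and "\<And>x y. x \<in> carrier X \<Longrightarrow> y \<in> carrier X \<Longrightarrow> f (x \<oplus>\<^bsub>X\<^esub> y) = f x \<oplus>\<^bsub>Y\<^esub> f y"
    and "\<And>a x. x \<in> carrier X \<Longrightarrow> f (a \<odot>\<^bsub>X\<^esub> x) = a \<odot>\<^bsub>Y\<^esub> f x"
    and "\<And>x y. x \<in> carrier X \<Longrightarrow> y \<in> carrier X \<Longrightarrow> ip Y (f x) (f y) = ip X x y"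
  shows "isometric_map X Y f"
  using assms unfolding isometric_map_def linear_map_def mod_hom_def mod_hom_axioms_def module_hom_def
  by (auto simp: real_ips_def vectorspace_def)

lemma linear_mapD:
  assumes "linear_map (class_ring :: real ring) X Y f"
  shows "x \<in> carrier X \<Longrightarrow> f x \<in> carrier Y"
    and "x \<in> carrier X \<Longrightarrow> y \<in> carrier X \<Longrightarrow> f (x \<oplus>\<^bsub>X\<^esub> y) = f x \<oplus>\<^bsub>Y\<^esub> f y"
    and "x \<in> carrier X \<Longrightarrow> f (a \<odot>\<^bsub>X\<^esub> x) = a \<odot>\<^bsub>Y\<^esub> f x"
  using assms unfolding linear_map_def mod_hom_def mod_hom_axioms_def module_hom_def by auto

lemma isometric_mapD:
  assumes "isometric_map X Y f"
  shows "real_ips X" "real_ips Y"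
    and "x \<in> carrier X \<Longrightarrow> f x \<in> carrier Y"
    and "x \<in> carrier X \<Longrightarrow> y \<in> carrier X \<Longrightarrow> f (x \<oplus>\<^bsub>X\<^esub> y) = f x \<oplus>\<^bsub>Y\<^esub> f y"
    and "x \<in> carrier X \<Longrightarrow> f (a \<odot>\<^bsub>X\<^esub> x) = a \<odot>\<^bsub>Y\<^esub> f x"
    and "x \<in> carrier X \<Longrightarrow> y \<in> carrier X \<Longrightarrow> ip Y (f x) (f y) = ip X x y"
  using assms linear_mapD[of X Y f] unfolding isometric_map_def by auto

lemma isometric_map_minus:
  assumes "isometric_map X Y f" "x \<in> carrier X" "y \<in> carrier X"
  shows "f (x \<ominus>\<^bsub>X\<^esub> y) = f x \<ominus>\<^bsub>Y\<^esub> f y"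
proof -
  interpret X: real_ips X by (rule isometric_mapD[OF assms(1)])
  interpret Y: real_ips Y by (rule isometric_mapD[OF assms(1)])
  show ?thesis
    using assms by (simp add: X.minus_eq_smult Y.minus_eq_smult isometric_mapD[OF assms(1)])
qed

lemma isometric_map_ip_dist:
  assumes "isometric_map X Y f" "x \<in> carrier X" "y \<in> carrier X"
  shows "ip_dist Y (f x) (f y) = ip_dist X x y"
proof -
  interpret X: real_ips X by (rule isometric_mapD[OF assms(1)])
  show ?thesis
    using assms isometric_mapD[OF assms(1)]
    by (simp add: ip_dist_def isometric_map_minus[OF assms(1), symmetric])
qed

text \<open>Distances are preserved, and points at distance zero coincide.\<close>

lemma isometric_map_inj_on:
  assumes "isometric_map X Y f"
  shows "inj_on f (carrier X)"
proof
  fix x y assume xy: "x \<in> carrier X" "y \<in> carrier X" "f x = f y"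
  interpret X: Metric_space "carrier X" "ip_dist X"
    by (rule real_ips.Metric_space_ip_dist[OF isometric_mapD(1)[OF assms]])
  interpret Y: Metric_space "carrier Y" "ip_dist Y"
    by (rule real_ips.Metric_space_ip_dist[OF isometric_mapD(2)[OF assms]])
  show "x = y"
    using xy isometric_map_ip_dist[OF assms xy(1,2)] isometric_mapD(3)[OF assms] by simp
qed

lemma isometric_map_comp:
  assumes "isometric_map X Y f" "isometric_map Y Z g"
  shows "isometric_map X Z (g \<circ> f)"
  using isometric_mapD[OF assms(1)] isometric_mapD[OF assms(2)] by (intro isometric_mapI) auto

lemma isometric_map_cong:
  assumes "isometric_map X Y f" "\<And>x. x \<in> carrier X \<Longrightarrow> g x = f x"
  shows "isometric_map X Y g"
proof -
  interpret X: real_ips X by (rule isometric_mapD[OF assms(1)])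
  show ?thesis using isometric_mapD[OF assms(1)] assms(2) by (intro isometric_mapI) auto
qed

text \<open>The axioms for X are pulled back from Y: an equation in X may be checked after applying
  the injective f, where it becomes the corresponding law of Y. Thus a single coordinate map
  provides both the structure of a matrix space and its isometry with a standard space. The case
  numbers follow the premises of \<open>real_ipsI\<close>.\<close>

lemma isometric_isoI:
  fixes X :: "'a ips" and Y :: "'b ips"
  assumes Y: "real_ips Y" and bij: "bij_betw f (carrier X) (carrier Y)"
    and zero: "\<zero>\<^bsub>X\<^esub> \<in> carrier X" "f \<zero>\<^bsub>X\<^esub> = \<zero>\<^bsub>Y\<^esub>"
    and add_closed: "\<And>x y. x \<in> carrier X \<Longrightarrow> y \<in> carrier X \<Longrightarrow> x \<oplus>\<^bsub>X\<^esub> y \<in> carrier X"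
    and add: "\<And>x y. x \<in> carrier X \<Longrightarrow> y \<in> carrier X \<Longrightarrow> f (x \<oplus>\<^bsub>X\<^esub> y) = f x \<oplus>\<^bsub>Y\<^esub> f y"
    and smult_closed: "\<And>a x. x \<in> carrier X \<Longrightarrow> a \<odot>\<^bsub>X\<^esub> x \<in> carrier X"
    and smult: "\<And>a x. x \<in> carrier X \<Longrightarrow> f (a \<odot>\<^bsub>X\<^esub> x) = a \<odot>\<^bsub>Y\<^esub> f x"
    and ip: "\<And>x y. x \<in> carrier X \<Longrightarrow> y \<in> carrier X \<Longrightarrow> ip X x y = ip Y (f x) (f y)"
  shows "isometric_iso X Y f"
proof -
  interpret Y: real_ips Y by (rule Y)
  have closed [simp]: "f x \<in> carrier Y" if "x \<in> carrier X" for x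
    using bij that by (auto simp: bij_betw_def)
  have inj: "x = y" if "x \<in> carrier X" "y \<in> carrier X" "f x = f y" for x y
    using bij that by (auto simp: bij_betw_def inj_on_def)
  note [simp] = zero add_closed add smult_closed smult
  have "real_ips X"
  proof (rule real_ipsI, goal_cases)
    case (3 x y z) then show ?case by (intro inj) (auto simp: Y.M.add.m_assoc)
  next
    case (4 x y) then show ?case by (intro inj) (auto simp: Y.M.add.m_comm)
  next
    case (5 x) then show ?case by (intro inj) auto
  next
    case (7 a b x) then show ?case by (intro inj) (auto simp: Y.smult_add_left)
  next
    case (8 a x y) then show ?case by (intro inj) (auto simp: Y.smult_add_right)
  next
    case (9 a b x) then show ?case by (intro inj) (auto simp: Y.smult_smult)
  next
    case (10 x) then show ?case by (intro inj) auto
  next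
    case (11 x) then show ?case by (intro inj) auto
  next
    case (12 x y) then show ?case by (simp add: ip Y.ip_commute)
  next
    case (13 x y z) then show ?case by (simp add: ip Y.ip_add)
  next
    case (14 a x y) then show ?case by (simp add: ip Y.ip_smult)
  next
    case (15 x)
    then have "f x \<noteq> \<zero>\<^bsub>Y\<^esub>" using inj[of x "\<zero>\<^bsub>X\<^esub>"] by auto
    then show ?case using 15 by (simp add: ip Y.ip_pos)
  qed auto
  then show ?thesis
    unfolding isometric_iso_def using Y bij ip by (auto intro!: isometric_mapI)
qed

lemma isometric_isoD:
  assumes "isometric_iso X Y f"
  shows "isometric_map X Y f" "bij_betw f (carrier X) (carrier Y)" "real_ips X" "real_ips Y"
  using assms isometric_mapD unfolding isometric_iso_def by auto

lemma isometric_iso_inv: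
  assumes "isometric_iso X Y f"
  shows "isometric_iso Y X (inv_into (carrier X) f)"
proof -
  let ?g = "inv_into (carrier X) f"
  note f = isometric_isoD[OF assms]
  interpret X: real_ips X by fact
  interpret Y: real_ips Y by fact
  have fg: "f (?g y) = y" "?g y \<in> carrier X" if "y \<in> carrier Y" for y
    using f(2) that by (auto simp: bij_betw_def f_inv_into_f inv_into_into)
  have gf: "?g (f x) = x" if "x \<in> carrier X" for x
    using f(2) that by (auto simp: bij_betw_def)
  note fD = isometric_mapD[OF f(1)]
  have "isometric_map Y X ?g"
  proof (rule isometric_mapI)
    show "?g (x \<oplus>\<^bsub>Y\<^esub> y) = ?g x \<oplus>\<^bsub>X\<^esub> ?g y" if "x \<in> carrier Y" "y \<in> carrier Y" for x y
      using fD(4)[of "?g x" "?g y"] gf[of "?g x \<oplus>\<^bsub>X\<^esub> ?g y"] that by (simp add: fg)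
    show "?g (a \<odot>\<^bsub>Y\<^esub> x) = a \<odot>\<^bsub>X\<^esub> ?g x" if "x \<in> carrier Y" for a x
      using fD(5)[of "?g x" a] gf[of "a \<odot>\<^bsub>X\<^esub> ?g x"] that by (simp add: fg)
    show "ip X (?g x) (?g y) = ip Y x y" if "x \<in> carrier Y" "y \<in> carrier Y" for x y
      using fD(6)[of "?g x" "?g y"] that by (simp add: fg)
  qed (use f fg in auto)
  then show ?thesis
    using bij_betw_inv_into[OF f(2)] by (simp add: isometric_iso_def)
qed

lemma isometric_iso_comp:
  assumes "isometric_iso X Y f" "isometric_iso Y Z g"
  shows "isometric_iso X Z (g \<circ> f)"
  using assms isometric_map_comp bij_betw_trans unfolding isometric_iso_def by blast

text \<open>The operations of \<open>transport\<close> are given through the inverse map, so the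
  inverse is homomorphic by unfolding. It is treated first: \<open>isometric_isoI\<close> then
  yields the axioms of the transported space, which are needed before f itself can be called an
  isometric map.\<close>

lemma isometric_iso_transport:
  assumes X: "real_ips X" and bij: "bij_betw f (carrier X) T"
  shows "isometric_iso X (transport f X T) f"
proof -
  interpret X: real_ips X by (rule X)
  let ?g = "inv_into (carrier X) f"
  have fg: "f (?g y) = y" "?g y \<in> carrier X" if "y \<in> T" for y
    using bij that by (auto simp: bij_betw_def f_inv_into_f inv_into_into)
  have gf [simp]: "?g (f x) = x" "f x \<in> T" if "x \<in> carrier X" for x
    using bij that by (auto simp: bij_betw_def)
  note [simp] = transport_def Let_def
  have "isometric_iso (transport f X T) X ?g"
    using bij_betw_inv_into[OF bij] by (intro isometric_isoI X) (auto simp: fg)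
  then have "real_ips (transport f X T)"
    by (rule isometric_isoD)
  then have "isometric_map X (transport f X T) f"
    by (intro isometric_mapI X) auto
  then show ?thesis
    using bij by (simp add: isometric_iso_def)
qed

lemma real_hilbert_space_isometric_iso:
  assumes f: "isometric_iso X Y f" and Y: "real_hilbert_space Y"
  shows "real_hilbert_space X"
  unfolding real_hilbert_space_iff
proof (intro conjI allI impI; (elim conjE)?)
  show "real_ips X" using f by (rule isometric_isoD)
  fix \<sigma> :: "nat \<Rightarrow> 'a"
  assume \<sigma>: "\<forall>i. \<sigma> i \<in> carrier X"
    and cauchy: "\<forall>\<epsilon>>0. \<exists>N. \<forall>i\<ge>N. \<forall>j\<ge>N. ip_dist X (\<sigma> i) (\<sigma> j) < \<epsilon>"
  note fm = isometric_isoD(1)[OF f]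
  have "\<forall>i. f (\<sigma> i) \<in> carrier Y"
    using isometric_mapD(3)[OF fm] \<sigma> by auto
  moreover have "\<forall>\<epsilon>>0. \<exists>N. \<forall>i\<ge>N. \<forall>j\<ge>N. ip_dist Y (f (\<sigma> i)) (f (\<sigma> j)) < \<epsilon>"
    using cauchy \<sigma> by (simp add: isometric_map_ip_dist[OF fm])
  ultimately obtain y where y: "y \<in> carrier Y" "\<forall>\<epsilon>>0. \<exists>N. \<forall>i\<ge>N. ip_dist Y (f (\<sigma> i)) y < \<epsilon>"
    using Y[unfolded real_hilbert_space_iff, THEN conjunct2, THEN spec[of _ "\<lambda>i. f (\<sigma> i)"]] by blast
  then obtain x where x: "x \<in> carrier X" "y = f x"
    using isometric_isoD(2)[OF f] by (metis bij_betw_imp_surj_on imageE)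
  have "\<forall>\<epsilon>>0. \<exists>N. \<forall>i\<ge>N. ip_dist X (\<sigma> i) x < \<epsilon>"
    using y(2) \<sigma> x by (simp add: isometric_map_ip_dist[OF fm])
  with x show "\<exists>x\<in>carrier X. \<forall>\<epsilon>>0. \<exists>N. \<forall>i\<ge>N. ip_dist X (\<sigma> i) x < \<epsilon>" by blast
qed

subsection \<open>Direct limits\<close>

text \<open>The composite of d connecting maps starting at level n. It brings elements of levels n
  and m to the common level n + m, where they can be compared and added.\<close>

fun push :: "(nat \<Rightarrow> 'a \<Rightarrow> 'a) \<Rightarrow> nat \<Rightarrow> nat \<Rightarrow> 'a \<Rightarrow> 'a" where
  "push j n 0 x = x"
| "push j n (Suc d) x = j (n + d) (push j n d x)"

text \<open>X is in effect an increasing union. A compatible family defines a map on it because two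
  representatives of the same point, pushed to a common level, have the same image under an
  injective \<open>\<iota>\<close> and hence coincide. Linearity and isometry are checked on pairs
  of points, which always share a level.\<close>

lemma direct_limitI:
  fixes X :: "'b ips" and S :: "nat \<Rightarrow> 'a ips"
  assumes j: "\<And>n. 1 \<le> n \<Longrightarrow> isometric_map (S n) (S (Suc n)) (j n)"
    and \<iota>: "\<And>n. 1 \<le> n \<Longrightarrow> isometric_map (S n) X (\<iota> n)"
    and \<iota>j: "\<And>n x. 1 \<le> n \<Longrightarrow> x \<in> carrier (S n) \<Longrightarrow> \<iota> (Suc n) (j n x) = \<iota> n x"
    and cover: "\<And>x. x \<in> carrier X \<Longrightarrow> \<exists>n\<ge>1. x \<in> \<iota> n ` carrier (S n)"
  shows "direct_limit TYPE('c) S j X \<iota>"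
proof -
  interpret X: real_ips X by (rule isometric_mapD(2)[OF \<iota>[of 1]]) simp
  have push: "push j n d x \<in> carrier (S (n + d))" "\<iota> (n + d) (push j n d x) = \<iota> n x"
    if "1 \<le> n" "x \<in> carrier (S n)" for n d x
  proof (induction d)
    case (Suc d)
    { case 1 then show ?case using isometric_mapD(3)[OF j[of "n + d"]] Suc that by simp }
    { case 2 then show ?case using \<iota>j[of "n + d"] Suc that by simp }
  qed (use that in auto)
  have two: "\<exists>n\<ge>1. \<exists>a\<in>carrier (S n). \<exists>b\<in>carrier (S n). \<iota> n a = x \<and> \<iota> n b = y"
    if xy: "x \<in> carrier X" "y \<in> carrier X" for x y
  proof -
    obtain n a where a: "1 \<le> n" "a \<in> carrier (S n)" "\<iota> n a = x" using cover[OF xy(1)] by blast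
    obtain m b where b: "1 \<le> m" "b \<in> carrier (S m)" "\<iota> m b = y" using cover[OF xy(2)] by blast
    show ?thesis
    proof (intro exI[of _ "n + m"] conjI bexI)
      show "\<iota> (n + m) (push j n m a) = x" using push(2)[OF a(1,2), of m] a by simp
      show "\<iota> (n + m) (push j m n b) = y" using push(2)[OF b(1,2), of n] b by (simp add: add.commute)
      show "push j n m a \<in> carrier (S (n + m))" using push(1)[OF a(1,2), of m] .
      show "push j m n b \<in> carrier (S (n + m))" using push(1)[OF b(1,2), of n] by (simp add: add.commute)
    qed (use a in auto)
  qed
  have universal: "\<exists>!h. h \<in> extensional (carrier X) \<and> linear_map (class_ring :: real ring) X Y h \<and>
              (\<forall>n\<ge>1. \<forall>x\<in>carrier (S n). h (\<iota> n x) = g n x)"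
    if g: "\<forall>n\<ge>1. linear_map (class_ring :: real ring) (S n) Y (g n)"
      and gj: "\<forall>n\<ge>1. \<forall>x\<in>carrier (S n). g (Suc n) (j n x) = g n x"
    for Y :: "'c ips" and g
  proof (rule ex1I, intro conjI)
    have g_push: "g (n + d) (push j n d x) = g n x" if "1 \<le> n" "x \<in> carrier (S n)" for n d x
      using that by (induction d) (use push gj in auto)
    have consistent: "g n a = g m b"
      if "1 \<le> n" "a \<in> carrier (S n)" "1 \<le> m" "b \<in> carrier (S m)" "\<iota> n a = \<iota> m b" for n m a b
    proof -
      have "push j n m a = push j m n b"
      proof (rule inj_onD[OF isometric_map_inj_on[OF \<iota>[of "n + m"]]])
        show "\<iota> (n + m) (push j n m a) = \<iota> (n + m) (push j m n b)"
          using push(2)[OF that(1,2), of m] push(2)[OF that(3,4), of n] that(5)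
          by (simp add: add.commute)
        show "push j n m a \<in> carrier (S (n + m))" using push(1)[OF that(1,2), of m] .
        show "push j m n b \<in> carrier (S (n + m))"
          using push(1)[OF that(3,4), of n] by (simp add: add.commute)
      qed (use that in auto)
      then show ?thesis
        using g_push[OF that(1,2), of m] g_push[OF that(3,4), of n] by (simp add: add.commute)
    qed
    \<comment> \<open>The description is unambiguous by \<open>consistent\<close>; the restriction
      makes h extensional, as the uniqueness claim demands.\<close>
    define h where "h = restrict (\<lambda>x. THE y. \<exists>n\<ge>1. \<exists>a\<in>carrier (S n). \<iota> n a = x \<and> y = g n a) (carrier X)"
    have h: "h (\<iota> n a) = g n a" if "1 \<le> n" "a \<in> carrier (S n)" for n a
    proof -
      have "(THE y. \<exists>m\<ge>1. \<exists>b\<in>carrier (S m). \<iota> m b = \<iota> n a \<and> y = g m b) = g n a"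
      proof (rule the_equality)
        fix y assume "\<exists>m\<ge>1. \<exists>b\<in>carrier (S m). \<iota> m b = \<iota> n a \<and> y = g m b"
        then obtain m b where "1 \<le> m" "b \<in> carrier (S m)" "\<iota> m b = \<iota> n a" "y = g m b" by blast
        then show "y = g n a" using consistent[of m b n a] that by simp
      qed (use that in blast)
      then show ?thesis
        using isometric_mapD(3)[OF \<iota>[OF that(1)] that(2)] by (simp add: h_def)
    qed
    show "h \<in> extensional (carrier X)" by (simp add: h_def)
    show "\<forall>n\<ge>1. \<forall>x\<in>carrier (S n). h (\<iota> n x) = g n x" using h by blast
    have Y: "Module.module (class_ring :: real ring) Y"
      using g[rule_format, of 1] by (auto simp: linear_map_def mod_hom_def)
    have "h x \<in> carrier Y" if x: "x \<in> carrier X" for x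
    proof -
      obtain n a where a: "1 \<le> n" "a \<in> carrier (S n)" "\<iota> n a = x" using cover[OF x] by blast
      then show ?thesis using h[OF a(1,2)] linear_mapD(1)[OF g[rule_format, OF a(1)] a(2)] by simp
    qed
    moreover have "h (x \<oplus>\<^bsub>X\<^esub> y) = h x \<oplus>\<^bsub>Y\<^esub> h y" if xy: "x \<in> carrier X" "y \<in> carrier X" for x y
    proof -
      obtain n a b where a: "1 \<le> n" "a \<in> carrier (S n)" "\<iota> n a = x" "b \<in> carrier (S n)" "\<iota> n b = y"
        using two[OF xy] by blast
      interpret Sn: real_ips "S n" by (rule isometric_mapD(1)[OF \<iota>[OF a(1)]])
      have "x \<oplus>\<^bsub>X\<^esub> y = \<iota> n (a \<oplus>\<^bsub>S n\<^esub> b)"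
        using a isometric_mapD(4)[OF \<iota>[OF a(1)]] by simp
      then show ?thesis
        using a h[of n] linear_mapD(2)[OF g[rule_format, OF a(1)], of a b] by (auto simp: Sn.M.add.m_closed)
    qed
    moreover have "h (r \<odot>\<^bsub>X\<^esub> x) = r \<odot>\<^bsub>Y\<^esub> h x" if x: "x \<in> carrier X" for x r
    proof -
      obtain n a where a: "1 \<le> n" "a \<in> carrier (S n)" "\<iota> n a = x" using cover[OF x] by blast
      interpret Sn: real_ips "S n" by (rule isometric_mapD(1)[OF \<iota>[OF a(1)]])
      have "r \<odot>\<^bsub>X\<^esub> x = \<iota> n (r \<odot>\<^bsub>S n\<^esub> a)"
        using a isometric_mapD(5)[OF \<iota>[OF a(1)]] by simp
      then show ?thesis
        using a h[of n] linear_mapD(3)[OF g[rule_format, OF a(1)], of a r] by auto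
    qed
    ultimately show lin: "linear_map (class_ring :: real ring) X Y h"
      using Y X.module_axioms class_field
      by (simp add: linear_map_def mod_hom_def mod_hom_axioms_def module_hom_def vectorspace_def)
    fix h' assume h': "h' \<in> extensional (carrier X) \<and> linear_map (class_ring :: real ring) X Y h' \<and>
              (\<forall>n\<ge>1. \<forall>x\<in>carrier (S n). h' (\<iota> n x) = g n x)"
    show "h' = h"
    proof (rule extensionalityI)
      show "h' \<in> extensional (carrier X)" using h' by blast
      show "h \<in> extensional (carrier X)" by (simp add: h_def)
      show "h' x = h x" if "x \<in> carrier X" for x
        using cover[OF that] h h' by auto
    qed
  qed
  have isometric: "isometric_map X Y h"
    if h: "linear_map (class_ring :: real ring) X Y h"
      and iso: "\<forall>n\<ge>1. isometric_map (S n) Y (h \<circ> \<iota> n)" for Y :: "'c ips" and h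
  proof (rule isometric_mapI)
    show "real_ips X" by (rule X.real_ips_axioms)
    show "real_ips Y" using isometric_mapD(2)[OF iso[rule_format, of 1]] by simp
    show "ip Y (h x) (h y) = ip X x y" if xy: "x \<in> carrier X" "y \<in> carrier X" for x y
    proof -
      obtain n a b where a: "1 \<le> n" "a \<in> carrier (S n)" "\<iota> n a = x" "b \<in> carrier (S n)" "\<iota> n b = y"
        using two[OF xy] by blast
      show ?thesis
        using isometric_mapD(6)[OF iso[rule_format, OF a(1)] a(2,4)]
        unfolding isometric_mapD(6)[OF \<iota>[OF a(1)] a(2,4), symmetric] o_apply a(3,5) .
    qed
  qed (use linear_mapD[OF h] in auto)
  show ?thesis
    unfolding direct_limit_def
    by (intro conjI allI impI ballI; (elim conjE)?)
      (fact j \<iota> \<iota>j | rule universal isometric, assumption+)+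
qed

subsection \<open>Orthogonal sums, Euclidean spaces and sequence spaces\<close>

lemma ips_sum_simps [simp]:
  "carrier (ips_sum X Y) = carrier X \<times> carrier Y"
  "\<zero>\<^bsub>ips_sum X Y\<^esub> = (\<zero>\<^bsub>X\<^esub>, \<zero>\<^bsub>Y\<^esub>)"
  "v \<oplus>\<^bsub>ips_sum X Y\<^esub> w = (fst v \<oplus>\<^bsub>X\<^esub> fst w, snd v \<oplus>\<^bsub>Y\<^esub> snd w)"
  "a \<odot>\<^bsub>ips_sum X Y\<^esub> v = (a \<odot>\<^bsub>X\<^esub> fst v, a \<odot>\<^bsub>Y\<^esub> snd v)"
  "ip (ips_sum X Y) v w = ip X (fst v) (fst w) + ip Y (snd v) (snd w)"
  by (simp_all add: ips_sum_def direct_sum_def module.extend_def ips.fields_def)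

lemma real_ips_sum:
  assumes "real_ips X" "real_ips Y"
  shows "real_ips (ips_sum X Y)"
proof -
  interpret X: real_ips X by fact
  interpret Y: real_ips Y by fact
  show ?thesis
  proof (rule real_ipsI, goal_cases)
    case (15 x)
    then show ?case
      using X.ip_self_nonneg[of "fst x"] Y.ip_self_nonneg[of "snd x"] X.ip_pos[of "fst x"] Y.ip_pos[of "snd x"]
      by (cases "fst x = \<zero>\<^bsub>X\<^esub>") (auto simp: mem_Times_iff prod_eq_iff intro: add_pos_nonneg add_nonneg_pos)
  next
    case (4 x y)
    then show ?case by (auto intro: X.M.add.m_comm Y.M.add.m_comm)
  next
    case (12 x y)
    then show ?case by (simp add: mem_Times_iff X.ip_commute[of "fst x"] Y.ip_commute[of "snd x"])
  qed (auto simp: X.M.add.m_assoc Y.M.add.m_assoc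
      X.smult_add_left Y.smult_add_left X.smult_add_right Y.smult_add_right
      X.smult_smult Y.smult_smult X.ip_add Y.ip_add X.ip_smult Y.ip_smult algebra_simps)
qed

text \<open>Pythagoras. It bounds both component distances by the distance in the sum, and the
  latter by their sum, so Cauchy sequences and limits can be handled componentwise.\<close>

lemma ip_dist_sum:
  assumes "real_ips X" "real_ips Y" "v \<in> carrier (ips_sum X Y)" "w \<in> carrier (ips_sum X Y)"
  shows "ip_dist (ips_sum X Y) v w =
    sqrt ((ip_dist X (fst v) (fst w))\<^sup>2 + (ip_dist Y (snd v) (snd w))\<^sup>2)"
proof -
  interpret X: real_ips X by fact
  interpret Y: real_ips Y by fact
  interpret S: real_ips "ips_sum X Y" by (rule real_ips_sum) fact+
  have vw: "fst v \<in> carrier X" "fst w \<in> carrier X" "snd v \<in> carrier Y" "snd w \<in> carrier Y"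
    using assms(3,4) by (auto simp: mem_Times_iff)
  then have "v \<ominus>\<^bsub>ips_sum X Y\<^esub> w = (fst v \<ominus>\<^bsub>X\<^esub> fst w, snd v \<ominus>\<^bsub>Y\<^esub> snd w)"
    unfolding S.minus_eq_smult[OF assms(3,4)] by (simp add: X.minus_eq_smult Y.minus_eq_smult)
  then show ?thesis
    using assms(3,4) vw by (simp add: ip_dist_def X.ip_self_nonneg Y.ip_self_nonneg)
qed

lemma real_hilbert_space_converges:
  assumes "real_hilbert_space X" "\<forall>i::nat. \<sigma> i \<in> carrier X"
    "\<forall>\<epsilon>>0. \<exists>N. \<forall>i\<ge>N. \<forall>j\<ge>N. ip_dist X (\<sigma> i) (\<sigma> j) < \<epsilon>"
  obtains x where "x \<in> carrier X" "\<forall>\<epsilon>>0. \<exists>N. \<forall>i\<ge>N. ip_dist X (\<sigma> i) x < \<epsilon>"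
proof -
  have "\<exists>x\<in>carrier X. \<forall>\<epsilon>>0. \<exists>N. \<forall>i\<ge>N. ip_dist X (\<sigma> i) x < \<epsilon>"
    using assms(1)[unfolded real_hilbert_space_iff, THEN conjunct2, THEN spec[of _ \<sigma>]]
    by (rule mp) (use assms in simp)
  then show thesis using that by (elim bexE)
qed

lemma real_hilbert_space_sum:
  assumes X: "real_hilbert_space X" and Y: "real_hilbert_space Y"
  shows "real_hilbert_space (ips_sum X Y)"
  unfolding real_hilbert_space_iff
proof (intro conjI allI impI; (elim conjE)?)
  have ips: "real_ips X" "real_ips Y" using X Y by (auto simp: real_hilbert_space_iff)
  show "real_ips (ips_sum X Y)" using ips by (rule real_ips_sum)
  fix \<sigma> :: "nat \<Rightarrow> 'a \<times> 'b"
  assume \<sigma>: "\<forall>i. \<sigma> i \<in> carrier (ips_sum X Y)"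
    and cauchy: "\<forall>\<epsilon>>0. \<exists>N. \<forall>i\<ge>N. \<forall>j\<ge>N. ip_dist (ips_sum X Y) (\<sigma> i) (\<sigma> j) < \<epsilon>"
  have le: "ip_dist X (fst v) (fst w) \<le> ip_dist (ips_sum X Y) v w"
    "ip_dist Y (snd v) (snd w) \<le> ip_dist (ips_sum X Y) v w"
    if "v \<in> carrier (ips_sum X Y)" "w \<in> carrier (ips_sum X Y)" for v w
    unfolding ip_dist_sum[OF ips that] by (simp_all add: real_le_rsqrt)
  have fst: "\<forall>i. fst (\<sigma> i) \<in> carrier X" and snd: "\<forall>i. snd (\<sigma> i) \<in> carrier Y"
    using \<sigma> by (auto simp: mem_Times_iff)
  have fst_cauchy: "\<forall>\<epsilon>>0. \<exists>N. \<forall>i\<ge>N. \<forall>j\<ge>N. ip_dist X (fst (\<sigma> i)) (fst (\<sigma> j)) < \<epsilon>"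
  proof (intro allI impI)
    fix \<epsilon> :: real assume "0 < \<epsilon>"
    then obtain N where "\<forall>i\<ge>N. \<forall>j\<ge>N. ip_dist (ips_sum X Y) (\<sigma> i) (\<sigma> j) < \<epsilon>" using cauchy by blast
    then show "\<exists>N. \<forall>i\<ge>N. \<forall>j\<ge>N. ip_dist X (fst (\<sigma> i)) (fst (\<sigma> j)) < \<epsilon>"
      by (intro exI[of _ N] allI impI le_less_trans[OF le(1)[OF \<sigma>[rule_format] \<sigma>[rule_format]]]) simp
  qed
  have snd_cauchy: "\<forall>\<epsilon>>0. \<exists>N. \<forall>i\<ge>N. \<forall>j\<ge>N. ip_dist Y (snd (\<sigma> i)) (snd (\<sigma> j)) < \<epsilon>"
  proof (intro allI impI)
    fix \<epsilon> :: real assume "0 < \<epsilon>"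
    then obtain N where "\<forall>i\<ge>N. \<forall>j\<ge>N. ip_dist (ips_sum X Y) (\<sigma> i) (\<sigma> j) < \<epsilon>" using cauchy by blast
    then show "\<exists>N. \<forall>i\<ge>N. \<forall>j\<ge>N. ip_dist Y (snd (\<sigma> i)) (snd (\<sigma> j)) < \<epsilon>"
      by (intro exI[of _ N] allI impI le_less_trans[OF le(2)[OF \<sigma>[rule_format] \<sigma>[rule_format]]]) simp
  qed
  obtain x where x: "x \<in> carrier X" "\<forall>\<epsilon>>0. \<exists>N. \<forall>i\<ge>N. ip_dist X (fst (\<sigma> i)) x < \<epsilon>"
    by (rule real_hilbert_space_converges[OF X fst fst_cauchy])
  obtain y where y: "y \<in> carrier Y" "\<forall>\<epsilon>>0. \<exists>N. \<forall>i\<ge>N. ip_dist Y (snd (\<sigma> i)) y < \<epsilon>"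
    by (rule real_hilbert_space_converges[OF Y snd snd_cauchy])
  have xy: "(x, y) \<in> carrier (ips_sum X Y)" using x y by simp
  have "\<exists>N. \<forall>i\<ge>N. ip_dist (ips_sum X Y) (\<sigma> i) (x, y) < \<epsilon>" if "\<epsilon> > 0" for \<epsilon>
  proof -
    have "\<epsilon> / 2 > 0" using that by simp
    then obtain N M where N: "\<forall>i\<ge>N. ip_dist X (fst (\<sigma> i)) x < \<epsilon> / 2"
      and M: "\<forall>i\<ge>M. ip_dist Y (snd (\<sigma> i)) y < \<epsilon> / 2"
      using x(2) y(2) by meson
    have nonneg: "0 \<le> ip_dist X v w" "0 \<le> ip_dist Y v' w'" for v w v' w'
      by (rule Metric_space.nonneg[OF real_ips.Metric_space_ip_dist], rule ips)+
    have "ip_dist (ips_sum X Y) (\<sigma> i) (x, y) < \<epsilon>" if "max N M \<le> i" for i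
    proof -
      have "ip_dist (ips_sum X Y) (\<sigma> i) (x, y) \<le> ip_dist X (fst (\<sigma> i)) x + ip_dist Y (snd (\<sigma> i)) y"
        unfolding ip_dist_sum[OF ips \<sigma>[rule_format] xy] using nonneg by (simp add: sqrt_sum_squares_le_sum)
      also have "\<dots> < \<epsilon> / 2 + \<epsilon> / 2" using N M that by (intro add_strict_mono) auto
      finally show ?thesis by simp
    qed
    then show ?thesis by blast
  qed
  then show "\<exists>x\<in>carrier (ips_sum X Y). \<forall>\<epsilon>>0. \<exists>N. \<forall>i\<ge>N. ip_dist (ips_sum X Y) (\<sigma> i) x < \<epsilon>"
    using xy by blast
qed

lemma Euclid_simps [simp]:
  "carrier (Euclid m) = carrier_vec m" "\<zero>\<^bsub>Euclid m\<^esub> = 0\<^sub>v m" "x \<oplus>\<^bsub>Euclid m\<^esub> y = x + y"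
  "a \<odot>\<^bsub>Euclid m\<^esub> x = a \<cdot>\<^sub>v x" "ip (Euclid m) x y = x \<bullet> y"
  by (simp_all add: Euclid_def module.extend_def ips.fields_def module_vec_def)

lemma real_ips_Euclid: "real_ips (Euclid m)"
proof (rule real_ipsI, goal_cases)
  case (15 x)
  then obtain i where "i < m" "x $ i \<noteq> 0" by (auto simp: vec_eq_iff)
  then have "0 < (\<Sum>i\<in>{0..<m}. x $ i * x $ i)"
    by (intro sum_pos2[of _ i]) (auto simp: zero_less_mult_iff linorder_neq_iff)
  then show ?case using 15 by (simp add: scalar_prod_def)
next
  case (12 x y)
  then show ?case by (simp add: comm_scalar_prod[of _ m])
qed (auto simp: assoc_add_vec[of _ m] comm_add_vec[of _ m] add_smult_distrib_vec
    smult_add_distrib_vec[of _ m] smult_smult_assoc add_scalar_prod_distrib[of _ m])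

lemma seq_space_simps [simp]:
  "carrier (seq_space S) = S" "\<zero>\<^bsub>seq_space S\<^esub> = (\<lambda>_. 0)" "x \<oplus>\<^bsub>seq_space S\<^esub> y = (\<lambda>i. x i + y i)"
  "a \<odot>\<^bsub>seq_space S\<^esub> x = (\<lambda>i. a *\<^sub>R x i)" "ip (seq_space S) x y = (\<Sum>\<^sub>\<infinity>i. inner (x i) (y i))"
  by (simp_all add: seq_space_def)

section \<open>Square-summable families, and completeness of the space they form\<close>

definition square_summable :: "('i \<Rightarrow> 'v::real_normed_vector) \<Rightarrow> 'i set \<Rightarrow> bool" where
  "square_summable x A \<longleftrightarrow> (\<lambda>i. (norm (x i))\<^sup>2) summable_on A"

text \<open>Comparison with |x i|^2 + |y i|^2, which dominates the inner product by Cauchy-Schwarz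
  and 2 a b \<le> a^2 + b^2.\<close>

lemma square_summable_inner:
  fixes x y :: "'i \<Rightarrow> 'v::real_inner"
  assumes "square_summable x A" "square_summable y A"
  shows "(\<lambda>i. inner (x i) (y i)) summable_on A"
proof (rule Infinite_Sum.abs_summable_summable, rule Infinite_Sum.abs_summable_on_comparison_test')
  show "(\<lambda>i. (norm (x i))\<^sup>2 + (norm (y i))\<^sup>2) summable_on A"
    using assms unfolding square_summable_def by (rule summable_on_add)
  show "norm (inner (x i) (y i)) \<le> (norm (x i))\<^sup>2 + (norm (y i))\<^sup>2" for i
  proof -
    have "norm (inner (x i) (y i)) \<le> norm (x i) * norm (y i)"
      using Cauchy_Schwarz_ineq2 by simp
    also have "\<dots> \<le> 2 * norm (x i) * norm (y i)" by simp
    also have "\<dots> \<le> (norm (x i))\<^sup>2 + (norm (y i))\<^sup>2" by (rule sum_squares_bound)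
    finally show ?thesis .
  qed
qed

lemma square_summable_add:
  fixes x y :: "'i \<Rightarrow> 'v::real_inner"
  assumes "square_summable x A" "square_summable y A"
  shows "square_summable (\<lambda>i. x i + y i) A"
proof -
  have "(\<lambda>i. (norm (x i))\<^sup>2 + (norm (y i))\<^sup>2 + 2 * inner (x i) (y i)) summable_on A"
    using assms square_summable_inner[OF assms] unfolding square_summable_def
    by (intro summable_on_add summable_on_cmult_right)
  then show ?thesis
    unfolding square_summable_def
    by (simp add: power2_norm_eq_inner inner_add_left inner_add_right inner_commute algebra_simps)
qed

lemma square_summable_scaleR:
  fixes x :: "'i \<Rightarrow> 'v::real_normed_vector"
  assumes "square_summable x A"
  shows "square_summable (\<lambda>i. a *\<^sub>R x i) A"
  using summable_on_cmult_right[OF assms[unfolded square_summable_def], of "a\<^sup>2"]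
  by (simp add: square_summable_def power_mult_distrib)

lemma square_summable_finite_support:
  assumes "finite {i. x i \<noteq> 0}"
  shows "square_summable x A"
proof -
  have "(\<lambda>i. (norm (x i))\<^sup>2) summable_on (A \<inter> {i. x i \<noteq> 0})"
    using assms by (intro summable_on_finite) auto
  then show ?thesis unfolding square_summable_def
    by (rule summable_on_cong_neutral[THEN iffD1, rotated -1]) auto
qed

text \<open>A common criterion for \<open>c00\<close> and \<open>ell2\<close>. Square summability
  makes the series of inner products summable, which is what additivity of \<open>infsum\<close>
  requires.\<close>

lemma real_ips_seq_space:
  fixes S :: "(nat \<Rightarrow> 'v::real_inner) set"
  assumes S: "\<And>x. x \<in> S \<Longrightarrow> square_summable x UNIV" and zero: "(\<lambda>_. 0) \<in> S"
    and add: "\<And>x y. x \<in> S \<Longrightarrow> y \<in> S \<Longrightarrow> (\<lambda>i. x i + y i) \<in> S"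
    and scale: "\<And>a x. x \<in> S \<Longrightarrow> (\<lambda>i. a *\<^sub>R x i) \<in> S"
  shows "real_ips (seq_space S)"
proof (rule real_ipsI, goal_cases)
  case (13 x y z)
  then show ?case
    by (simp add: inner_add_left) (intro infsum_add square_summable_inner S)
next
  case (14 a x y)
  then show ?case
    by (simp add: infsum_cmult_right')
next
  case (15 x)
  then obtain i where i: "x i \<noteq> 0" by auto
  have "0 < (norm (x i))\<^sup>2" using i by simp
  also have "\<dots> = (\<Sum>\<^sub>\<infinity>i\<in>{i}. (norm (x i))\<^sup>2)" by simp
  also have "\<dots> \<le> (\<Sum>\<^sub>\<infinity>i. (norm (x i))\<^sup>2)"
    using S[of x] 15 by (intro infsum_mono_neutral) (auto simp: square_summable_def)
  finally show ?case by (simp add: power2_norm_eq_inner)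
qed (use assms in \<open>auto simp: algebra_simps inner_commute\<close>)

lemma real_ips_c00: "real_ips (c00 :: (nat \<Rightarrow> 'v::real_inner) ips)"
  unfolding c00_def
proof (rule real_ips_seq_space)
  fix x y :: "nat \<Rightarrow> 'v" assume "x \<in> {x. finite {i. x i \<noteq> 0}}" "y \<in> {x. finite {i. x i \<noteq> 0}}"
  then show "(\<lambda>i. x i + y i) \<in> {x. finite {i. x i \<noteq> 0}}"
    by (auto intro: finite_subset[of _ "{i. x i \<noteq> 0} \<union> {i. y i \<noteq> 0}"])
next
  fix x :: "nat \<Rightarrow> 'v" and a assume "x \<in> {x. finite {i. x i \<noteq> 0}}"
  then show "(\<lambda>i. a *\<^sub>R x i) \<in> {x. finite {i. x i \<noteq> 0}}"
    by (auto intro: finite_subset[of _ "{i. x i \<noteq> 0}"])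
qed (auto intro: square_summable_finite_support)

lemma ell2_eq: "ell2 = seq_space {x. square_summable x UNIV}"
  by (simp add: ell2_def square_summable_def)

lemma real_ips_ell2: "real_ips (ell2 :: (nat \<Rightarrow> 'v::real_inner) ips)"
  unfolding ell2_eq
  by (rule real_ips_seq_space)
    (auto intro: square_summable_add square_summable_scaleR square_summable_finite_support)

text \<open>A Cauchy sequence converges in every coordinate, because one coordinate difference is
  bounded by the distance. The coordinatewise limit y is then shown to be square summable and to be
  the limit in norm.\<close>

lemma real_hilbert_space_ell2: "real_hilbert_space (ell2 :: (nat \<Rightarrow> 'v::{real_inner, banach}) ips)"
  unfolding real_hilbert_space_iff
proof (intro conjI allI impI; (elim conjE)?)
  let ?X = "ell2 :: (nat \<Rightarrow> 'v) ips"
  show "real_ips ?X" by (rule real_ips_ell2)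
  interpret real_ips ?X by (rule real_ips_ell2)
  have carrier: "x \<in> carrier ?X \<longleftrightarrow> square_summable x UNIV" for x by (simp add: ell2_eq)
  have dist: "ip_dist ?X x y = sqrt (\<Sum>\<^sub>\<infinity>i. (norm (x i - y i))\<^sup>2)"
    if "square_summable x UNIV" "square_summable y UNIV" for x y
  proof -
    have "x \<in> carrier ?X" "y \<in> carrier ?X" using that by (auto simp: carrier)
    then have "x \<ominus>\<^bsub>?X\<^esub> y = (\<lambda>i. x i - y i)"
      by (simp add: minus_eq_smult) (simp add: ell2_eq)
    then show ?thesis using that by (simp add: ip_dist_def carrier) (simp add: ell2_eq power2_norm_eq_inner)
  qed
  have diff: "square_summable (\<lambda>i. x i - y i) UNIV"
    if "square_summable x UNIV" "square_summable y UNIV" for x y :: "nat \<Rightarrow> 'v"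
    using square_summable_add[OF that(1) square_summable_scaleR[OF that(2), of "-1"]] by simp
  fix \<sigma> :: "nat \<Rightarrow> nat \<Rightarrow> 'v"
  assume "\<forall>i. \<sigma> i \<in> carrier ?X"
  then have \<sigma>: "square_summable (\<sigma> n) UNIV" for n by (simp add: carrier)
  assume cauchy: "\<forall>\<epsilon>>0. \<exists>N. \<forall>i\<ge>N. \<forall>j\<ge>N. ip_dist ?X (\<sigma> i) (\<sigma> j) < \<epsilon>"
  have finite_le: "(\<Sum>i\<in>F. (norm (\<sigma> m i - \<sigma> n i))\<^sup>2) \<le> (ip_dist ?X (\<sigma> m) (\<sigma> n))\<^sup>2" if "finite F" for F m n
  proof -
    have "(\<Sum>i\<in>F. (norm (\<sigma> m i - \<sigma> n i))\<^sup>2) \<le> (\<Sum>\<^sub>\<infinity>i. (norm (\<sigma> m i - \<sigma> n i))\<^sup>2)"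
      using that diff[OF \<sigma> \<sigma>] by (intro finite_sum_le_infsum) (auto simp: square_summable_def)
    then show ?thesis by (simp add: dist \<sigma> infsum_nonneg)
  qed
  have "Cauchy (\<lambda>n. \<sigma> n i)" for i
  proof (rule metric_CauchyI)
    fix \<epsilon> :: real assume "0 < \<epsilon>"
    then obtain N where N: "\<forall>m\<ge>N. \<forall>n\<ge>N. ip_dist ?X (\<sigma> m) (\<sigma> n) < \<epsilon>" using cauchy by blast
    have "dist (\<sigma> m i) (\<sigma> n i) < \<epsilon>" if "N \<le> m" "N \<le> n" for m n
    proof -
      have "(dist (\<sigma> m i) (\<sigma> n i))\<^sup>2 \<le> (ip_dist ?X (\<sigma> m) (\<sigma> n))\<^sup>2"
        using finite_le[of "{i}" m n] by (simp add: dist_norm)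
      then have "dist (\<sigma> m i) (\<sigma> n i) \<le> ip_dist ?X (\<sigma> m) (\<sigma> n)"
        using Metric_space.nonneg[OF Metric_space_ip_dist] by (rule power2_le_imp_le)
      then show ?thesis using N that by force
    qed
    then show "\<exists>N. \<forall>m\<ge>N. \<forall>n\<ge>N. dist (\<sigma> m i) (\<sigma> n i) < \<epsilon>" by blast
  qed
  then obtain y where y: "\<And>i. (\<lambda>n. \<sigma> n i) \<longlonglongrightarrow> y i"
    unfolding Cauchy_convergent_iff convergent_def by metis
  \<comment> \<open>For a fixed finite F the bound survives the limit n \<rightarrow> \<infinity>,
    and only afterwards does F grow. This order avoids interchanging a limit with an infinite
    sum.\<close>
  have close: "square_summable (\<lambda>i. \<sigma> m i - y i) UNIV \<and> (\<Sum>\<^sub>\<infinity>i. (norm (\<sigma> m i - y i))\<^sup>2) \<le> \<epsilon>\<^sup>2"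
    if N: "\<forall>m\<ge>N. \<forall>n\<ge>N. ip_dist ?X (\<sigma> m) (\<sigma> n) < \<epsilon>" and "N \<le> m" for N m \<epsilon>
  proof -
    have bound: "(\<Sum>i\<in>F. (norm (\<sigma> m i - y i))\<^sup>2) \<le> \<epsilon>\<^sup>2" if "finite F" for F
    proof (rule LIMSEQ_le_const2)
      show "(\<lambda>n. \<Sum>i\<in>F. (norm (\<sigma> m i - \<sigma> n i))\<^sup>2) \<longlonglongrightarrow> (\<Sum>i\<in>F. (norm (\<sigma> m i - y i))\<^sup>2)"
        by (intro tendsto_intros y)
      have "(\<Sum>i\<in>F. (norm (\<sigma> m i - \<sigma> n i))\<^sup>2) \<le> \<epsilon>\<^sup>2" if "N \<le> n" for n
      proof (rule order_trans[OF finite_le[OF \<open>finite F\<close>, of m n]], rule power_mono)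
        show "ip_dist ?X (\<sigma> m) (\<sigma> n) \<le> \<epsilon>" using N \<open>N \<le> m\<close> that by (simp add: less_imp_le)
      qed (rule Metric_space.nonneg[OF Metric_space_ip_dist])
      then show "\<exists>N. \<forall>n\<ge>N. (\<Sum>i\<in>F. (norm (\<sigma> m i - \<sigma> n i))\<^sup>2) \<le> \<epsilon>\<^sup>2" by blast
    qed
    have summable: "(\<lambda>i. (norm (\<sigma> m i - y i))\<^sup>2) summable_on UNIV"
      by (rule nonneg_bdd_above_summable_on) (auto intro!: bdd_aboveI2 bound)
    then have "(\<Sum>\<^sub>\<infinity>i. (norm (\<sigma> m i - y i))\<^sup>2) \<le> \<epsilon>\<^sup>2"
      by (rule infsum_le_finite_sums) (rule bound)
    then show ?thesis using summable by (simp add: square_summable_def)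
  qed
  obtain N where "\<forall>m\<ge>N. \<forall>n\<ge>N. ip_dist ?X (\<sigma> m) (\<sigma> n) < 1"
    using cauchy[rule_format, of 1] by auto
  \<comment> \<open>y is \<open>\<sigma> N\<close> minus the square-summable difference of
    \<open>\<sigma> N\<close> and y.\<close>
  from diff[OF \<sigma>[of N] close[OF this order_refl, THEN conjunct1]]
  have y_summable: "square_summable y UNIV" by simp
  have "\<exists>N. \<forall>n\<ge>N. ip_dist ?X (\<sigma> n) y < \<epsilon>" if "\<epsilon> > 0" for \<epsilon>
  proof -
    \<comment> \<open>The limit preserves only the weak inequality; half of \<epsilon> restores the
      strict one.\<close>
    obtain N where N: "\<forall>m\<ge>N. \<forall>n\<ge>N. ip_dist ?X (\<sigma> m) (\<sigma> n) < \<epsilon> / 2"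
      using cauchy[rule_format, of "\<epsilon> / 2"] \<open>\<epsilon> > 0\<close> by auto
    have "ip_dist ?X (\<sigma> n) y < \<epsilon>" if "N \<le> n" for n
    proof -
      have "ip_dist ?X (\<sigma> n) y \<le> \<epsilon> / 2"
        unfolding dist[OF \<sigma> y_summable]
        by (rule real_le_lsqrt) (use close[OF N that] \<open>\<epsilon> > 0\<close> in auto)
      then show ?thesis using \<open>\<epsilon> > 0\<close> by simp
    qed
    then show ?thesis by blast
  qed
  then show "\<exists>x\<in>carrier ?X. \<forall>\<epsilon>>0. \<exists>N. \<forall>i\<ge>N. ip_dist ?X (\<sigma> i) x < \<epsilon>"
    using y_summable carrier by blast
qed

section \<open>Smooth functions of matrices\<close>

text \<open>As an L2 norm over index pairs, the Frobenius distance inherits its triangle inequality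
  from the one for \<open>L2_set\<close>.\<close>

lemma mat_dist_eq_L2_set:
  "mat_dist n A B = L2_set (\<lambda>(i,j). cmod (A $$ (i,j) - B $$ (i,j))) ({..<n} \<times> {..<n})"
  by (simp add: mat_dist_def L2_set_def sum.cartesian_product case_prod_unfold)

lemma cmod_entry_le_mat_dist:
  assumes "i < n" "j < n"
  shows "cmod (A $$ (i,j) - B $$ (i,j)) \<le> mat_dist n A B"
  unfolding mat_dist_eq_L2_set
  using member_le_L2_set[of "{..<n} \<times> {..<n}" "(i,j)" "\<lambda>(i,j). cmod (A $$ (i,j) - B $$ (i,j))"] assms by simp

interpretation mat: Metric_space "carrier_mat n n" "mat_dist n" for n
proof
  show "0 \<le> mat_dist n A B" for A B
    unfolding mat_dist_eq_L2_set by (rule L2_set_nonneg)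
  show "mat_dist n A B = mat_dist n B A" for A B
    by (simp add: mat_dist_def norm_minus_commute)
  show "mat_dist n A B = 0 \<longleftrightarrow> A = B" if "A \<in> carrier_mat n n" "B \<in> carrier_mat n n" for A B
  proof
    assume "mat_dist n A B = 0"
    then have "cmod (A $$ (i,j) - B $$ (i,j)) \<le> 0" if "i < n" "j < n" for i j
      using cmod_entry_le_mat_dist[OF that, of A B] by simp
    then show "A = B" using that by (intro eq_matI) auto
  qed (simp add: mat_dist_def)
  show "mat_dist n A C \<le> mat_dist n A B + mat_dist n B C" for A B C
  proof -
    have "mat_dist n A C \<le> L2_set (\<lambda>p. (case p of (i,j) \<Rightarrow> cmod (A $$ (i,j) - B $$ (i,j)))
        + (case p of (i,j) \<Rightarrow> cmod (B $$ (i,j) - C $$ (i,j)))) ({..<n} \<times> {..<n})"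
      unfolding mat_dist_eq_L2_set
      by (rule L2_set_mono) (auto intro: norm_diff_triangle_le)
    also have "\<dots> \<le> mat_dist n A B + mat_dist n B C"
      unfolding mat_dist_eq_L2_set by (rule L2_set_triangle_ineq)
    finally show ?thesis .
  qed
qed

lemma topspace_mat_topology [simp]: "topspace (mat_topology n) = carrier_mat n n"
  by (simp add: mat_topology_def)

lemma openin_mat_topology:
  "openin (mat_topology n) U \<longleftrightarrow>
    U \<subseteq> carrier_mat n n \<and> (\<forall>A\<in>U. \<exists>r>0. \<forall>B\<in>carrier_mat n n. mat_dist n A B < r \<longrightarrow> B \<in> U)"
  unfolding mat_topology_def mat.openin_mtopology subset_iff mat.in_mball by blast

lemma continuous_map_entry:
  assumes "i < n" "j < n"
  shows "continuous_map (mat_topology n) euclidean (\<lambda>A. A $$ (i,j))"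
  unfolding continuous_map_def openin_mat_topology
proof (intro conjI allI impI ballI, goal_cases)
  case (3 U A)
  then obtain e where e: "e > 0" "\<And>z. dist z (A $$ (i,j)) < e \<Longrightarrow> z \<in> U"
    by (auto simp: open_dist)
  show ?case
  proof (intro exI[of _ e] conjI ballI impI)
    fix B assume "B \<in> carrier_mat n n" "mat_dist n A B < e"
    then show "B \<in> {A \<in> topspace (mat_topology n). A $$ (i,j) \<in> U}"
      using cmod_entry_le_mat_dist[OF assms, of A B] e(2)[of "B $$ (i,j)"]
      by (simp add: dist_norm norm_minus_commute)
  qed (fact e)
qed auto

text \<open>Continuity point by point along \<open>atin\<close>, so that the limit rules for sums,
  products, conjugates, inverses and roots apply on an abstract topology.\<close>

lemma continuous_map_euclidean_iff:
  "continuous_map X euclidean f \<longleftrightarrow> (\<forall>x\<in>topspace X. (f \<longlongrightarrow> f x) (atin X x))"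
  by (simp add: continuous_map_atin)

text \<open>Unlike \<open>Ck\<close>, this asks for continuity at every order. Then order \<open>Suc k\<close> implies order \<open>k\<close>
  without an appeal to the continuity of differentiable functions, and the product rule iterates.\<close>

primrec Ck_upto ::
  "nat \<Rightarrow> complex mat set \<Rightarrow> complex mat set \<Rightarrow> nat \<Rightarrow> (complex mat \<Rightarrow> complex) \<Rightarrow> bool"
  where
    "Ck_upto n V S 0 g \<longleftrightarrow> continuous_map (subtopology (mat_topology n) S) euclidean g"
  | "Ck_upto n V S (Suc k) g \<longleftrightarrow>
       continuous_map (subtopology (mat_topology n) S) euclidean g \<and>
       (\<forall>H\<in>V. \<exists>g'.
          (\<forall>A\<in>S. ((\<lambda>t::real. g (A + complex_of_real t \<cdot>\<^sub>m H)) has_vector_derivative g' A) (at 0)) \<and>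
          Ck_upto n V S k g')"

lemma Ck_upto_imp_Ck: "Ck_upto n V S k g \<Longrightarrow> Ck n V S k g"
proof (induction k arbitrary: g)
  case (Suc k)
  then show ?case by (auto) blast
qed simp

lemma Ck_upto_continuous: "Ck_upto n V S k g \<Longrightarrow> continuous_map (subtopology (mat_topology n) S) euclidean g"
  by (cases k) auto

lemma Ck_upto_Suc: "Ck_upto n V S (Suc k) g \<Longrightarrow> Ck_upto n V S k g"
proof (induction k arbitrary: g)
  case (Suc k)
  show ?case unfolding Ck_upto.simps(2)[of n V S k]
  proof (intro conjI ballI)
    show "continuous_map (subtopology (mat_topology n) S) euclidean g"
      using Suc.prems by simp
    fix H assume "H \<in> V"
    then obtain g' where
      "\<forall>A\<in>S. ((\<lambda>t::real. g (A + complex_of_real t \<cdot>\<^sub>m H)) has_vector_derivative g' A) (at 0)"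
      "Ck_upto n V S (Suc k) g'"
      using Suc.prems unfolding Ck_upto.simps(2)[of n V S "Suc k"] by blast
    then show "\<exists>g'. (\<forall>A\<in>S. ((\<lambda>t::real. g (A + complex_of_real t \<cdot>\<^sub>m H)) has_vector_derivative g' A) (at 0)) \<and>
        Ck_upto n V S k g'"
      using Suc.IH by blast
  qed
qed simp

lemma Ck_upto_SucE:
  assumes "Ck_upto n V S (Suc k) f" "H \<in> V"
  obtains f' where "\<And>A. A \<in> S \<Longrightarrow>
      ((\<lambda>t::real. f (A + complex_of_real t \<cdot>\<^sub>m H)) has_vector_derivative f' A) (at 0)"
    "Ck_upto n V S k f'"
  using assms unfolding Ck_upto.simps by metis

text \<open>V plays the part of the tangent space: lines from a member of V in the direction of
  another stay in V and, as S is relatively open, lines through a point of S stay in S for small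
  parameters. The instances of V are the Hermitian matrices and the lower triangular ones with real
  diagonal.\<close>

locale smooth_domain =
  fixes n :: nat and V S :: "complex mat set"
  assumes V_carrier: "V \<subseteq> carrier_mat n n"
    and V_closed: "\<And>A H t. A \<in> V \<Longrightarrow> H \<in> V \<Longrightarrow> A + complex_of_real t \<cdot>\<^sub>m H \<in> V"
    and S_open: "openin (subtopology (mat_topology n) V) S"
begin

lemma S_subset: "S \<subseteq> V"
  using openin_subset[OF S_open] by simp

lemma S_carrier: "A \<in> S \<Longrightarrow> A \<in> carrier_mat n n"
  using S_subset V_carrier by auto

lemma topspace_S [simp]: "topspace (subtopology (mat_topology n) S) = S"
  using S_carrier by auto

lemma line_zero [simp]: "A \<in> S \<Longrightarrow> H \<in> V \<Longrightarrow> A + 0 \<cdot>\<^sub>m H = A"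
  using S_carrier[of A] subsetD[OF V_carrier, of H] by (intro eq_matI) auto

text \<open>The distance from A to A + t H is |t| times the Frobenius norm of H, hence small with
  t.\<close>

lemma eventually_line_in_S:
  assumes "A \<in> S" "H \<in> V"
  shows "eventually (\<lambda>t::real. A + complex_of_real t \<cdot>\<^sub>m H \<in> S) (nhds 0)"
proof -
  have carr: "A \<in> carrier_mat n n" "H \<in> carrier_mat n n" using assms S_carrier V_carrier by auto
  obtain U where U: "openin (mat_topology n) U" "S = U \<inter> V"
    using S_open by (auto simp: openin_subtopology)
  then obtain r where r: "r > 0" "\<And>B. B \<in> carrier_mat n n \<Longrightarrow> mat_dist n A B < r \<Longrightarrow> B \<in> U"
    using assms unfolding openin_mat_topology by (metis IntD1)
  let ?f = "\<lambda>t::real. mat_dist n A (A + complex_of_real t \<cdot>\<^sub>m H)"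
  have f: "?f t = sqrt (\<Sum>i<n. \<Sum>j<n. (\<bar>t\<bar> * cmod (H $$ (i,j)))\<^sup>2)" for t
    unfolding mat_dist_def using carr
    by (intro arg_cong[of _ _ sqrt] sum.cong refl) (simp add: norm_mult)
  have "(?f \<longlongrightarrow> sqrt (\<Sum>i<n. \<Sum>j<n. (\<bar>0\<bar> * cmod (H $$ (i,j)))\<^sup>2)) (nhds 0)"
    unfolding f by (intro tendsto_intros filterlim_ident)
  then have "eventually (\<lambda>t. ?f t < r) (nhds 0)"
    by (rule order_tendstoD) (use r in simp)
  then show ?thesis
  proof eventually_elim
    case (elim t)
    have "A \<in> V" using assms S_subset by auto
    then show ?case
      using r(2)[OF _ elim] V_closed[of A H t] assms V_carrier by (auto simp: U(2))
  qed
qed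

text \<open>A derivative at A sees f only on short lines through A, and these stay in S. So the
  values on S determine the derivatives, and the same f' serves for g without an induction on
  k.\<close>

lemma Ck_upto_cong:
  assumes "Ck_upto n V S k f" "\<And>A. A \<in> S \<Longrightarrow> f A = g A"
  shows "Ck_upto n V S k g"
proof -
  have cont: "continuous_map (subtopology (mat_topology n) S) euclidean g"
    using Ck_upto_continuous[OF assms(1)] by (rule continuous_map_eq) (simp add: assms(2))
  show ?thesis
  proof (cases k)
    case (Suc m)
    show ?thesis unfolding Suc Ck_upto.simps
    proof (intro conjI ballI cont)
      fix H assume H: "H \<in> V"
      obtain f' where f': "\<And>A. A \<in> S \<Longrightarrow>
          ((\<lambda>t::real. f (A + complex_of_real t \<cdot>\<^sub>m H)) has_vector_derivative f' A) (at 0)"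
        "Ck_upto n V S m f'"
        using Ck_upto_SucE[OF assms(1)[unfolded Suc] H] by metis
      have "((\<lambda>t::real. g (A + complex_of_real t \<cdot>\<^sub>m H)) has_vector_derivative f' A) (at 0)"
        if A: "A \<in> S" for A
        unfolding has_vector_derivative_def
      proof (rule has_derivative_transform_eventually)
        show "((\<lambda>t::real. f (A + complex_of_real t \<cdot>\<^sub>m H)) has_derivative (\<lambda>x. x *\<^sub>R f' A)) (at 0)"
          using f'(1)[OF A] by (simp add: has_vector_derivative_def)
        show "eventually (\<lambda>t. f (A + complex_of_real t \<cdot>\<^sub>m H) = g (A + complex_of_real t \<cdot>\<^sub>m H)) (at 0)"
          using eventually_line_in_S[OF A H]
          by (auto simp: assms(2) eventually_at_filter elim: eventually_mono)
      qed (use A H assms(2) in auto)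
      then show "\<exists>g'. (\<forall>A\<in>S. ((\<lambda>t::real. g (A + complex_of_real t \<cdot>\<^sub>m H)) has_vector_derivative g' A) (at 0)) \<and>
          Ck_upto n V S m g'"
        using f'(2) by blast
    qed
  qed (use cont in simp)
qed

section \<open>Closure of the smoothness classes under the operations of a procedure\<close>

lemma Ck_upto_const: "Ck_upto n V S k (\<lambda>_. c)"
proof (induction k arbitrary: c)
  case (Suc k)
  show ?case unfolding Ck_upto.simps
    by (intro conjI ballI exI[of _ "\<lambda>_. 0"] Suc) auto
qed simp

lemma Ck_upto_entry:
  assumes "i < n" "j < n"
  shows "Ck_upto n V S k (\<lambda>A. A $$ (i,j))"
proof (cases k)
  case 0
  then show ?thesis using continuous_map_entry[OF assms] by (simp add: continuous_map_from_subtopology)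
next
  case (Suc k)
  show ?thesis unfolding Suc Ck_upto.simps
  proof (intro conjI ballI)
    show "continuous_map (subtopology (mat_topology n) S) euclidean (\<lambda>A. A $$ (i,j))"
      using continuous_map_entry[OF assms] by (simp add: continuous_map_from_subtopology)
    fix H assume H: "H \<in> V"
    have "((\<lambda>t::real. (A + complex_of_real t \<cdot>\<^sub>m H) $$ (i,j)) has_vector_derivative H $$ (i,j)) (at 0)"
      if A: "A \<in> S" for A
    proof -
      have "A \<in> carrier_mat n n" "H \<in> carrier_mat n n"
        using A H V_carrier S_carrier by auto
      then have "(A + complex_of_real t \<cdot>\<^sub>m H) $$ (i,j) = A $$ (i,j) + t *\<^sub>R H $$ (i,j)" for t
        using assms by (simp add: scaleR_conv_of_real)
      then show ?thesis by (auto intro!: derivative_eq_intros)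
    qed
    then show "\<exists>g'. (\<forall>A\<in>S. ((\<lambda>t::real. (A + complex_of_real t \<cdot>\<^sub>m H) $$ (i,j)) has_vector_derivative g' A) (at 0)) \<and>
        Ck_upto n V S k g'"
      by (intro exI[of _ "\<lambda>_. H $$ (i,j)"] conjI ballI Ck_upto_const)
  qed
qed

lemma Ck_upto_cnj: "Ck_upto n V S k f \<Longrightarrow> Ck_upto n V S k (\<lambda>A. cnj (f A))"
proof (induction k arbitrary: f)
  case 0
  then show ?case by (auto simp: continuous_map_euclidean_iff intro: tendsto_cnj)
next
  case (Suc k)
  show ?case unfolding Ck_upto.simps
  proof (intro conjI ballI)
    show "continuous_map (subtopology (mat_topology n) S) euclidean (\<lambda>A. cnj (f A))"
      using Ck_upto_continuous[OF Suc.prems] by (auto simp: continuous_map_euclidean_iff intro: tendsto_cnj)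
    fix H assume H: "H \<in> V"
    obtain f' where d: "\<And>A. A \<in> S \<Longrightarrow>
        ((\<lambda>t::real. f (A + complex_of_real t \<cdot>\<^sub>m H)) has_vector_derivative f' A) (at 0)"
      "Ck_upto n V S k f'"
      using Ck_upto_SucE[OF Suc.prems H] by metis
    from d show "\<exists>g'. (\<forall>A\<in>S. ((\<lambda>t::real. cnj (f (A + complex_of_real t \<cdot>\<^sub>m H))) has_vector_derivative g' A) (at 0)) \<and>
        Ck_upto n V S k g'"
      by (intro exI[of _ "\<lambda>A. cnj (f' A)"] conjI Suc.IH) (auto intro: has_vector_derivative_cnj)
  qed
qed

lemma Ck_upto_add:
  "Ck_upto n V S k f \<Longrightarrow> Ck_upto n V S k g \<Longrightarrow> Ck_upto n V S k (\<lambda>A. f A + g A)"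
proof (induction k arbitrary: f g)
  case 0
  then show ?case by (auto simp: continuous_map_euclidean_iff intro: tendsto_add)
next
  case (Suc k)
  show ?case unfolding Ck_upto.simps
  proof (intro conjI ballI)
    show "continuous_map (subtopology (mat_topology n) S) euclidean (\<lambda>A. f A + g A)"
      using Suc.prems[THEN Ck_upto_continuous] by (auto simp: continuous_map_euclidean_iff intro: tendsto_add)
    fix H assume "H \<in> V"
    then obtain f' g' where "\<And>A. A \<in> S \<Longrightarrow>
        ((\<lambda>t::real. f (A + complex_of_real t \<cdot>\<^sub>m H)) has_vector_derivative f' A) (at 0)"
      "\<And>A. A \<in> S \<Longrightarrow> ((\<lambda>t::real. g (A + complex_of_real t \<cdot>\<^sub>m H)) has_vector_derivative g' A) (at 0)"
      "Ck_upto n V S k f'" "Ck_upto n V S k g'"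
      using Suc.prems by (metis Ck_upto.simps(2))
    then show "\<exists>g'. (\<forall>A\<in>S. ((\<lambda>t::real. f (A + complex_of_real t \<cdot>\<^sub>m H) + g (A + complex_of_real t \<cdot>\<^sub>m H))
        has_vector_derivative g' A) (at 0)) \<and> Ck_upto n V S k g'"
      by (intro exI[of _ "\<lambda>A. f' A + g' A"] conjI Suc.IH) (auto intro: has_vector_derivative_add)
  qed
qed

lemma Ck_upto_mult:
  "Ck_upto n V S k f \<Longrightarrow> Ck_upto n V S k g \<Longrightarrow> Ck_upto n V S k (\<lambda>A. f A * g A)"
proof (induction k arbitrary: f g)
  case 0
  then show ?case by (auto simp: continuous_map_euclidean_iff intro: tendsto_mult)
next
  case (Suc k)
  show ?case unfolding Ck_upto.simps
  proof (intro conjI ballI)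
    show "continuous_map (subtopology (mat_topology n) S) euclidean (\<lambda>A. f A * g A)"
      using Suc.prems[THEN Ck_upto_continuous] by (auto simp: continuous_map_euclidean_iff intro: tendsto_mult)
    fix H assume H: "H \<in> V"
    then obtain f' g' where d: "\<And>A. A \<in> S \<Longrightarrow>
        ((\<lambda>t::real. f (A + complex_of_real t \<cdot>\<^sub>m H)) has_vector_derivative f' A) (at 0)"
      "\<And>A. A \<in> S \<Longrightarrow> ((\<lambda>t::real. g (A + complex_of_real t \<cdot>\<^sub>m H)) has_vector_derivative g' A) (at 0)"
      "Ck_upto n V S k f'" "Ck_upto n V S k g'"
      using Suc.prems by (metis Ck_upto.simps(2))
    have "((\<lambda>t::real. f (A + complex_of_real t \<cdot>\<^sub>m H) * g (A + complex_of_real t \<cdot>\<^sub>m H))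
        has_vector_derivative f A * g' A + f' A * g A) (at 0)" if "A \<in> S" for A
      using has_vector_derivative_mult[OF d(1,2)[OF that]] that H by simp
    moreover have "Ck_upto n V S k (\<lambda>A. f A * g' A + f' A * g A)"
      by (intro Ck_upto_add Suc.IH d Suc.prems[THEN Ck_upto_Suc])
    ultimately show "\<exists>g'. (\<forall>A\<in>S. ((\<lambda>t::real. f (A + complex_of_real t \<cdot>\<^sub>m H) * g (A + complex_of_real t \<cdot>\<^sub>m H))
        has_vector_derivative g' A) (at 0)) \<and> Ck_upto n V S k g'"
      by (intro exI[of _ "\<lambda>A. f A * g' A + f' A * g A"]) blast
  qed
qed

text \<open>The derivative - f' / f^2 is made of f' and of 1 / f one order lower, so the claim
  reproduces itself in the induction on k.\<close>

lemma Ck_upto_inverse: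
  assumes "\<And>A. A \<in> S \<Longrightarrow> f A \<noteq> 0"
  shows "Ck_upto n V S k f \<Longrightarrow> Ck_upto n V S k (\<lambda>A. inverse (f A))"
proof (induction k)
  case 0
  then show ?case using assms by (auto simp: continuous_map_euclidean_iff intro!: tendsto_inverse)
next
  case (Suc k)
  show ?case unfolding Ck_upto.simps
  proof (intro conjI ballI)
    show "continuous_map (subtopology (mat_topology n) S) euclidean (\<lambda>A. inverse (f A))"
      using Suc.prems[THEN Ck_upto_continuous] assms
      by (auto simp: continuous_map_euclidean_iff intro!: tendsto_inverse)
    fix H assume H: "H \<in> V"
    obtain f' where d: "\<And>A. A \<in> S \<Longrightarrow>
        ((\<lambda>t::real. f (A + complex_of_real t \<cdot>\<^sub>m H)) has_vector_derivative f' A) (at 0)"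
      "Ck_upto n V S k f'"
      using Ck_upto_SucE[OF Suc.prems H] by metis
    have "((\<lambda>t::real. inverse (f (A + complex_of_real t \<cdot>\<^sub>m H)))
        has_vector_derivative (-1) * (f' A * (inverse (f A) * inverse (f A)))) (at 0)" if A: "A \<in> S" for A
    proof -
      have "(inverse has_field_derivative - (inverse (f A) * inverse (f A))) (at (f (A + complex_of_real 0 \<cdot>\<^sub>m H)))"
        using DERIV_inverse'[OF DERIV_ident, of "f A" UNIV] assms[OF A] A H by simp
      from field_vector_diff_chain_at[OF d(1)[OF A] this] show ?thesis by (simp add: o_def)
    qed
    moreover have "Ck_upto n V S k (\<lambda>A. (-1) * (f' A * (inverse (f A) * inverse (f A))))"
      by (intro Ck_upto_mult Ck_upto_const d Suc.IH Suc.prems[THEN Ck_upto_Suc])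
    ultimately show "\<exists>g'. (\<forall>A\<in>S. ((\<lambda>t::real. inverse (f (A + complex_of_real t \<cdot>\<^sub>m H)))
        has_vector_derivative g' A) (at 0)) \<and> Ck_upto n V S k g'"
      by (intro exI[of _ "\<lambda>A. (-1) * (f' A * (inverse (f A) * inverse (f A)))"]) blast
  qed
qed

text \<open>The derivative is Re f' / (2 sqrt (Re f)), so again the function itself reappears one
  order lower. Writing Re f' as (f' + cnj f') / 2 stays within the closure rules at hand, and with
  the 2 from the root this gives the constant 1/4.\<close>

lemma Ck_upto_sqrt:
  assumes "\<And>A. A \<in> S \<Longrightarrow> 0 < Re (f A)"
  shows "Ck_upto n V S k f \<Longrightarrow> Ck_upto n V S k (\<lambda>A. complex_of_real (sqrt (Re (f A))))"
proof (induction k)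
  case 0
  then show ?case by (auto simp: continuous_map_euclidean_iff intro!: tendsto_intros)
next
  case (Suc k)
  let ?r = "\<lambda>A. complex_of_real (sqrt (Re (f A)))"
  show ?case unfolding Ck_upto.simps
  proof (intro conjI ballI)
    show "continuous_map (subtopology (mat_topology n) S) euclidean ?r"
      using Suc.prems[THEN Ck_upto_continuous]
      by (auto simp: continuous_map_euclidean_iff intro!: tendsto_intros)
    fix H assume H: "H \<in> V"
    obtain f' where d: "\<And>A. A \<in> S \<Longrightarrow>
        ((\<lambda>t::real. f (A + complex_of_real t \<cdot>\<^sub>m H)) has_vector_derivative f' A) (at 0)"
      "Ck_upto n V S k f'"
      using Ck_upto_SucE[OF Suc.prems H] by metis
    have deriv: "((\<lambda>t::real. ?r (A + complex_of_real t \<cdot>\<^sub>m H)) has_vector_derivative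
        (f' A + cnj (f' A)) * ((1/4) * inverse (?r A))) (at 0)" if A: "A \<in> S" for A
    proof -
      define \<phi> where "\<phi> = (\<lambda>t::real. Re (f (A + complex_of_real t \<cdot>\<^sub>m H)))"
      have "(\<phi> has_real_derivative Re (f' A)) (at 0)"
        unfolding \<phi>_def using bounded_linear.has_vector_derivative[OF bounded_linear_Re d(1)[OF A]]
        by (simp add: has_real_derivative_iff_has_vector_derivative)
      moreover have \<phi>0: "\<phi> 0 = Re (f A)" "0 < \<phi> 0" using assms[OF A] A H by (simp_all add: \<phi>_def)
      ultimately have "((\<lambda>t. sqrt (\<phi> t)) has_real_derivative Re (f' A) * inverse (sqrt (Re (f A))) / 2) (at 0)"
        using DERIV_chain2[where f = sqrt and g = \<phi> and x = 0, OF DERIV_real_sqrt[OF \<phi>0(2)]]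
        by (simp add: mult.commute)
      then have "((\<lambda>t::real. sqrt (Re (f (A + complex_of_real t \<cdot>\<^sub>m H)))) has_real_derivative
          Re (f' A) * inverse (sqrt (Re (f A))) / 2) (at 0)"
        by (simp add: \<phi>_def)
      then have "((\<lambda>t::real. ?r (A + complex_of_real t \<cdot>\<^sub>m H)) has_vector_derivative
          complex_of_real (Re (f' A) * inverse (sqrt (Re (f A))) / 2)) (at 0)"
        by (intro has_vector_derivative_of_real) (simp add: has_real_derivative_iff_has_vector_derivative)
      moreover have "complex_of_real (Re (f' A) * inverse (sqrt (Re (f A))) / 2) =
          (f' A + cnj (f' A)) * ((1/4) * inverse (?r A))"
        using complex_add_cnj[of "f' A"] by simp
      ultimately show ?thesis by (simp only:)
    qed
    moreover have "Ck_upto n V S k (\<lambda>A. (f' A + cnj (f' A)) * ((1/4) * inverse (?r A)))"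
      by (intro Ck_upto_mult Ck_upto_add Ck_upto_cnj Ck_upto_const Ck_upto_inverse d(2) Suc.IH
          Ck_upto_Suc[OF Suc.prems]) (use assms in \<open>auto simp: less_le\<close>)
    ultimately show "\<exists>g'. (\<forall>A\<in>S. ((\<lambda>t::real. ?r (A + complex_of_real t \<cdot>\<^sub>m H))
        has_vector_derivative g' A) (at 0)) \<and> Ck_upto n V S k g'"
      by (intro exI[of _ "\<lambda>A. (f' A + cnj (f' A)) * ((1/4) * inverse (?r A))"]) blast
  qed
qed

end

subsection \<open>Computable functions of matrices\<close>

text \<open>A single procedure has to serve all of D. If D consists of all lists [A, B], this is the
  algorithmic claim; with B fixed and A ranging over an open domain, it feeds the smoothness
  claim.\<close>

definition computable :: "complex mat list set \<Rightarrow> (complex mat list \<Rightarrow> complex) \<Rightarrow> bool" where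
  "computable D g \<longleftrightarrow> (\<exists>p. \<forall>Ms\<in>D. run Ms p = Some (g Ms))"

lemma computable_cong:
  "computable D f \<Longrightarrow> (\<And>Ms. Ms \<in> D \<Longrightarrow> f Ms = g Ms) \<Longrightarrow> computable D g"
  unfolding computable_def by metis

lemma computable_entry:
  assumes "\<And>Ms. Ms \<in> D \<Longrightarrow> m < length Ms \<and> i < dim_row (Ms ! m) \<and> j < dim_col (Ms ! m)"
  shows "computable D (\<lambda>Ms. Ms ! m $$ (i,j))"
  unfolding computable_def using assms by (intro exI[of _ "Entry m i j"]) simp

lemma computable_one: "computable D (\<lambda>_. 1)"
  unfolding computable_def by (intro exI[of _ Unit]) simp

lemma computable_add: "computable D f \<Longrightarrow> computable D g \<Longrightarrow> computable D (\<lambda>Ms. f Ms + g Ms)"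
  unfolding computable_def by (elim exE, rule_tac x = "Plus p pa" in exI) simp

lemma computable_diff: "computable D f \<Longrightarrow> computable D g \<Longrightarrow> computable D (\<lambda>Ms. f Ms - g Ms)"
  unfolding computable_def by (elim exE, rule_tac x = "Minus p pa" in exI) simp

lemma computable_mult: "computable D f \<Longrightarrow> computable D g \<Longrightarrow> computable D (\<lambda>Ms. f Ms * g Ms)"
  unfolding computable_def by (elim exE, rule_tac x = "Times p pa" in exI) simp

lemma computable_divide:
  "computable D f \<Longrightarrow> computable D g \<Longrightarrow> (\<And>Ms. Ms \<in> D \<Longrightarrow> g Ms \<noteq> 0) \<Longrightarrow> computable D (\<lambda>Ms. f Ms / g Ms)"
  unfolding computable_def by (elim exE, rule_tac x = "Divide p pa" in exI) simp

lemma computable_cnj: "computable D f \<Longrightarrow> computable D (\<lambda>Ms. cnj (f Ms))"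
  unfolding computable_def by (elim exE, rule_tac x = "Conj p" in exI) simp

lemma computable_sqrt:
  "computable D f \<Longrightarrow> (\<And>Ms. Ms \<in> D \<Longrightarrow> f Ms \<in> \<real> \<and> 0 < Re (f Ms)) \<Longrightarrow>
    computable D (\<lambda>Ms. complex_of_real (sqrt (Re (f Ms))))"
  unfolding computable_def by (elim exE, rule_tac x = "Root p" in exI) simp

lemma computable_zero: "computable D (\<lambda>_. 0)"
  using computable_diff[OF computable_one computable_one] by simp

text \<open>The pattern is fixed in advance, so its signs are constants of the program, built from
  the constant 1 by subtraction.\<close>

lemma computable_sign: "s \<in> {-1, 1} \<Longrightarrow> computable D (\<lambda>_. complex_of_real s)"
  using computable_one computable_diff[OF computable_zero computable_one] by auto

lemma computable_sum:
  "(\<And>k. k \<in> K \<Longrightarrow> computable D (f k)) \<Longrightarrow> computable D (\<lambda>Ms. \<Sum>k\<in>K. f k Ms)"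
  by (induction K rule: infinite_finite_induct) (auto intro: computable_zero computable_add)

text \<open>Induction over the procedure. Success on all of S forces denominators to be nonzero and
  radicands to be positive throughout S, which are the side conditions of
  \<open>Ck_upto_inverse\<close> and \<open>Ck_upto_sqrt\<close>. Reads from the fixed matrix B give
  constants.\<close>

lemma (in smooth_domain) Ck_upto_run:
  assumes "\<And>A. A \<in> S \<Longrightarrow> run [A, B] p = Some (g A)"
  shows "Ck_upto n V S k g"
\<comment> \<open>A point of S is needed to learn, from a successful read, that its indices are in
  range.\<close>
proof (cases "S = {}")
  case True
  then show ?thesis using Ck_upto_cong[OF Ck_upto_const[of k 0]] by simp
next
  case False
  from assms show ?thesis
  proof (induction p arbitrary: g)
    case (Entry m i j)
    obtain A where A: "A \<in> S" using False by blast
    show ?case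
    proof (cases "m = 0")
      case True
      then have "i < n" "j < n" using Entry[OF A] S_carrier[OF A] by (auto split: if_splits)
      from Ck_upto_entry[OF this] show ?thesis
      proof (rule Ck_upto_cong)
        show "A $$ (i,j) = g A" if "A \<in> S" for A
          using Entry[OF that] True by (simp split: if_splits)
      qed
    next
      case False
      then have "m = 1" using Entry[OF A] by (auto split: if_splits)
      from Ck_upto_const[of k "B $$ (i,j)"] show ?thesis
      proof (rule Ck_upto_cong)
        show "B $$ (i,j) = g A" if "A \<in> S" for A
          using Entry[OF that] \<open>m = 1\<close> by (simp split: if_splits)
      qed
    qed
  next
    case Unit
    from Ck_upto_const[of k 1] show ?case by (rule Ck_upto_cong) (use Unit in auto)
  next
    case (Plus p q)
    let ?f = "\<lambda>A. the (run [A, B] p)" and ?g = "\<lambda>A. the (run [A, B] q)"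
    have p: "run [A, B] p = Some (?f A)" and q: "run [A, B] q = Some (?g A)" if "A \<in> S" for A
      using Plus.prems[OF that] by (auto split: option.splits)
    from Ck_upto_add[OF Plus.IH(1)[OF p] Plus.IH(2)[OF q]] show ?case
    proof (rule Ck_upto_cong)
      fix A assume "A \<in> S"
      from Plus.prems[OF this] show "?f A + ?g A = g A"
        by (simp split: option.splits if_splits)
    qed
  next
    case (Minus p q)
    let ?f = "\<lambda>A. the (run [A, B] p)" and ?g = "\<lambda>A. the (run [A, B] q)"
    have p: "run [A, B] p = Some (?f A)" and q: "run [A, B] q = Some (?g A)" if "A \<in> S" for A
      using Minus.prems[OF that] by (auto split: option.splits)
    from Ck_upto_add[OF Minus.IH(1)[OF p] Ck_upto_mult[OF Ck_upto_const[of k "-1"] Minus.IH(2)[OF q]]] show ?case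
    proof (rule Ck_upto_cong)
      fix A assume "A \<in> S"
      from Minus.prems[OF this] show "?f A + (-1) * ?g A = g A"
        by (simp split: option.splits if_splits)
    qed
  next
    case (Times p q)
    let ?f = "\<lambda>A. the (run [A, B] p)" and ?g = "\<lambda>A. the (run [A, B] q)"
    have p: "run [A, B] p = Some (?f A)" and q: "run [A, B] q = Some (?g A)" if "A \<in> S" for A
      using Times.prems[OF that] by (auto split: option.splits)
    from Ck_upto_mult[OF Times.IH(1)[OF p] Times.IH(2)[OF q]] show ?case
    proof (rule Ck_upto_cong)
      fix A assume "A \<in> S"
      from Times.prems[OF this] show "?f A * ?g A = g A"
        by (simp split: option.splits if_splits)
    qed
  next
    case (Divide p q)
    let ?f = "\<lambda>A. the (run [A, B] p)" and ?g = "\<lambda>A. the (run [A, B] q)"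
    have p: "run [A, B] p = Some (?f A)" and q: "run [A, B] q = Some (?g A)" if "A \<in> S" for A
      using Divide.prems[OF that] by (auto split: option.splits)
    note Divide.IH(1)[OF p] Divide.IH(2)[OF q]
    moreover have "?g A \<noteq> 0" if "A \<in> S" for A
      using Divide.prems[OF that] by (auto split: option.splits if_splits)
    ultimately have "Ck_upto n V S k (\<lambda>A. ?f A * inverse (?g A))"
      by (intro Ck_upto_mult Ck_upto_inverse) auto
    then show ?case
    proof (rule Ck_upto_cong)
      fix A assume "A \<in> S"
      from Divide.prems[OF this] show "?f A * inverse (?g A) = g A"
        by (simp add: divide_inverse split: option.splits if_splits)
    qed
  next
    case (Conj p)
    let ?f = "\<lambda>A. the (run [A, B] p)"
    have p: "run [A, B] p = Some (?f A)" if "A \<in> S" for A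
      using Conj.prems[OF that] by (auto split: option.splits)
    from Ck_upto_cnj[OF Conj.IH[OF p]] show ?case
    proof (rule Ck_upto_cong)
      fix A assume "A \<in> S"
      from Conj.prems[OF this] show "cnj (?f A) = g A"
        by (simp split: option.splits if_splits)
    qed
  next
    case (Root p)
    let ?f = "\<lambda>A. the (run [A, B] p)"
    have p: "run [A, B] p = Some (?f A)" if "A \<in> S" for A
      using Root.prems[OF that] by (auto split: option.splits)
    note Root.IH[OF p]
    moreover have "0 < Re (?f A)" if "A \<in> S" for A
      using Root.prems[OF that] by (auto split: option.splits if_splits)
    ultimately have "Ck_upto n V S k (\<lambda>A. complex_of_real (sqrt (Re (?f A))))"
      by (intro Ck_upto_sqrt) auto
    then show ?case
    proof (rule Ck_upto_cong)
      fix A assume "A \<in> S"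
      from Root.prems[OF this] show "complex_of_real (sqrt (Re (?f A))) = g A"
        by (simp split: option.splits if_splits)
    qed
  qed
qed

lemma (in smooth_domain) smooth_map_computable:
  assumes "\<And>i j. i < n \<Longrightarrow> j < n \<Longrightarrow> computable ((\<lambda>A. [A, B]) ` S) (\<lambda>Ms. f (Ms ! 0) $$ (i,j))"
  shows "smooth_map n V S f"
proof -
  have "Ck n V S k (\<lambda>A. f A $$ (i,j))" if ij: "i < n" "j < n" for i j k
  proof -
    obtain p where p: "\<forall>A\<in>S. run [A, B] p = Some (f A $$ (i,j))"
      using assms[OF ij] by (auto simp: computable_def)
    show ?thesis by (rule Ck_upto_imp_Ck[OF Ck_upto_run]) (rule p[rule_format])
  qed
  then show ?thesis using S_open by (simp add: smooth_map_def)
qed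

section \<open>Matrix preliminaries\<close>

lemma mat_adjoint_dim [simp]: "dim_row (mat_adjoint A) = dim_col A" "dim_col (mat_adjoint A) = dim_row A"
  by (simp_all add: mat_adjoint_def)

lemma mat_adjoint_index [simp]:
  fixes A :: "complex mat"
  shows "i < dim_col A \<Longrightarrow> j < dim_row A \<Longrightarrow> mat_adjoint A $$ (i,j) = cnj (A $$ (j,i))"
  by (simp add: mat_adjoint_def mat_of_rows_def conjugate_complex_def)

lemma mat_adjoint_carrier [simp]: "A \<in> carrier_mat n m \<Longrightarrow> mat_adjoint A \<in> carrier_mat m n"
  by auto

lemma mult_index_sum:
  "A \<in> carrier_mat n m \<Longrightarrow> B \<in> carrier_mat m k \<Longrightarrow> i < n \<Longrightarrow> j < k \<Longrightarrow>
    (A * B) $$ (i,j) = (\<Sum>l<m. A $$ (i,l) * B $$ (l,j))"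
  by (auto simp: scalar_prod_def atLeast0LessThan intro!: sum.cong)

lemma mat_adjoint_mult:
  fixes A B :: "complex mat"
  assumes "A \<in> carrier_mat n m" "B \<in> carrier_mat m k"
  shows "mat_adjoint (A * B) = mat_adjoint B * mat_adjoint A"
proof (rule eq_matI)
  fix i j assume "i < dim_row (mat_adjoint B * mat_adjoint A)" "j < dim_col (mat_adjoint B * mat_adjoint A)"
  then have ij: "i < k" "j < n" using assms by auto
  have "mat_adjoint (A * B) $$ (i,j) = cnj (\<Sum>l<m. A $$ (j,l) * B $$ (l,i))"
    using ij assms by (subst mat_adjoint_index) (auto simp del: index_mult_mat(1) simp: mult_index_sum[OF assms])
  also have "\<dots> = (mat_adjoint B * mat_adjoint A) $$ (i,j)"
    using ij assms by (auto simp del: index_mult_mat(1) simp: mult_index_sum[of _ k m _ n] mult.commute intro!: sum.cong)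
  finally show "mat_adjoint (A * B) $$ (i,j) = (mat_adjoint B * mat_adjoint A) $$ (i,j)" .
qed (use assms in auto)

lemma herm_iff:
  "A \<in> herm n \<longleftrightarrow> A \<in> carrier_mat n n \<and> (\<forall>i<n. \<forall>j<n. cnj (A $$ (j,i)) = A $$ (i,j))"
  unfolding herm_def mem_Collect_eq
proof (rule conj_cong[OF refl])
  assume A: "A \<in> carrier_mat n n"
  show "mat_adjoint A = A \<longleftrightarrow> (\<forall>i<n. \<forall>j<n. cnj (A $$ (j,i)) = A $$ (i,j))"
  proof
    assume *: "mat_adjoint A = A"
    show "\<forall>i<n. \<forall>j<n. cnj (A $$ (j,i)) = A $$ (i,j)"
      using A by (subst (2) *[symmetric]) auto
  qed (use A in \<open>auto intro!: eq_matI\<close>)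
qed

lemma Dmat_carrier [simp]: "Dmat n e \<in> carrier_mat n n"
  by (simp add: Dmat_def)

text \<open>A submatrix along an interval is a shift of indices: m = 0 gives the leading blocks, m =
  n - k the trailing ones.\<close>

lemma pick_interval: "i < k \<Longrightarrow> pick {m..<m + k} i = m + i"
proof -
  assume "i < k"
  have "{a \<in> {m..<m + k}. a < m + i} = {m..<m + i}" using \<open>i < k\<close> by auto
  then show ?thesis using pick_card_in_set[of "m + i" "{m..<m + k}"] \<open>i < k\<close> by simp
qed

lemma leading_minor_eq:
  assumes "A \<in> carrier_mat n n" "k \<le> n"
  shows "leading_minor A k = det (mat k k (\<lambda>(i,j). A $$ (i,j)))"
proof -
  have card: "card {i. i < n \<and> i < k} = k"
    using assms by (simp add: min_absorb2 conj_commute cong: conj_cong)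
  have "submatrix A {..<k} {..<k} = mat k k (\<lambda>(i,j). A $$ (i,j))"
    using pick_interval[of _ k 0] assms card
    by (intro eq_matI) (auto simp: submatrix_def atLeast0LessThan)
  then show ?thesis by (simp add: leading_minor_def)
qed

lemma trailing_minor_eq:
  assumes "A \<in> carrier_mat n n" "k \<le> n"
  shows "trailing_minor A k = det (mat k k (\<lambda>(i,j). A $$ (n - k + i, n - k + j)))"
proof -
  have "{i. i < n \<and> n - k \<le> i \<and> i < n} = {n - k..<n}" by auto
  then have "card {i. i < n \<and> n - k \<le> i \<and> i < n} = k" using assms by simp
  then have "submatrix A {n - k..<n} {n - k..<n} = mat k k (\<lambda>(i,j). A $$ (n - k + i, n - k + j))"
    using pick_interval[of _ k "n - k"] assms
    by (intro eq_matI) (auto simp: submatrix_def)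
  then show ?thesis using assms by (simp add: trailing_minor_def)
qed

text \<open>After a transposition only conjugation remains, which passes through the Leibniz sum
  since the signs of permutations are real.\<close>

lemma det_mat_adjoint:
  fixes A :: "complex mat"
  assumes "A \<in> carrier_mat n n"
  shows "det (mat_adjoint A) = cnj (det A)"
proof -
  have "det (mat_adjoint A) = det (transpose_mat (mat_adjoint A))"
    using assms by (intro det_transpose[symmetric, of _ n]) auto
  also have "\<dots> = (\<Sum>p | p permutes {0..<n}. signof p * (\<Prod>i = 0..<n. cnj (A $$ (i, p i))))"
    using assms by (subst det_def'[of _ n]) (auto intro!: sum.cong prod.cong simp: permutes_in_image)
  also have "\<dots> = cnj (det A)"
    by (simp add: det_def'[OF assms] sign_def cong: if_cong)
  finally show ?thesis .
qed

text \<open>A leading block of a Hermitian matrix is Hermitian, so its determinant equals its own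
  conjugate.\<close>

lemma herm_minor_real:
  assumes "A \<in> herm n" "k \<le> n"
  shows "leading_minor A k \<in> \<real>"
proof -
  let ?M = "mat k k (\<lambda>(i,j). A $$ (i,j))"
  have "mat_adjoint ?M = ?M"
    using assms by (intro eq_matI) (auto simp: herm_iff)
  then have "cnj (det ?M) = det ?M"
    using det_mat_adjoint[of ?M k] by simp
  then show ?thesis
    using assms by (simp add: leading_minor_eq[of _ n] herm_iff complex_eq_iff complex_is_Real_iff)
qed

text \<open>Splits the condition on the complex \<open>sgn\<close> into reality and a strict real
  inequality. The former is automatic for minors of Hermitian matrices, the latter is an open
  condition.\<close>

lemma sgn_eq_sign_iff:
  assumes "s \<in> {-1, 1 :: real}"
  shows "sgn z = complex_of_real s \<longleftrightarrow> z \<in> \<real> \<and> 0 < s * Re z"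
proof
  assume "sgn z = complex_of_real s"
  then have "z \<noteq> 0" "sgn z * complex_of_real (cmod z) = complex_of_real (s * cmod z)"
    using assms by auto
  moreover from this have "z = complex_of_real (s * cmod z)"
    by (simp add: sgn_eq)
  ultimately obtain r where r: "z = complex_of_real (s * r)" "0 < r"
    by (metis zero_less_norm_iff)
  show "z \<in> \<real> \<and> 0 < s * Re z"
    using r assms unfolding r(1) Re_complex_of_real by auto
next
  assume *: "z \<in> \<real> \<and> 0 < s * Re z"
  then obtain x where x: "z = complex_of_real x" by (auto elim: Reals_cases)
  then have "sgn z = complex_of_real (sgn x)" by (simp add: sgn_of_real)
  moreover have "sgn x = s" using * x assms by (auto simp: sgn_if)
  ultimately show "sgn z = complex_of_real s" by simp
qed

section \<open>Signed Cholesky factorization\<close>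

text \<open>The factors d may be arbitrary complex numbers because the induction over pivots applies
  this with a residual of still unknown sign as the last factor.\<close>

lemma det_ldl:
  fixes L :: "nat \<Rightarrow> nat \<Rightarrow> complex" and d :: "nat \<Rightarrow> complex"
  assumes L: "\<And>i j. i < j \<Longrightarrow> j < m \<Longrightarrow> L i j = 0"
  shows "det (mat m m (\<lambda>(i,j). \<Sum>k<m. L i k * d k * cnj (L j k))) = (\<Prod>k<m. L k k * d k * cnj (L k k))"
proof -
  let ?L = "mat m m (\<lambda>(i,j). L i j)" and ?D = "mat_diag m d"
  have LD: "?L * ?D = mat m m (\<lambda>(i,j). L i j * d j)"
    by (subst mat_diag_mult_right[of _ m]) auto
  have "mat m m (\<lambda>(i,j). \<Sum>k<m. L i k * d k * cnj (L j k)) = ?L * ?D * mat_adjoint ?L"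
    unfolding LD
    by (intro eq_matI) (auto simp: scalar_prod_def atLeast0LessThan intro!: sum.cong)
  also have "det \<dots> = det ?L * det ?D * det (mat_adjoint ?L)"
    using det_mult[of "?L * ?D" m "mat_adjoint ?L"] det_mult[of ?L m ?D]
      mult_carrier_mat[of ?L m m ?D m] by simp
  also have "det ?L = (\<Prod>k<m. L k k)"
    by (subst det_lower_triangular[of m]) (auto simp: L prod_list_diag_prod atLeast0LessThan)
  also have "det ?D = (\<Prod>k<m. d k)"
    by (subst det_lower_triangular[of m]) (auto simp: mat_diag_def prod_list_diag_prod atLeast0LessThan)
  also have "det (mat_adjoint ?L) = cnj (\<Prod>k<m. L k k)"
    using \<open>det ?L = (\<Prod>k<m. L k k)\<close> by (subst det_mat_adjoint[of _ m]) auto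
  finally show ?thesis by (simp add: prod.distrib)
qed

text \<open>Comparing entry (i,j) of A = L D L^* for j \<le> i gives s i = L i j * d j * cnj (L j
  j), where s i is what remains of a i j after the columns before j. At i = j this reads s j = d j *
  (L j j)^2, and multiplying by d j = \<plusminus>1 yields the square of the diagonal entry. Only
  earlier columns are called, so the column index j decreases.\<close>

function chol :: "(nat \<Rightarrow> real) \<Rightarrow> (nat \<Rightarrow> nat \<Rightarrow> complex) \<Rightarrow> nat \<Rightarrow> nat \<Rightarrow> complex" where
  "chol d a i j =
    (let s = (\<lambda>i. a i j - (\<Sum>k<j. chol d a i k * complex_of_real (d k) * cnj (chol d a j k)));
         r = complex_of_real (sqrt (Re (complex_of_real (d j) * s j)))
     in if i < j then 0 else if i = j then r else s i / (complex_of_real (d j) * r))"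
  by auto
termination by (relation "Wellfounded.measure (\<lambda>(d, a, i, j). j)") auto
declare chol.simps [simp del]

text \<open>In a valid factorization this is an entry of the Schur complement of the leading block
  of order j; at i = j it is the pivot.\<close>

definition residual :: "(nat \<Rightarrow> real) \<Rightarrow> (nat \<Rightarrow> nat \<Rightarrow> complex) \<Rightarrow> nat \<Rightarrow> nat \<Rightarrow> complex" where
  "residual d a i j = a i j - (\<Sum>k<j. chol d a i k * complex_of_real (d k) * cnj (chol d a j k))"

lemma chol_upper: "i < j \<Longrightarrow> chol d a i j = 0"
  by (subst chol.simps) simp

lemma chol_diag: "chol d a j j = complex_of_real (sqrt (Re (complex_of_real (d j) * residual d a j j)))"
  by (subst chol.simps) (simp add: residual_def)

lemma chol_below: "j < i \<Longrightarrow> chol d a i j = residual d a i j / (complex_of_real (d j) * chol d a j j)"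
  unfolding chol_diag by (subst chol.simps) (simp add: residual_def)

text \<open>Induction on columns: if the columns before j agree with those of L, the residual at p
  is L p j * d j * L j j. Its value at p = j gives the diagonal entry by a positive root, the others
  follow by division.\<close>

lemma chol_unique:
  assumes d: "\<And>k. k < n \<Longrightarrow> d k \<in> {-1, 1}"
    and upper: "\<And>i j. j < n \<Longrightarrow> i < j \<Longrightarrow> L i j = 0"
    and diag: "\<And>j. j < n \<Longrightarrow> L j j \<in> \<real> \<and> 0 < Re (L j j)"
    and a: "\<And>i j. i < n \<Longrightarrow> j \<le> i \<Longrightarrow> a i j = (\<Sum>k\<le>j. L i k * complex_of_real (d k) * cnj (L j k))"
  shows "i < n \<Longrightarrow> j < n \<Longrightarrow> chol d a i j = L i j"
proof (induction j arbitrary: i rule: less_induct)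
  case (less j)
  obtain r where r: "L j j = complex_of_real r" "0 < r"
    using diag[OF less.prems(2)] by (auto elim: Reals_cases)
  have dj: "complex_of_real (d j) * complex_of_real (d j) = 1" "d j \<noteq> 0"
    using d[OF less.prems(2)] by auto
  have res: "residual d a p j = L p j * complex_of_real (d j) * complex_of_real r" if "p < n" "j \<le> p" for p
  proof -
    have "(\<Sum>k<j. chol d a p k * complex_of_real (d k) * cnj (chol d a j k)) =
        (\<Sum>k<j. L p k * complex_of_real (d k) * cnj (L j k))"
      using less that by (intro sum.cong) auto
    then show ?thesis
      using a[OF that] by (simp add: residual_def r lessThan_Suc_atMost[symmetric])
  qed
  have "complex_of_real (d j) * residual d a j j = complex_of_real (r * r)"
    using res[OF less.prems(2)] r dj by (simp add: mult.left_commute mult.commute)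
  then have diag_eq: "chol d a j j = complex_of_real r"
    using r by (simp add: chol_diag)
  consider "i < j" | "i = j" | "j < i" by linarith
  then show ?case
  proof cases
    case 3
    then show ?thesis
      using res[of i] less.prems r dj by (simp add: chol_below diag_eq)
  qed (use less.prems upper r diag_eq in \<open>auto simp: chol_upper\<close>)
qed

lemma dsign_sign:
  assumes e: "\<And>k. 1 \<le> k \<Longrightarrow> k \<le> n \<Longrightarrow> e k \<in> {-1, 1}" and i: "i < n"
  shows "dsign e i \<in> {-1, 1}"
proof (cases "i = 0")
  case True
  then show ?thesis using e[of 1] i by (simp add: dsign_def)
next
  case False
  then show ?thesis using e[of i] e[of "Suc i"] i by (auto simp: dsign_def)
qed

text \<open>The product e 1 * (e 1 * e 2) * (e 2 * e 3) * ... telescopes since each e k squares to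
  1. This is why the diagonal of D consists of products of neighbouring signs.\<close>

lemma prod_dsign:
  assumes "\<And>k. 1 \<le> k \<Longrightarrow> k \<le> n \<Longrightarrow> e k \<in> {-1, 1}" "1 \<le> m" "m \<le> n"
  shows "(\<Prod>k<m. dsign e k) = e m"
  using assms(2,3)
proof (induction m)
  case (Suc m)
  show ?case
  proof (cases "m = 0")
    case False
    then have "e m * e m = 1" using assms(1)[of m] Suc.prems by auto
    then show ?thesis using Suc False by (simp add: dsign_def)
  qed (simp add: dsign_def)
qed simp

text \<open>Each factor is |l k|^2 times a real sign, so only the telescoping product of signs
  survives. It signs the minors of L D L^* and, inside the recursion, the product of the pivots
  found so far.\<close>

lemma sgn_prod_ldl:
  assumes e: "\<And>k. 1 \<le> k \<Longrightarrow> k \<le> n \<Longrightarrow> e k \<in> {-1, 1}" and m: "1 \<le> m" "m \<le> n"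
    and l: "\<And>k. k < m \<Longrightarrow> l k \<noteq> 0"
  shows "sgn (\<Prod>k<m. l k * complex_of_real (dsign e k) * cnj (l k)) = complex_of_real (e m)"
proof -
  have "l k * complex_of_real x * cnj (l k) = complex_of_real ((cmod (l k))\<^sup>2 * x)" for k x
  proof -
    have "l k * complex_of_real x * cnj (l k) = (l k * cnj (l k)) * complex_of_real x"
      by (simp add: mult_ac)
    then show ?thesis unfolding complex_norm_square[symmetric] by simp
  qed
  then have "(\<Prod>k<m. l k * complex_of_real (dsign e k) * cnj (l k)) =
      complex_of_real ((\<Prod>k<m. (cmod (l k))\<^sup>2) * (\<Prod>k<m. dsign e k))"
    by (simp only: of_real_prod[symmetric] prod.distrib)
  also have "\<dots> = complex_of_real ((\<Prod>k<m. (cmod (l k))\<^sup>2) * e m)"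
    using prod_dsign[OF e m] by simp
  finally have *: "(\<Prod>k<m. l k * complex_of_real (dsign e k) * cnj (l k)) =
      complex_of_real ((\<Prod>k<m. (cmod (l k))\<^sup>2) * e m)" .
  have "0 < (\<Prod>k<m. (cmod (l k))\<^sup>2)" using l by (intro prod_pos) auto
  then show ?thesis
    using e[OF m] unfolding * sgn_eq_sign_iff[OF e[OF m]] Re_complex_of_real by auto
qed

section \<open>Correctness of the recursion when the leading minors have the prescribed
  signs\<close>

context
  fixes n :: nat and e :: "nat \<Rightarrow> real" and a :: "nat \<Rightarrow> nat \<Rightarrow> complex"
  assumes e: "\<And>k. 1 \<le> k \<Longrightarrow> k \<le> n \<Longrightarrow> e k \<in> {-1, 1}"
    and herm: "\<And>i j. i < n \<Longrightarrow> j < n \<Longrightarrow> cnj (a j i) = a i j"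
    and minors: "\<And>k. 1 \<le> k \<Longrightarrow> k \<le> n \<Longrightarrow> sgn (det (mat k k (\<lambda>(i,j). a i j))) = complex_of_real (e k)"
begin

private abbreviation "d \<equiv> dsign e"
private abbreviation "c \<equiv> chol (dsign e) a"
text \<open>\<open>chol\<close> is total and takes \<open>Re\<close> before the root, so its
  diagonal value is a genuine positive root precisely under this condition.\<close>

private definition pivot_ok :: "nat \<Rightarrow> bool" where
  "pivot_ok j \<longleftrightarrow> complex_of_real (d j) * residual d a j j \<in> \<real> \<and>
    0 < Re (complex_of_real (d j) * residual d a j j)"

private lemma d_sign: "j < n \<Longrightarrow> d j \<in> {-1, 1}"
  using dsign_sign[OF e] .

text \<open>An admissible pivot makes the root exact: (c j j)^2 is d j times the residual, so column
  j of the product reproduces a on and below the diagonal.\<close>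

private lemma chol_column:
  assumes ok: "pivot_ok j" and ij: "j \<le> i" "i < n"
  shows "a i j = (\<Sum>k\<le>j. c i k * complex_of_real (d k) * cnj (c j k))"
proof -
  obtain r where r: "complex_of_real (d j) * residual d a j j = complex_of_real (r * r)" "c j j = complex_of_real r" "0 < r"
  proof
    let ?x = "Re (complex_of_real (d j) * residual d a j j)"
    show "c j j = complex_of_real (sqrt ?x)" by (rule chol_diag)
    show "0 < sqrt ?x" using ok by (simp add: pivot_ok_def)
    have "complex_of_real (sqrt ?x * sqrt ?x) = complex_of_real ?x"
      using ok by (simp add: pivot_ok_def del: of_real_mult)
    also have "\<dots> = complex_of_real (d j) * residual d a j j"
      using ok unfolding pivot_ok_def by (metis of_real_Re)
    finally show "complex_of_real (d j) * residual d a j j = complex_of_real (sqrt ?x * sqrt ?x)" by simp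
  qed
  have dj: "complex_of_real (d j) * complex_of_real (d j) = 1" "d j \<noteq> 0"
    using d_sign[of j] ij by auto
  have "residual d a i j = c i j * complex_of_real (d j) * cnj (c j j)"
  proof (cases "i = j")
    case True
    have "residual d a j j = complex_of_real (d j) * (complex_of_real (d j) * residual d a j j)"
      using dj by (simp add: mult.assoc[symmetric])
    then show ?thesis using r True by simp
  next
    case False
    then show ?thesis using chol_below[of j i d a] r ij dj by simp
  qed
  then show ?thesis
    by (simp add: residual_def lessThan_Suc_atMost[symmetric] algebra_simps)
qed

text \<open>Entries above the diagonal follow from those below by conjugation, as a is
  Hermitian.\<close>

private lemma chol_entry:
  assumes ok: "\<And>k. k < m \<Longrightarrow> pivot_ok k" and ij: "min i j < m" "i < n" "j < n"
  shows "a i j = (\<Sum>k\<le>min i j. c i k * complex_of_real (d k) * cnj (c j k))"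
proof (cases "j \<le> i")
  case True
  then have "min i j = j" by simp
  then show ?thesis using chol_column[OF ok, of j i] ij True by simp
next
  case False
  have "a i j = cnj (a j i)" using herm[of j i] ij by (metis complex_cnj_cnj)
  also have "a j i = (\<Sum>k\<le>i. c j k * complex_of_real (d k) * cnj (c i k))"
    using chol_column[OF ok, of i j] ij False by simp
  finally show ?thesis using False by (simp add: min_def mult.commute mult.left_commute)
qed

lemma pivot_ok: "j < n \<Longrightarrow> pivot_ok j"
proof (induction j rule: less_induct)
  case (less j)
  have ok: "pivot_ok k" if "k < j" for k using less that by simp
  \<comment> \<open>With a unit vector as last column of \<open>L'\<close>, the leading block of order \<open>j + 1\<close> is \<open>L' d' L'\<^sup>*\<close>,
    so the residual is the quotient of two consecutive leading minors.\<close>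
  define Q where "Q = (\<Prod>k<j. c k k * complex_of_real (d k) * cnj (c k k))"
  define L' where "L' = (\<lambda>i k. if k < j then c i k else if i = k then 1 else 0 :: complex)"
  define d' where "d' = (\<lambda>k. if k < j then complex_of_real (d k) else residual d a j j)"
  have "a p q = (\<Sum>k<Suc j. L' p k * d' k * cnj (L' q k))" if pq: "p < Suc j" "q < Suc j" for p q
  proof (cases "min p q < j")
    case True
    \<comment> \<open>Beyond min p q one of the two outer factors vanishes, since
      \<open>chol\<close> is lower triangular and the last column of L' is a unit vector.\<close>
    have "(\<Sum>k<Suc j. L' p k * d' k * cnj (L' q k)) = (\<Sum>k\<le>min p q. L' p k * d' k * cnj (L' q k))"
      using True pq by (intro sum.mono_neutral_right) (auto simp: L'_def chol_upper min_def split: if_splits)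
    also have "\<dots> = (\<Sum>k\<le>min p q. c p k * complex_of_real (d k) * cnj (c q k))"
      using True by (intro sum.cong) (auto simp: L'_def d'_def)
    finally show ?thesis using chol_entry[OF ok, of j p q] True pq less.prems by simp
  next
    case False
    then have "p = j" "q = j" using pq by auto
    then show ?thesis by (simp add: L'_def d'_def residual_def)
  qed
  then have "det (mat (Suc j) (Suc j) (\<lambda>(i,j). a i j)) =
      det (mat (Suc j) (Suc j) (\<lambda>(p,q). \<Sum>k<Suc j. L' p k * d' k * cnj (L' q k)))"
    by (intro arg_cong[of _ _ det] eq_matI) auto
  also have "\<dots> = (\<Prod>k<Suc j. L' k k * d' k * cnj (L' k k))"
    by (rule det_ldl) (auto simp: L'_def chol_upper)
  also have "\<dots> = Q * residual d a j j"
    by (simp add: Q_def L'_def d'_def)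
  finally have minor: "sgn Q * sgn (residual d a j j) = complex_of_real (e (Suc j))"
    using minors[of "Suc j"] less.prems by (simp add: sgn_mult)
  have nonzero: "c k k \<noteq> 0" if "k < j" for k
    using ok[OF that] by (auto simp: pivot_ok_def chol_diag)
  \<comment> \<open>For j = 0 the product is empty and has sign 1, which matches the separate value
    of \<open>dsign\<close> at 0.\<close>
  have "sgn Q = (if j = 0 then 1 else complex_of_real (e j))"
    using sgn_prod_ldl[where m = j and l = "\<lambda>k. c k k", OF e] nonzero less.prems by (auto simp: Q_def)
  then have "complex_of_real (d j) = sgn Q * complex_of_real (e (Suc j))"
    by (simp add: dsign_def)
  also have "\<dots> = sgn Q * sgn Q * sgn (residual d a j j)"
    by (simp add: minor[symmetric])
  also have "sgn Q * sgn Q = 1"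
    using \<open>sgn Q = _\<close> e[of j] less.prems by (auto split: if_splits simp flip: of_real_mult)
  finally have "sgn (residual d a j j) = complex_of_real (d j)" by simp
  then have "residual d a j j \<in> \<real> \<and> 0 < d j * Re (residual d a j j)"
    using sgn_eq_sign_iff[OF d_sign[OF less.prems]] by blast
  then show ?case by (auto simp: pivot_ok_def)
qed

lemma chol_correct:
  assumes "i < n" "j < n"
  shows "a i j = (\<Sum>k<n. chol (dsign e) a i k * complex_of_real (dsign e k) * cnj (chol (dsign e) a j k))"
proof -
  have "a i j = (\<Sum>k\<le>min i j. c i k * complex_of_real (d k) * cnj (c j k))"
    using chol_entry[of n i j] pivot_ok assms by simp
  also have "\<dots> = (\<Sum>k<n. c i k * complex_of_real (d k) * cnj (c j k))"
    using assms by (intro sum.mono_neutral_left) (auto simp: chol_upper min_def split: if_splits)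
  finally show ?thesis .
qed

lemma chol_diag_pos:
  assumes "j < n"
  shows "chol (dsign e) a j j \<in> \<real>" "0 < Re (chol (dsign e) a j j)"
  using pivot_ok[OF assms] by (simp_all add: chol_diag pivot_ok_def)

lemma pivot_pos:
  assumes "j < n"
  shows "complex_of_real (dsign e j) * residual (dsign e) a j j \<in> \<real>"
    "0 < Re (complex_of_real (dsign e j) * residual (dsign e) a j j)"
  using pivot_ok[OF assms] by (simp_all add: pivot_ok_def)

end

text \<open>In contrast to \<open>sign_patterns\<close> there is no extensionality, so one infinite
  pattern satisfies this for every n and serves all levels of a direct limit.\<close>

definition signs :: "nat \<Rightarrow> (nat \<Rightarrow> real) \<Rightarrow> bool" where
  "signs n e \<longleftrightarrow> (\<forall>k. 1 \<le> k \<longrightarrow> k \<le> n \<longrightarrow> e k \<in> {-1, 1})"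

lemma signsD: "signs n e \<Longrightarrow> 1 \<le> k \<Longrightarrow> k \<le> n \<Longrightarrow> e k \<in> {-1, 1}"
  by (simp add: signs_def)

lemma signs_sign_patterns: "e \<in> sign_patterns n \<Longrightarrow> signs n e"
  unfolding signs_def sign_patterns_def by (metis PiE_mem atLeastAtMost_iff)

lemma signs_inf_sign_pattern: "inf_sign_pattern e \<Longrightarrow> signs n e"
  by (simp add: signs_def inf_sign_pattern_def)

section \<open>The factorization at the level of matrices\<close>

lemma LmatD:
  assumes "L \<in> Lmat n"
  shows "L \<in> carrier_mat n n" "\<And>i j. i < j \<Longrightarrow> j < n \<Longrightarrow> L $$ (i,j) = 0"
    "\<And>i. i < n \<Longrightarrow> L $$ (i,i) \<in> \<real>" "\<And>i. i < n \<Longrightarrow> 0 < Re (L $$ (i,i))"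
  using assms by (auto simp: Lmat_def low_def)

lemma LmatI:
  assumes "L \<in> carrier_mat n n" "\<And>i j. i < j \<Longrightarrow> j < n \<Longrightarrow> L $$ (i,j) = 0"
    "\<And>i. i < n \<Longrightarrow> L $$ (i,i) \<in> \<real> \<and> 0 < Re (L $$ (i,i))"
  shows "L \<in> Lmat n"
  using assms by (auto simp: Lmat_def low_def)

lemma Lmat_diag_nonzero: "L \<in> Lmat n \<Longrightarrow> i < n \<Longrightarrow> L $$ (i,i) \<noteq> 0"
  using LmatD(4)[of L n i] by auto

lemma LPMD:
  assumes "A \<in> LPM n e"
  shows "A \<in> carrier_mat n n" "A \<in> herm n"
    "\<And>i j. i < n \<Longrightarrow> j < n \<Longrightarrow> cnj (A $$ (j,i)) = A $$ (i,j)"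
    "\<And>k. 1 \<le> k \<Longrightarrow> k \<le> n \<Longrightarrow> sgn (det (mat k k (\<lambda>(i,j). A $$ (i,j)))) = complex_of_real (e k)"
  using assms by (auto simp: LPM_def herm_iff leading_minor_eq[of _ n])

definition chol_mat :: "nat \<Rightarrow> (nat \<Rightarrow> real) \<Rightarrow> complex mat \<Rightarrow> complex mat" where
  "chol_mat n e A = mat n n (\<lambda>(i,j). chol (dsign e) (\<lambda>i j. A $$ (i,j)) i j)"

lemma LDL_carrier [simp]: "L \<in> carrier_mat n n \<Longrightarrow> LDL n e L \<in> carrier_mat n n"
  by (simp add: LDL_def mult_carrier_mat[of _ n n])

lemma LDL_index:
  assumes "L \<in> carrier_mat n n" "i < n" "j < n"
  shows "LDL n e L $$ (i,j) = (\<Sum>k<n. L $$ (i,k) * complex_of_real (dsign e k) * cnj (L $$ (j,k)))"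
proof -
  have "L * Dmat n e = mat n n (\<lambda>(i,j). L $$ (i,j) * complex_of_real (dsign e j))"
    unfolding Dmat_def by (rule mat_diag_mult_right[OF assms(1)])
  then show ?thesis
    using assms by (auto simp: LDL_def scalar_prod_def atLeast0LessThan intro!: sum.cong)
qed

lemma chol_mat_Lmat:
  assumes "signs n e" "A \<in> LPM n e"
  shows "chol_mat n e A \<in> Lmat n"
proof (rule LmatI)
  show "chol_mat n e A $$ (i,i) \<in> \<real> \<and> 0 < Re (chol_mat n e A $$ (i,i))" if "i < n" for i
    using chol_diag_pos[OF signsD[OF assms(1)] LPMD(3,4)[OF assms(2)] that] that
    by (simp add: chol_mat_def)
qed (auto simp: chol_mat_def chol_upper)

lemma LDL_chol_mat:
  assumes "signs n e" "A \<in> LPM n e"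
  shows "LDL n e (chol_mat n e A) = A"
proof (rule eq_matI)
  fix i j assume "i < dim_row A" "j < dim_col A"
  then have ij: "i < n" "j < n" using LPMD(1)[OF assms(2)] by auto
  show "LDL n e (chol_mat n e A) $$ (i,j) = A $$ (i,j)"
    using ij chol_correct[OF signsD[OF assms(1)] LPMD(3,4)[OF assms(2)] ij]
    by (subst LDL_index) (auto simp: chol_mat_def)
qed (use LPMD(1)[OF assms(2)] in \<open>auto simp: LDL_def chol_mat_def\<close>)

text \<open>As L i k = 0 for i < m \<le> k, the leading block of order m of L D L^* is formed from
  the leading blocks of L and D. Its determinant is a positive number times the telescoping product
  of signs.\<close>

lemma LDL_LPM:
  assumes e: "signs n e" and L: "L \<in> Lmat n"
  shows "LDL n e L \<in> LPM n e"
proof -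
  note LD = LmatD[OF L]
  have carr: "LDL n e L \<in> carrier_mat n n" using LD(1) by simp
  have "LDL n e L \<in> herm n"
    unfolding herm_iff using LD(1) by (auto simp: LDL_index mult_ac intro!: sum.cong)
  moreover have "sgn (leading_minor (LDL n e L) m) = complex_of_real (e m)" if m: "1 \<le> m" "m \<le> n" for m
  proof -
    have "mat m m (\<lambda>(i,j). LDL n e L $$ (i,j)) =
        mat m m (\<lambda>(i,j). \<Sum>k<m. L $$ (i,k) * complex_of_real (dsign e k) * cnj (L $$ (j,k)))"
    proof (rule eq_matI)
      fix i j assume "i < dim_row (mat m m (\<lambda>(i,j). \<Sum>k<m. L $$ (i,k) * complex_of_real (dsign e k) * cnj (L $$ (j,k))))"
        "j < dim_col (mat m m (\<lambda>(i,j). \<Sum>k<m. L $$ (i,k) * complex_of_real (dsign e k) * cnj (L $$ (j,k))))"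
      then have ij: "i < m" "j < m" by auto
      have "(\<Sum>k<n. L $$ (i,k) * complex_of_real (dsign e k) * cnj (L $$ (j,k))) =
          (\<Sum>k<m. L $$ (i,k) * complex_of_real (dsign e k) * cnj (L $$ (j,k)))"
      proof (rule sum.mono_neutral_right)
        show "\<forall>k\<in>{..<n} - {..<m}. L $$ (i,k) * complex_of_real (dsign e k) * cnj (L $$ (j,k)) = 0"
          using LD(2)[of i] ij by auto
      qed (use m in auto)
      then have "LDL n e L $$ (i,j) = (\<Sum>k<m. L $$ (i,k) * complex_of_real (dsign e k) * cnj (L $$ (j,k)))"
        using ij m LD(1) by (simp add: LDL_index)
      then show "mat m m (\<lambda>(i,j). LDL n e L $$ (i,j)) $$ (i,j) =
        mat m m (\<lambda>(i,j). \<Sum>k<m. L $$ (i,k) * complex_of_real (dsign e k) * cnj (L $$ (j,k))) $$ (i,j)"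
        using ij by simp
    qed auto
    then have "leading_minor (LDL n e L) m = (\<Prod>k<m. L $$ (k,k) * complex_of_real (dsign e k) * cnj (L $$ (k,k)))"
      using det_ldl[of m "\<lambda>i j. L $$ (i,j)" "\<lambda>k. complex_of_real (dsign e k)"] LD(2) m carr
      by (simp add: leading_minor_eq[of _ n])
    then show ?thesis
      using sgn_prod_ldl[where m = m and l = "\<lambda>k. L $$ (k,k)", OF signsD[OF e]] m Lmat_diag_nonzero[OF L] by simp
  qed
  ultimately show ?thesis by (simp add: LPM_def)
qed

lemma chol_mat_LDL:
  assumes e: "signs n e" and L: "L \<in> Lmat n"
  shows "chol_mat n e (LDL n e L) = L"
proof (rule eq_matI)
  note LD = LmatD[OF L]
  fix i j assume "i < dim_row L" "j < dim_col L"
  then have ij: "i < n" "j < n" using LD(1) by auto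
  define L' where "L' = (\<lambda>i j. if i < j then 0 else L $$ (i,j))"
  have "chol (dsign e) (\<lambda>i j. LDL n e L $$ (i,j)) i j = L' i j"
  proof (rule chol_unique[of n])
    show "dsign e k \<in> {-1, 1}" if "k < n" for k using dsign_sign[OF signsD[OF e] that] .
    show "L' j j \<in> \<real> \<and> 0 < Re (L' j j)" if "j < n" for j using LD(3,4)[OF that] by (simp add: L'_def)
    fix p q assume pq: "p < n" "q \<le> p"
    then have "LDL n e L $$ (p,q) = (\<Sum>k<n. L $$ (p,k) * complex_of_real (dsign e k) * cnj (L $$ (q,k)))"
      using LD(1) by (simp add: LDL_index)
    also have "\<dots> = (\<Sum>k\<le>q. L $$ (p,k) * complex_of_real (dsign e k) * cnj (L $$ (q,k)))"
      using pq LD(2) by (intro sum.mono_neutral_right) auto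
    finally show "LDL n e L $$ (p,q) = (\<Sum>k\<le>q. L' p k * complex_of_real (dsign e k) * cnj (L' q k))"
      using pq by (simp add: L'_def)
  qed (use ij in \<open>auto simp: L'_def\<close>)
  then show "chol_mat n e (LDL n e L) $$ (i,j) = L $$ (i,j)"
    using ij LD(2)[of i j] by (simp add: chol_mat_def L'_def)
qed (use LmatD(1)[OF L] in \<open>auto simp: chol_mat_def\<close>)

lemma bij_betw_LDL:
  assumes "signs n e"
  shows "bij_betw (LDL n e) (Lmat n) (LPM n e)"
  by (rule bij_betw_byWitness[of _ "chol_mat n e"])
    (auto simp: chol_mat_LDL LDL_chol_mat chol_mat_Lmat LDL_LPM assms)

subsection \<open>The group of triangular matrices\<close>

lemma Lmat_one: "1\<^sub>m n \<in> Lmat n"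
  by (rule LmatI) auto

lemma Lmat_mult:
  assumes "L \<in> Lmat n" "M \<in> Lmat n"
  shows "L * M \<in> Lmat n"
proof (rule LmatI)
  note LD = LmatD[OF assms(1)] and MD = LmatD[OF assms(2)]
  note index = mult_index_sum[OF LD(1) MD(1)]
  show "L * M \<in> carrier_mat n n" using LD(1) MD(1) by (rule mult_carrier_mat)
  show "(L * M) $$ (i,j) = 0" if "i < j" "j < n" for i j
    unfolding index[OF order.strict_trans[OF that] that(2)]
  proof (rule sum.neutral, safe)
    fix k assume "k < n"
    then show "L $$ (i,k) * M $$ (k,j) = 0"
      using LD(2)[of i k] MD(2)[of k j] that by (cases "i < k") auto
  qed
  show "(L * M) $$ (i,i) \<in> \<real> \<and> 0 < Re ((L * M) $$ (i,i))" if i: "i < n" for i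
  proof -
    have "(L * M) $$ (i,i) = (\<Sum>k\<in>{i}. L $$ (i,k) * M $$ (k,i))"
      unfolding index[OF i i]
    proof (rule sum.mono_neutral_right)
      show "\<forall>k\<in>{..<n} - {i}. L $$ (i,k) * M $$ (k,i) = 0"
        using LD(2)[of i] MD(2)[of _ i] i by (auto simp: neq_iff)
    qed (use i in auto)
    then show ?thesis
      using LD(3,4)[OF i] MD(3,4)[OF i] by (auto elim!: Reals_cases)
  qed
qed

text \<open>Row i of the equation M X = 1, solved for X i j. It makes the inverse visibly a
  composition of field operations whose only divisors are diagonal entries of M.\<close>

function forward_subst :: "complex mat \<Rightarrow> nat \<Rightarrow> nat \<Rightarrow> complex" where
  "forward_subst M i j =
    ((if i = j then 1 else 0) - (\<Sum>k<i. M $$ (i,k) * forward_subst M k j)) / M $$ (i,i)"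
  by auto
termination by (relation "Wellfounded.measure (\<lambda>(M, i, j). i)") auto
declare forward_subst.simps [simp del]

definition tri_inv :: "nat \<Rightarrow> complex mat \<Rightarrow> complex mat" where
  "tri_inv n M = mat n n (\<lambda>(i,j). forward_subst M i j)"

lemma forward_subst_upper: "i < j \<Longrightarrow> forward_subst M i j = 0"
proof (induction i rule: less_induct)
  case (less i)
  then show ?case by (subst forward_subst.simps) simp
qed

lemma forward_subst_diag: "forward_subst M i i = 1 / M $$ (i,i)"
  by (subst forward_subst.simps) (simp add: forward_subst_upper)

lemma tri_inv_Lmat:
  assumes "M \<in> Lmat n"
  shows "tri_inv n M \<in> Lmat n"
  using LmatD(3,4)[OF assms]
  by (intro LmatI) (auto simp: tri_inv_def forward_subst_upper forward_subst_diag elim!: Reals_cases)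

lemma tri_inv_right:
  assumes "M \<in> Lmat n"
  shows "M * tri_inv n M = 1\<^sub>m n"
proof (rule eq_matI)
  note MD = LmatD[OF assms]
  have carr: "tri_inv n M \<in> carrier_mat n n" by (simp add: tri_inv_def)
  fix i j assume "i < dim_row (1\<^sub>m n :: complex mat)" "j < dim_col (1\<^sub>m n :: complex mat)"
  then have ij: "i < n" "j < n" by auto
  have "(M * tri_inv n M) $$ (i,j) = (\<Sum>k<n. M $$ (i,k) * forward_subst M k j)"
    unfolding mult_index_sum[OF MD(1) carr ij] using ij by (intro sum.cong) (auto simp: tri_inv_def)
  also have "\<dots> = (\<Sum>k<Suc i. M $$ (i,k) * forward_subst M k j)"
    using MD(2)[of i] ij by (intro sum.mono_neutral_right) auto
  also have "\<dots> = (if i = j then 1 else 0)"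
    using Lmat_diag_nonzero[OF assms ij(1)] forward_subst.simps[of M i j] by simp
  finally show "(M * tri_inv n M) $$ (i,j) = 1\<^sub>m n $$ (i,j)" using ij by simp
qed (use LmatD(1)[OF assms] in \<open>auto simp: tri_inv_def\<close>)

lemma tri_inv_left:
  assumes "M \<in> Lmat n"
  shows "tri_inv n M * M = 1\<^sub>m n"
  using mat_mult_left_right_inverse[OF LmatD(1)[OF assms] LmatD(1)[OF tri_inv_Lmat[OF assms]]]
    tri_inv_right[OF assms] by simp

subsection \<open>The action on indefinite Hermitian matrices\<close>

text \<open>If A = X D X^* and B = M D M^*, then L = X M^{-1} satisfies L M = X and hence L B L^* =
  A.\<close>

definition cong_inv :: "nat \<Rightarrow> (nat \<Rightarrow> real) \<Rightarrow> complex mat \<Rightarrow> complex mat \<Rightarrow> complex mat" where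
  "cong_inv n e B A = chol_mat n e A * tri_inv n (chol_mat n e B)"

text \<open>In the coordinates given by the factorization, congruence by L becomes multiplication by
  L from the left. The action on a stratum is thus the action of the group on itself.\<close>

lemma congruence_LDL:
  assumes "L \<in> carrier_mat n n" "M \<in> carrier_mat n n"
  shows "L * LDL n e M * mat_adjoint L = LDL n e (L * M)"
proof -
  have adj: "mat_adjoint L \<in> carrier_mat n n" "mat_adjoint M \<in> carrier_mat n n"
    using assms by auto
  have D: "Dmat n e \<in> carrier_mat n n" by simp
  note carr = mult_carrier_mat[of _ n n _ n] assms adj D
  show ?thesis
    unfolding LDL_def mat_adjoint_mult[OF assms]
    by (simp add: assoc_mult_mat[of _ n n _ n _ n] carr del: Dmat_carrier)
qed

lemma congruence_bij:
  assumes e: "signs n e" and B: "B \<in> LPM n e"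
  shows "bij_betw (\<lambda>L. L * B * mat_adjoint L) (Lmat n) (LPM n e)"
    and "\<And>A. A \<in> LPM n e \<Longrightarrow> inv_into (Lmat n) (\<lambda>L. L * B * mat_adjoint L) A = cong_inv n e B A"
    and "\<And>A. A \<in> LPM n e \<Longrightarrow> cong_inv n e B A \<in> Lmat n"
proof -
  define M where "M = chol_mat n e B"
  have M: "M \<in> Lmat n" "LDL n e M = B"
    using chol_mat_Lmat[OF e B] LDL_chol_mat[OF e B] by (auto simp: M_def)
  have F: "L * B * mat_adjoint L = LDL n e (L * M)" if "L \<in> Lmat n" for L
    using congruence_LDL[OF LmatD(1)[OF that] LmatD(1)[OF M(1)], of e] M(2) by simp
  have carrM: "M \<in> carrier_mat n n" "tri_inv n M \<in> carrier_mat n n"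
    using LmatD(1) M(1) tri_inv_Lmat by auto
  have 1: "cong_inv n e B (L * B * mat_adjoint L) = L" if L: "L \<in> Lmat n" for L
    unfolding cong_inv_def F[OF L] chol_mat_LDL[OF e Lmat_mult[OF L M(1)]] M_def[symmetric]
    using assoc_mult_mat[OF LmatD(1)[OF L] carrM] tri_inv_right[OF M(1)] LmatD(1)[OF L] by simp
  show mem: "cong_inv n e B A \<in> Lmat n" if "A \<in> LPM n e" for A
    unfolding cong_inv_def using chol_mat_Lmat[OF e] that B by (intro Lmat_mult tri_inv_Lmat) auto
  have 2: "cong_inv n e B A * B * mat_adjoint (cong_inv n e B A) = A" if A: "A \<in> LPM n e" for A
  proof -
    have C: "chol_mat n e A \<in> carrier_mat n n" using LmatD(1)[OF chol_mat_Lmat[OF e A]] .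
    have "cong_inv n e B A * M = chol_mat n e A"
      unfolding cong_inv_def M_def[symmetric]
      using assoc_mult_mat[OF C carrM(2,1)] tri_inv_left[OF M(1)] C by simp
    then show ?thesis using F[OF mem[OF A]] LDL_chol_mat[OF e A] by simp
  qed
  have 3: "L * B * mat_adjoint L \<in> LPM n e" if "L \<in> Lmat n" for L
    unfolding F[OF that] by (intro LDL_LPM e Lmat_mult that M)
  show bij: "bij_betw (\<lambda>L. L * B * mat_adjoint L) (Lmat n) (LPM n e)"
    by (rule bij_betw_byWitness[of _ "cong_inv n e B"]) (use 1 2 3 mem in auto)
  show "inv_into (Lmat n) (\<lambda>L. L * B * mat_adjoint L) A = cong_inv n e B A" if "A \<in> LPM n e" for A
    using bij 2[OF that] mem[OF that] by (intro inv_into_f_eq) (auto simp: bij_betw_def)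
qed

subsection \<open>Computability of the factorization\<close>

lemma computable_residual:
  assumes "\<And>k. k < n \<Longrightarrow> d k \<in> {-1, 1}"
    and "\<And>i j. i < n \<Longrightarrow> j < n \<Longrightarrow> computable D (\<lambda>Ms. a Ms i j)"
    and "\<And>i k. i < n \<Longrightarrow> k < j \<Longrightarrow> computable D (\<lambda>Ms. chol d (a Ms) i k)"
    and "i < n" "j < n"
  shows "computable D (\<lambda>Ms. residual d (a Ms) i j)"
  unfolding residual_def using assms
  by (intro computable_diff computable_sum computable_mult computable_cnj computable_sign) auto

text \<open>Induction on columns. The case distinction is on the indices and not on the entries, so
  one procedure works for all inputs; positive pivots make all its roots and divisions
  succeed.\<close>

lemma computable_chol:
  assumes d: "\<And>k. k < n \<Longrightarrow> d k \<in> {-1, 1}"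
    and a: "\<And>i j. i < n \<Longrightarrow> j < n \<Longrightarrow> computable D (\<lambda>Ms. a Ms i j)"
    and pos: "\<And>Ms j. Ms \<in> D \<Longrightarrow> j < n \<Longrightarrow> complex_of_real (d j) * residual d (a Ms) j j \<in> \<real> \<and>
      0 < Re (complex_of_real (d j) * residual d (a Ms) j j)"
  shows "i < n \<Longrightarrow> j < n \<Longrightarrow> computable D (\<lambda>Ms. chol d (a Ms) i j)"
proof (induction j arbitrary: i rule: less_induct)
  case (less j)
  have IH: "computable D (\<lambda>Ms. chol d (a Ms) i k)" if "i < n" "k < j" for i k
    using less that by simp
  note res = computable_residual[where a = a, OF d a IH _ less.prems(2)]
  have diag: "computable D (\<lambda>Ms. chol d (a Ms) j j)"
    unfolding chol_diag
    by (intro computable_sqrt computable_mult computable_sign d less.prems res pos)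
  consider "i < j" | "i = j" | "j < i" by linarith
  then show ?case
  proof cases
    case 1
    then show ?thesis using computable_zero by (simp add: chol_upper)
  next
    case 3
    have "complex_of_real (d j) * chol d (a Ms) j j \<noteq> 0" if "Ms \<in> D" for Ms
      using d[OF less.prems(2)] pos[OF that less.prems(2)] by (auto simp: chol_diag)
    then show ?thesis
      unfolding chol_below[OF 3]
      by (intro computable_divide computable_mult computable_sign d less.prems res diag)
  qed (use diag in simp)
qed

lemma computable_tri_inv:
  assumes M: "\<And>i j. i < n \<Longrightarrow> j < n \<Longrightarrow> computable D (\<lambda>Ms. M Ms $$ (i,j))"
    and nonzero: "\<And>Ms i. Ms \<in> D \<Longrightarrow> i < n \<Longrightarrow> M Ms $$ (i,i) \<noteq> 0"
  shows "i < n \<Longrightarrow> j < n \<Longrightarrow> computable D (\<lambda>Ms. forward_subst (M Ms) i j)"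
proof (induction i rule: less_induct)
  case (less i)
  have "computable D (\<lambda>_. if i = j then 1 else 0)"
    by (simp add: computable_one computable_zero)
  then show ?case
    using less nonzero
    by (subst forward_subst.simps) (intro computable_divide computable_diff computable_sum computable_mult M; auto)
qed

lemma computable_chol_mat:
  assumes e: "signs n e" and D: "\<And>Ms. Ms \<in> D \<Longrightarrow> m < length Ms \<and> Ms ! m \<in> LPM n e"
    and ij: "i < n" "j < n"
  shows "computable D (\<lambda>Ms. chol_mat n e (Ms ! m) $$ (i,j))"
proof -
  have "computable D (\<lambda>Ms. chol (dsign e) (\<lambda>i j. Ms ! m $$ (i,j)) i j)"
  proof (rule computable_chol[where n = n and a = "\<lambda>Ms i j. Ms ! m $$ (i,j)"])
    show "dsign e k \<in> {-1, 1}" if "k < n" for k using dsign_sign[OF signsD[OF e] that] .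
    show "computable D (\<lambda>Ms. Ms ! m $$ (i,j))" if "i < n" "j < n" for i j
      using D LPMD(1) that by (intro computable_entry) fastforce
    show "complex_of_real (dsign e j) * residual (dsign e) (\<lambda>i j. Ms ! m $$ (i,j)) j j \<in> \<real> \<and>
      0 < Re (complex_of_real (dsign e j) * residual (dsign e) (\<lambda>i j. Ms ! m $$ (i,j)) j j)"
      if "Ms \<in> D" "j < n" for Ms j
    proof -
      have A: "Ms ! m \<in> LPM n e" using D[OF that(1)] by blast
      note pivot_pos[where e = e and n = n and a = "\<lambda>i j. Ms ! m $$ (i,j)" and j = j,
          OF signsD[OF e] LPMD(3)[OF A] LPMD(4)[OF A] that(2)]
      then show ?thesis by blast
    qed
  qed (use ij in auto)
  then show ?thesis using ij by (simp add: chol_mat_def)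
qed

lemma computable_cong_inv:
  assumes e: "signs n e" and D: "\<And>Ms. Ms \<in> D \<Longrightarrow> 1 < length Ms \<and> Ms ! 0 \<in> LPM n e \<and> Ms ! 1 \<in> LPM n e"
    and ij: "i < n" "j < n"
  shows "computable D (\<lambda>Ms. cong_inv n e (Ms ! 1) (Ms ! 0) $$ (i,j))"
proof -
  have nonzero: "chol_mat n e (Ms ! 1) $$ (i,i) \<noteq> 0" if "Ms \<in> D" "i < n" for Ms i
    using Lmat_diag_nonzero[OF chol_mat_Lmat[OF e]] D[OF that(1)] that(2) by blast
  have "computable D (\<lambda>Ms. \<Sum>k<n. chol_mat n e (Ms ! 0) $$ (i,k) *
      forward_subst (chol_mat n e (Ms ! 1)) k j)"
    using e ij D nonzero
    by (intro computable_sum computable_mult computable_chol_mat computable_tri_inv[where n = n and M = "\<lambda>Ms. chol_mat n e (Ms ! 1)"]) fastforce+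
  then show ?thesis
  proof (rule computable_cong)
    fix Ms
    have "chol_mat n e (Ms ! 0) \<in> carrier_mat n n" "tri_inv n (chol_mat n e (Ms ! 1)) \<in> carrier_mat n n"
      by (simp_all add: chol_mat_def tri_inv_def)
    from mult_index_sum[OF this ij] show "(\<Sum>k<n. chol_mat n e (Ms ! 0) $$ (i,k) *
      forward_subst (chol_mat n e (Ms ! 1)) k j) = cong_inv n e (Ms ! 1) (Ms ! 0) $$ (i,j)"
      using ij by (simp add: cong_inv_def tri_inv_def)
  qed
qed

lemma algorithmic_inverseI:
  assumes "\<And>i j. i < n \<Longrightarrow> j < n \<Longrightarrow>
      computable {[A, B] | A B. A \<in> T \<and> B \<in> T} (\<lambda>Ms. inv_into S (F (Ms ! 1)) (Ms ! 0) $$ (i,j))"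
  shows "algorithmic_inverse n S T F"
proof -
  have "\<exists>p. \<forall>B\<in>T. \<forall>A\<in>T. i < n \<longrightarrow> j < n \<longrightarrow> run [A, B] p = Some (inv_into S (F B) A $$ (i,j))" for i j
  proof (cases "i < n \<and> j < n")
    case True
    then obtain p where "\<forall>Ms\<in>{[A, B] | A B. A \<in> T \<and> B \<in> T}.
        run Ms p = Some (inv_into S (F (Ms ! 1)) (Ms ! 0) $$ (i,j))"
      using assms unfolding computable_def by blast
    then show ?thesis by (intro exI[of _ p]) fastforce
  qed auto
  then obtain p where "\<forall>i j. \<forall>B\<in>T. \<forall>A\<in>T. i < n \<longrightarrow> j < n \<longrightarrow> run [A, B] (p i j) = Some (inv_into S (F B) A $$ (i,j))"
    by metis
  then show ?thesis unfolding algorithmic_inverse_def by blast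
qed

lemma algorithmic_congruence:
  assumes e: "signs n e"
  shows "algorithmic_inverse n (Lmat n) (LPM n e) (\<lambda>B L. L * B * mat_adjoint L)"
proof (rule algorithmic_inverseI)
  let ?D = "{[A, B] | A B. A \<in> LPM n e \<and> B \<in> LPM n e}"
  fix i j assume ij: "i < n" "j < n"
  have "computable ?D (\<lambda>Ms. cong_inv n e (Ms ! 1) (Ms ! 0) $$ (i,j))"
    by (rule computable_cong_inv[OF e _ ij]) auto
  then show "computable ?D (\<lambda>Ms. inv_into (Lmat n) (\<lambda>L. L * (Ms ! 1) * mat_adjoint L) (Ms ! 0) $$ (i,j))"
    by (rule computable_cong) (use congruence_bij(2)[OF e] in auto)
qed

section \<open>Open dense strata\<close>

lemma openin_sub_mat_topology:
  assumes "H \<subseteq> carrier_mat n n"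
  shows "openin (subtopology (mat_topology n) H) U \<longleftrightarrow>
    U \<subseteq> H \<and> (\<forall>A\<in>U. \<exists>r>0. \<forall>B\<in>H. mat_dist n A B < r \<longrightarrow> B \<in> U)"
proof -
  interpret H: Submetric "carrier_mat n n" "mat_dist n" H
    by unfold_locales (rule assms)
  show ?thesis
    unfolding mat_topology_def H.mtopology_submetric[symmetric] H.sub.openin_mtopology
    unfolding subset_iff H.sub.in_mball by blast
qed

lemma open_dense_in_mat_topology:
  assumes H: "H \<subseteq> carrier_mat n n"
  shows "open_dense_in (subtopology (mat_topology n) H) U \<longleftrightarrow>
    openin (subtopology (mat_topology n) H) U \<and> (\<forall>A\<in>H. \<forall>r>0. \<exists>B\<in>U. mat_dist n A B < r)"
proof (cases "openin (subtopology (mat_topology n) H) U")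
  case True
  then have U: "U \<subseteq> H" using openin_subset by fastforce
  have top: "topspace (subtopology (mat_topology n) H) = H" using H by auto
  have cl: "mat_topology n closure_of U = {A \<in> carrier_mat n n. \<forall>r>0. \<exists>B\<in>U. mat_dist n A B < r}"
    unfolding mat_topology_def mat.metric_closure_of mat.in_mball using U H by blast
  have "subtopology (mat_topology n) H closure_of U = H \<inter> mat_topology n closure_of U"
    using U by (simp add: closure_of_subtopology inf.absorb2)
  then show ?thesis
    unfolding open_dense_in_def top cl using True H by blast
qed (simp add: open_dense_in_def)

lemma herm_carrier: "herm n \<subseteq> carrier_mat n n"
  by (auto simp: herm_def)

lemma herm_carrierD: "A \<in> herm n \<Longrightarrow> A \<in> carrier_mat n n"
  by (auto simp: herm_def)

lemma low_carrier: "low n \<subseteq> carrier_mat n n"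
  by (auto simp: low_def)

text \<open>By the Leibniz formula the minor is a polynomial in the entries.\<close>

lemma continuous_map_leading_minor:
  assumes "k \<le> n"
  shows "continuous_map (mat_topology n) euclidean (\<lambda>A. leading_minor A k)"
proof (rule continuous_map_eq)
  let ?f = "\<lambda>A :: complex mat. \<Sum>p | p permutes {0..<k}. signof p * (\<Prod>i = 0..<k. A $$ (i, p i))"
  show "continuous_map (mat_topology n) euclidean ?f"
    unfolding continuous_map_euclidean_iff
  proof (intro ballI tendsto_sum tendsto_mult tendsto_const tendsto_prod)
    fix A p i assume A: "A \<in> topspace (mat_topology n)" "p \<in> {p. p permutes {0..<k}}" "i \<in> {0..<k}"
    have "p i \<in> {0..<k}" using permutes_in_image[of p "{0..<k}" i] A by simp
    then have "p i < n" using assms by simp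
    then have "continuous_map (mat_topology n) euclidean (\<lambda>A. A $$ (i, p i))"
      using A assms by (intro continuous_map_entry) auto
    then show "((\<lambda>A. A $$ (i, p i)) \<longlongrightarrow> A $$ (i, p i)) (atin (mat_topology n) A)"
      using A by (simp add: continuous_map_euclidean_iff)
  qed
  show "?f A = leading_minor A k" if "A \<in> topspace (mat_topology n)" for A
    using that assms
    by (auto simp: leading_minor_eq[of _ n] det_def'[of _ k] permutes_in_image intro!: sum.cong prod.cong)
qed

lemma openin_finite_conj:
  assumes "finite K" "\<And>k. k \<in> K \<Longrightarrow> openin X {x \<in> topspace X. P k x}"
  shows "openin X {x \<in> topspace X. \<forall>k\<in>K. P k x}"
  using assms
proof (induction K rule: finite_induct)
  case (insert k K)
  have "{x \<in> topspace X. \<forall>k\<in>insert k K. P k x} = {x \<in> topspace X. P k x} \<inter> {x \<in> topspace X. \<forall>k\<in>K. P k x}"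
    by auto
  then show ?case using insert by (auto intro: openin_Int)
qed simp

lemma openin_pos_preimage:
  assumes "continuous_map X euclidean (f :: 'a \<Rightarrow> complex)"
  shows "openin X {x \<in> topspace X. 0 < s * Re (f x)}"
proof -
  have "open {z. 0 < s * Re z}"
    by (intro open_Collect_less continuous_intros)
  then show ?thesis
    using openin_continuous_map_preimage[OF assms, of "{z. 0 < s * Re z}"] by simp
qed

text \<open>Minors of Hermitian matrices are real anyway, so finitely many strict inequalities
  remain; openness of the stratum is read off from these.\<close>

lemma LPM_iff:
  assumes "signs n e"
  shows "A \<in> LPM n e \<longleftrightarrow> A \<in> herm n \<and> (\<forall>k\<in>{1..n}. 0 < e k * Re (leading_minor A k))"
  using assms herm_minor_real[of A n]
  by (auto simp: LPM_def sgn_eq_sign_iff signs_def)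

lemma openin_LPM:
  assumes "signs n e"
  shows "openin (subtopology (mat_topology n) (herm n)) (LPM n e)"
proof -
  let ?X = "subtopology (mat_topology n) (herm n)"
  have top: "topspace ?X = herm n" using herm_carrier by auto
  have "LPM n e = {A \<in> topspace ?X. \<forall>k\<in>{1..n}. 0 < e k * Re (leading_minor A k)}"
    unfolding top using LPM_iff[OF assms] by auto
  also have "openin ?X \<dots>"
    by (intro openin_finite_conj openin_pos_preimage continuous_map_from_subtopology
        continuous_map_leading_minor) auto
  finally show ?thesis .
qed

lemma openin_Lmat: "openin (subtopology (mat_topology n) (low n)) (Lmat n)"
proof -
  let ?X = "subtopology (mat_topology n) (low n)"
  have top: "topspace ?X = low n" using low_carrier by auto
  have "Lmat n = {L \<in> topspace ?X. \<forall>i\<in>{..<n}. 0 < 1 * Re (L $$ (i,i))}"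
    unfolding top Lmat_def by auto
  also have "openin ?X \<dots>"
    by (intro openin_finite_conj openin_pos_preimage continuous_map_from_subtopology
        continuous_map_entry) auto
  finally show ?thesis .
qed

text \<open>The minor vanishes when -t is an eigenvalue of the leading block of order k, that is, a
  root of its monic characteristic polynomial.\<close>

lemma finite_singular_shifts:
  assumes "A \<in> carrier_mat n n" "k \<le> n"
  shows "finite {t :: real. leading_minor (A + complex_of_real t \<cdot>\<^sub>m 1\<^sub>m n) k = 0}"
proof -
  define M where "M = mat k k (\<lambda>(i,j). A $$ (i,j))"
  have M: "M \<in> carrier_mat k k" by (simp add: M_def)
  have "leading_minor (A + complex_of_real t \<cdot>\<^sub>m 1\<^sub>m n) k = det (char_matrix M (- complex_of_real t))" for t
  proof -
    have "mat k k (\<lambda>(i,j). (A + complex_of_real t \<cdot>\<^sub>m 1\<^sub>m n) $$ (i,j)) = char_matrix M (- complex_of_real t)"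
      using assms by (intro eq_matI) (auto simp: char_matrix_def M_def)
    then show ?thesis using assms by (subst leading_minor_eq[of _ n]) auto
  qed
  then have "{t. leading_minor (A + complex_of_real t \<cdot>\<^sub>m 1\<^sub>m n) k = 0} =
      (\<lambda>t. - complex_of_real t) -` {z. poly (char_poly M) z = 0}"
    using eigenvalue_det[OF M] eigenvalue_root_char_poly[OF M] by auto
  moreover have "finite {z. poly (char_poly M) z = 0}"
    using degree_monic_char_poly[OF M] by (intro poly_roots_finite) auto
  then have "finite ((\<lambda>t. - complex_of_real t) -` {z. poly (char_poly M) z = 0})"
    by (rule finite_vimageI) (simp add: inj_on_def)
  ultimately show ?thesis by (simp only:)
qed

lemma open_dense_LPM:
  "open_dense_in (subtopology (mat_topology n) (herm n)) (\<Union>\<delta>\<in>sign_patterns n. LPM n \<delta>)"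
  unfolding open_dense_in_mat_topology[OF herm_carrier]
proof (intro conjI ballI allI impI)
  show "openin (subtopology (mat_topology n) (herm n)) (\<Union>\<delta>\<in>sign_patterns n. LPM n \<delta>)"
    by (intro openin_Union) (auto intro: openin_LPM signs_sign_patterns)
  fix A and r :: real assume A: "A \<in> herm n" and r: "0 < r"
  have carr: "A \<in> carrier_mat n n" using A herm_carrier by auto
  let ?B = "\<lambda>t :: real. A + complex_of_real t \<cdot>\<^sub>m 1\<^sub>m n"
  \<comment> \<open>A shift by t moves A by sqrt n * t. The added 1 keeps the denominator positive
    even for n = 0.\<close>
  have "0 < r / (sqrt n + 1)" using r by (intro divide_pos_pos add_nonneg_pos) auto
  then have "infinite ({0<..<r / (sqrt n + 1)} - (\<Union>k\<in>{1..n}. {t. leading_minor (?B t) k = 0}))"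
    using finite_singular_shifts[OF carr] by (intro Diff_infinite_finite finite_UN_I infinite_Ioo) auto
  then obtain t where "t \<in> {0<..<r / (sqrt n + 1)} - (\<Union>k\<in>{1..n}. {t. leading_minor (?B t) k = 0})"
    using infinite_imp_nonempty by blast
  then have t: "0 < t" "t < r / (sqrt n + 1)" "\<And>k. k \<in> {1..n} \<Longrightarrow> leading_minor (?B t) k \<noteq> 0"
    by auto
  have dist: "mat_dist n A (?B t) < r"
  proof -
    have "mat_dist n A (?B t) = sqrt (\<Sum>i<n. \<Sum>j<n. if i = j then t\<^sup>2 else 0)"
      unfolding mat_dist_def using carr
      by (intro arg_cong[of _ _ sqrt] sum.cong refl) auto
    also have "\<dots> = sqrt n * t" using t by (simp add: real_sqrt_mult)
    also have "\<dots> \<le> (sqrt n + 1) * t" using t by (simp add: distrib_right)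
    also have "\<dots> < r"
    proof -
      have "0 < sqrt (real n) + 1" by (simp add: add_nonneg_pos)
      then show ?thesis using t(2) by (simp add: less_divide_eq mult.commute)
    qed
    finally show ?thesis .
  qed
  have B: "?B t \<in> herm n"
    using A by (auto simp: herm_iff)
  \<comment> \<open>The pattern is read off the shifted matrix; the restriction makes it an
    extensional function as in \<open>sign_patterns\<close>.\<close>
  define \<delta> where "\<delta> = restrict (\<lambda>k. sgn (Re (leading_minor (?B t) k))) {1..n}"
  have nz: "Re (leading_minor (?B t) k) \<noteq> 0" if "k \<in> {1..n}" for k
    using t(3)[OF that] herm_minor_real[OF B, of k] that by (auto elim: Reals_cases)
  then have \<delta>: "\<delta> \<in> sign_patterns n"
    by (auto simp: \<delta>_def sign_patterns_def sgn_if)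
  have "?B t \<in> LPM n \<delta>"
    unfolding LPM_iff[OF signs_sign_patterns[OF \<delta>]]
  proof (intro conjI ballI B)
    fix k assume k: "k \<in> {1..n}"
    have "0 < sgn x * x" if "x \<noteq> 0" for x :: real using that by (simp add: sgn_if)
    then show "0 < \<delta> k * Re (leading_minor (?B t) k)" using nz[OF k] k by (simp add: \<delta>_def)
  qed
  then show "\<exists>B\<in>\<Union>\<delta>\<in>sign_patterns n. LPM n \<delta>. mat_dist n A B < r"
    using \<delta> dist by blast
qed

text \<open>The factor L = 1 exhibits the sign matrix D as a member.\<close>

lemma LPM_nonempty: "signs n e \<Longrightarrow> LPM n e \<noteq> {}"
  using LDL_LPM[OF _ Lmat_one] by blast

lemma sign_patterns_eqI:
  assumes "\<delta> \<in> sign_patterns n" "\<delta>' \<in> sign_patterns n"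
    and "\<And>k. k \<in> {1..n} \<Longrightarrow> complex_of_real (\<delta> k) = complex_of_real (\<delta>' k)"
  shows "\<delta> = \<delta>'"
  using assms unfolding sign_patterns_def by (intro PiE_ext) auto

lemma disjoint_LPM: "disjoint_family_on (LPM n) (sign_patterns n)"
  unfolding disjoint_family_on_def
proof (intro ballI impI)
  fix \<delta> \<delta>' assume *: "\<delta> \<in> sign_patterns n" "\<delta>' \<in> sign_patterns n" "\<delta> \<noteq> \<delta>'"
  then show "LPM n \<delta> \<inter> LPM n \<delta>' = {}"
    using sign_patterns_eqI[OF *(1,2)] by (auto simp: LPM_def)
qed

section \<open>Reversal and trailing minors\<close>

lemma Pmat_mult_left:
  assumes "A \<in> carrier_mat n n"
  shows "Pmat n * A = mat n n (\<lambda>(i,j). A $$ (n - 1 - i, j))"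
proof (rule eq_matI)
  fix i j assume "i < dim_row (mat n n (\<lambda>(i,j). A $$ (n - 1 - i, j)))" "j < dim_col (mat n n (\<lambda>(i,j). A $$ (n - 1 - i, j)))"
  then have ij: "i < n" "j < n" by auto
  have P: "Pmat n \<in> carrier_mat n n" by (simp add: Pmat_def)
  have "(Pmat n * A) $$ (i,j) = (\<Sum>k<n. if k = n - 1 - i then A $$ (k,j) else 0)"
    unfolding mult_index_sum[OF P assms ij] using ij by (intro sum.cong) (auto simp: Pmat_def)
  then show "(Pmat n * A) $$ (i,j) = mat n n (\<lambda>(i,j). A $$ (n - 1 - i, j)) $$ (i,j)"
    using ij by simp
qed (use assms in \<open>auto simp: Pmat_def\<close>)

lemma Pmat_mult_right:
  assumes "A \<in> carrier_mat n n"
  shows "A * Pmat n = mat n n (\<lambda>(i,j). A $$ (i, n - 1 - j))"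
proof (rule eq_matI)
  fix i j assume "i < dim_row (mat n n (\<lambda>(i,j). A $$ (i, n - 1 - j)))" "j < dim_col (mat n n (\<lambda>(i,j). A $$ (i, n - 1 - j)))"
  then have ij: "i < n" "j < n" by auto
  have P: "Pmat n \<in> carrier_mat n n" by (simp add: Pmat_def)
  have "(A * Pmat n) $$ (i,j) = (\<Sum>k<n. if k = n - 1 - j then A $$ (i,k) else 0)"
    unfolding mult_index_sum[OF assms P ij] using ij by (intro sum.cong) (auto simp: Pmat_def)
  then show "(A * Pmat n) $$ (i,j) = mat n n (\<lambda>(i,j). A $$ (i, n - 1 - j)) $$ (i,j)"
    using ij by simp
qed (use assms in \<open>auto simp: Pmat_def\<close>)

lemma Pmat_sandwich:
  assumes "A \<in> carrier_mat n n"
  shows "Pmat n * A * Pmat n = mat n n (\<lambda>(i,j). A $$ (n - 1 - i, n - 1 - j))"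
  unfolding Pmat_mult_left[OF assms]
  by (subst Pmat_mult_right) auto

text \<open>A reflection in the antidiagonal combined with conjugation. The reflection exchanges row
  and column roles, which is why lower triangular matrices remain lower triangular.\<close>

lemma reversal_eq:
  assumes "A \<in> carrier_mat n n"
  shows "reversal n A = mat n n (\<lambda>(i,j). cnj (A $$ (n - 1 - j, n - 1 - i)))"
  unfolding reversal_def Pmat_sandwich[OF assms] by (intro eq_matI) auto

lemma reversal_carrier [simp]: "A \<in> carrier_mat n n \<Longrightarrow> reversal n A \<in> carrier_mat n n"
  by (simp add: reversal_eq)

lemma reversal_index:
  "A \<in> carrier_mat n n \<Longrightarrow> i < n \<Longrightarrow> j < n \<Longrightarrow> reversal n A $$ (i,j) = cnj (A $$ (n - 1 - j, n - 1 - i))"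
  by (simp add: reversal_eq)

lemma reversal_reversal [simp]: "A \<in> carrier_mat n n \<Longrightarrow> reversal n (reversal n A) = A"
  by (intro eq_matI) (auto simp: reversal_eq)

lemma reversal_mult:
  assumes "A \<in> carrier_mat n n" "B \<in> carrier_mat n n"
  shows "reversal n (A * B) = reversal n B * reversal n A"
proof (rule eq_matI)
  fix i j assume "i < dim_row (reversal n B * reversal n A)" "j < dim_col (reversal n B * reversal n A)"
  then have ij: "i < n" "j < n" using assms by (auto simp: reversal_eq)
  then have ij': "n - 1 - i < n" "n - 1 - j < n" by auto
  have "reversal n (A * B) $$ (i,j) = (\<Sum>k<n. cnj (A $$ (n - 1 - j, k)) * cnj (B $$ (k, n - 1 - i)))"
    using mult_index_sum[OF assms ij'(2,1)] assms ij by (simp add: reversal_index mult_carrier_mat[of _ n n] del: index_mult_mat(1))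
  also have "\<dots> = (\<Sum>k<n. cnj (A $$ (n - 1 - j, n - Suc k)) * cnj (B $$ (n - Suc k, n - 1 - i)))"
    by (rule sum.nat_diff_reindex[symmetric])
  also have "\<dots> = (reversal n B * reversal n A) $$ (i,j)"
    unfolding mult_index_sum[OF reversal_carrier[OF assms(2)] reversal_carrier[OF assms(1)] ij]
    using assms ij by (intro sum.cong) (auto simp: reversal_index)
  finally show "reversal n (A * B) $$ (i,j) = (reversal n B * reversal n A) $$ (i,j)" .
qed (use assms in \<open>auto simp: reversal_eq mult_carrier_mat[of _ n n]\<close>)

lemma reversal_mat_adjoint:
  "A \<in> carrier_mat n n \<Longrightarrow> reversal n (mat_adjoint A) = mat_adjoint (reversal n A)"
  by (intro eq_matI) (auto simp: reversal_eq)

lemma reversal_herm: "A \<in> herm n \<Longrightarrow> reversal n A \<in> herm n"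
  by (auto simp: herm_iff reversal_eq)

lemma reversal_Lmat: "L \<in> Lmat n \<Longrightarrow> reversal n L \<in> Lmat n"
proof (rule LmatI)
  assume L: "L \<in> Lmat n"
  note LD = LmatD[OF L]
  show "reversal n L \<in> carrier_mat n n" using LD(1) by simp
  show "reversal n L $$ (i,j) = 0" if "i < j" "j < n" for i j
    using LD(1) LD(2)[of "n - 1 - j" "n - 1 - i"] that by (simp add: reversal_index)
  show "reversal n L $$ (i,i) \<in> \<real> \<and> 0 < Re (reversal n L $$ (i,i))" if "i < n" for i
    using LD(1) LD(3,4)[of "n - 1 - i"] that by (auto simp: reversal_index elim!: Reals_cases)
qed

text \<open>Entries are permuted and conjugated, so the sum of their squared moduli is unchanged.
  Openness and density of the leading strata carry over to the trailing ones through this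
  isometry.\<close>

lemma mat_dist_reversal:
  assumes "A \<in> carrier_mat n n" "B \<in> carrier_mat n n"
  shows "mat_dist n (reversal n A) (reversal n B) = mat_dist n A B"
proof -
  let ?g = "\<lambda>i j. (cmod (A $$ (i,j) - B $$ (i,j)))\<^sup>2"
  have "(\<Sum>i<n. \<Sum>j<n. (cmod (reversal n A $$ (i,j) - reversal n B $$ (i,j)))\<^sup>2) =
      (\<Sum>i<n. \<Sum>j<n. ?g (n - Suc j) (n - Suc i))"
    using assms by (intro sum.cong refl) (auto simp: reversal_index simp flip: complex_cnj_diff)
  also have "\<dots> = (\<Sum>i<n. \<Sum>j<n. ?g j (n - Suc i))"
    by (intro sum.cong refl sum.nat_diff_reindex)
  also have "\<dots> = (\<Sum>i<n. \<Sum>j<n. ?g j i)"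
    by (rule sum.nat_diff_reindex)
  also have "\<dots> = (\<Sum>i<n. \<Sum>j<n. ?g i j)"
    by (rule sum.swap)
  finally show ?thesis by (simp add: mat_dist_def)
qed

text \<open>P is an involution, so the two factors det P multiply to 1 and only the adjoint affects
  the determinant.\<close>

lemma det_reversal:
  assumes "A \<in> carrier_mat n n"
  shows "det (reversal n A) = cnj (det A)"
proof -
  have P: "Pmat n \<in> carrier_mat n n" by (simp add: Pmat_def)
  have "Pmat n * Pmat n = 1\<^sub>m n"
    unfolding Pmat_mult_left[OF P] by (intro eq_matI) (auto simp: Pmat_def)
  then have "det (Pmat n) * det (Pmat n) = 1"
    using det_mult[OF P P] by simp
  moreover have "det (Pmat n * A * Pmat n) = det A * (det (Pmat n) * det (Pmat n))"
    using det_mult[OF mult_carrier_mat[OF P assms] P] det_mult[OF P assms] by simp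
  ultimately have "det (Pmat n * A * Pmat n) = det A" by simp
  moreover have "Pmat n * A * Pmat n \<in> carrier_mat n n"
    using mult_carrier_mat[OF mult_carrier_mat[OF P assms] P] .
  ultimately show ?thesis by (simp add: reversal_def det_mat_adjoint)
qed

text \<open>The trailing block of a reversed matrix is the reversal, in size k, of the leading
  block. The conjugate is harmless for membership in a stratum, where the minors are real.\<close>

lemma trailing_minor_reversal:
  assumes "A \<in> carrier_mat n n" "k \<le> n"
  shows "trailing_minor (reversal n A) k = cnj (leading_minor A k)"
proof -
  let ?M = "mat k k (\<lambda>(i,j). A $$ (i,j))"
  have "mat k k (\<lambda>(i,j). reversal n A $$ (n - k + i, n - k + j)) = reversal k ?M"
    using assms by (intro eq_matI) (auto simp: reversal_eq)
  then show ?thesis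
    using assms det_reversal[of ?M k] by (simp add: trailing_minor_eq[of _ n] leading_minor_eq[of _ n])
qed

section \<open>Trailing strata as mirror images of leading strata\<close>

lemma reversal_TPM_iff:
  assumes "A \<in> carrier_mat n n" "signs n e"
  shows "reversal n A \<in> TPM n e \<longleftrightarrow> A \<in> LPM n e"
proof -
  have "reversal n A \<in> herm n \<longleftrightarrow> A \<in> herm n"
    using reversal_herm[of A n] reversal_herm[of "reversal n A" n] assms by auto
  moreover have "sgn (trailing_minor (reversal n A) k) = complex_of_real (e k) \<longleftrightarrow>
      sgn (leading_minor A k) = complex_of_real (e k)" if "k \<in> {1..n}" for k
    using that assms by (simp add: trailing_minor_reversal sgn_eq_sign_iff signs_def complex_is_Real_iff)
  ultimately show ?thesis by (auto simp: TPM_def LPM_def)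
qed

lemma TPM_iff: "A \<in> carrier_mat n n \<Longrightarrow> signs n e \<Longrightarrow> A \<in> TPM n e \<longleftrightarrow> reversal n A \<in> LPM n e"
  using reversal_TPM_iff[of "reversal n A" n e] by simp

lemma TPM_herm: "TPM n e \<subseteq> herm n"
  by (auto simp: TPM_def)

lemma TPMD:
  assumes "A \<in> TPM n e" "signs n e"
  shows "A \<in> carrier_mat n n" "reversal n A \<in> LPM n e"
proof -
  show A: "A \<in> carrier_mat n n" using assms TPM_herm herm_carrier by blast
  then show "reversal n A \<in> LPM n e" using assms TPM_iff by blast
qed

lemma LPM_reversal: "A \<in> LPM n e \<Longrightarrow> signs n e \<Longrightarrow> reversal n A \<in> TPM n e"
  using reversal_TPM_iff LPMD(1) by blast

lemma openin_reversal_herm: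
  assumes "openin (subtopology (mat_topology n) (herm n)) U"
  shows "openin (subtopology (mat_topology n) (herm n)) {A \<in> herm n. reversal n A \<in> U}"
  unfolding openin_sub_mat_topology[OF herm_carrier]
proof (intro conjI ballI)
  fix A assume A: "A \<in> {A \<in> herm n. reversal n A \<in> U}"
  then obtain r where r: "r > 0" "\<And>B. B \<in> herm n \<Longrightarrow> mat_dist n (reversal n A) B < r \<Longrightarrow> B \<in> U"
    using assms unfolding openin_sub_mat_topology[OF herm_carrier] by blast
  have "B \<in> {A \<in> herm n. reversal n A \<in> U}" if "B \<in> herm n" "mat_dist n A B < r" for B
    using r(2)[OF reversal_herm[OF that(1)]] that A mat_dist_reversal[of A n B] herm_carrierD by auto
  then show "\<exists>r>0. \<forall>B\<in>herm n. mat_dist n A B < r \<longrightarrow> B \<in> {A \<in> herm n. reversal n A \<in> U}"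
    using r(1) by blast
qed auto

lemma TPM_eq: "signs n e \<Longrightarrow> TPM n e = {A \<in> herm n. reversal n A \<in> LPM n e}"
  using TPM_iff TPM_herm herm_carrier by blast

lemma openin_TPM: "signs n e \<Longrightarrow> openin (subtopology (mat_topology n) (herm n)) (TPM n e)"
  unfolding TPM_eq by (intro openin_reversal_herm openin_LPM)

lemma open_dense_TPM:
  "open_dense_in (subtopology (mat_topology n) (herm n)) (\<Union>\<delta>\<in>sign_patterns n. TPM n \<delta>)"
  unfolding open_dense_in_mat_topology[OF herm_carrier]
proof (intro conjI ballI allI impI)
  show "openin (subtopology (mat_topology n) (herm n)) (\<Union>\<delta>\<in>sign_patterns n. TPM n \<delta>)"
    by (intro openin_Union) (auto intro: openin_TPM signs_sign_patterns)
  fix A and r :: real assume A: "A \<in> herm n" and r: "0 < r"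
  then obtain \<delta> B where B: "\<delta> \<in> sign_patterns n" "B \<in> LPM n \<delta>" "mat_dist n (reversal n A) B < r"
    using open_dense_LPM[of n] reversal_herm[OF A]
    unfolding open_dense_in_mat_topology[OF herm_carrier] by blast
  then have "mat_dist n A (reversal n B) < r"
    using mat_dist_reversal[of "reversal n A" n B] herm_carrierD[OF A] LPMD(1)[OF B(2)] by simp
  then show "\<exists>B\<in>\<Union>\<delta>\<in>sign_patterns n. TPM n \<delta>. mat_dist n A B < r"
    using B LPM_reversal signs_sign_patterns by blast
qed

lemma TPM_nonempty: "signs n e \<Longrightarrow> TPM n e \<noteq> {}"
  using LPM_nonempty LPM_reversal by blast

lemma disjoint_TPM: "disjoint_family_on (TPM n) (sign_patterns n)"
  unfolding disjoint_family_on_def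
proof (intro ballI impI)
  fix \<delta> \<delta>' assume *: "\<delta> \<in> sign_patterns n" "\<delta>' \<in> sign_patterns n" "\<delta> \<noteq> \<delta>'"
  then show "TPM n \<delta> \<inter> TPM n \<delta>' = {}"
    using sign_patterns_eqI[OF *(1,2)] by (auto simp: TPM_def)
qed

section \<open>Congruence by triangular matrices in the trailing setting\<close>

lemma bij_betw_reversal:
  assumes "signs n e"
  shows "bij_betw (reversal n) (LPM n e) (TPM n e)" "bij_betw (reversal n) (TPM n e) (LPM n e)"
    "bij_betw (reversal n) (Lmat n) (Lmat n)"
  by (rule bij_betw_byWitness[of _ "reversal n"];
      use assms TPMD LPM_reversal LPMD(1) LmatD(1) reversal_Lmat in auto)+

lemma reversal_congruence:
  assumes "L \<in> carrier_mat n n" "B \<in> carrier_mat n n"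
  shows "reversal n (L * B * mat_adjoint L) = mat_adjoint (reversal n L) * reversal n B * reversal n L"
proof -
  have carr: "mat_adjoint L \<in> carrier_mat n n" "L * B \<in> carrier_mat n n"
    using assms by auto
  have rev: "mat_adjoint (reversal n L) \<in> carrier_mat n n"
    using mat_adjoint_carrier[OF reversal_carrier[OF assms(1)]] .
  show ?thesis
    using reversal_mult[OF carr(2,1)] reversal_mult[OF assms] reversal_mat_adjoint[OF assms(1)]
      assoc_mult_mat[OF rev reversal_carrier[OF assms(2)] reversal_carrier[OF assms(1)]] by simp
qed

text \<open>Reversal before and after turns L \<mapsto> L^* C L into the leading congruence with
  base point the reversal of C, so bijectivity and the formula for the inverse need no second
  factorization.\<close>

lemma trailing_congruence_eq:
  assumes "L \<in> carrier_mat n n" "C \<in> carrier_mat n n"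
  shows "mat_adjoint L * C * L = reversal n (reversal n L * reversal n C * mat_adjoint (reversal n L))"
  using reversal_congruence[of "reversal n L" n "reversal n C"] assms by simp

lemma trailing_congruence_bij:
  assumes e: "signs n e" and C: "C \<in> TPM n e"
  shows "bij_betw (\<lambda>L. mat_adjoint L * C * L) (Lmat n) (TPM n e)"
    and "\<And>A. A \<in> TPM n e \<Longrightarrow> inv_into (Lmat n) (\<lambda>L. mat_adjoint L * C * L) A =
      reversal n (cong_inv n e (reversal n C) (reversal n A))"
proof -
  note CD = TPMD[OF C e]
  let ?F = "\<lambda>L. L * reversal n C * mat_adjoint L"
  note F = congruence_bij[OF e CD(2)]
  have eq: "mat_adjoint L * C * L = (reversal n \<circ> (?F \<circ> reversal n)) L" if "L \<in> Lmat n" for L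
    using trailing_congruence_eq[OF LmatD(1)[OF that] CD(1)] by simp
  have "bij_betw (reversal n \<circ> (?F \<circ> reversal n)) (Lmat n) (TPM n e)"
    by (rule bij_betw_trans[OF bij_betw_trans[OF bij_betw_reversal(3)[OF e] F(1)] bij_betw_reversal(1)[OF e]])
  moreover have "bij_betw (\<lambda>L. mat_adjoint L * C * L) (Lmat n) (TPM n e) \<longleftrightarrow>
      bij_betw (reversal n \<circ> (?F \<circ> reversal n)) (Lmat n) (TPM n e)"
    by (rule bij_betw_cong) (rule eq)
  ultimately show bij: "bij_betw (\<lambda>L. mat_adjoint L * C * L) (Lmat n) (TPM n e)" by blast
  fix A assume A: "A \<in> TPM n e"
  note AD = TPMD[OF A e]
  let ?L = "cong_inv n e (reversal n C) (reversal n A)"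
  have L: "?L \<in> Lmat n" using F(3)[OF AD(2)] .
  have "?F ?L = reversal n A"
    using F(2)[OF AD(2)] f_inv_into_f[of "reversal n A" ?F "Lmat n"] bij_betw_imp_surj_on[OF F(1)] AD(2) by simp
  then have "mat_adjoint (reversal n ?L) * C * reversal n ?L = A"
    using eq[OF reversal_Lmat[OF L]] LmatD(1)[OF L] AD(1) by simp
  then show "inv_into (Lmat n) (\<lambda>L. mat_adjoint L * C * L) A = reversal n ?L"
    using bij reversal_Lmat[OF L] by (intro inv_into_f_eq) (auto simp: bij_betw_def)
qed

text \<open>A program transformation that simulates a run on the reversed matrices: each read goes
  to the reflected position and is conjugated. Reads outside the n by n range are left alone, so
  that they fail in both runs; reflecting them with truncated subtraction could turn a failure into
  a success.\<close>

primrec reversed_procedure :: "nat \<Rightarrow> procedure \<Rightarrow> procedure" where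
  "reversed_procedure n (Entry m i j) =
    (if i < n \<and> j < n then Conj (Entry m (n - 1 - j) (n - 1 - i)) else Entry m i j)"
| "reversed_procedure n Unit = Unit"
| "reversed_procedure n (Plus p q) = Plus (reversed_procedure n p) (reversed_procedure n q)"
| "reversed_procedure n (Minus p q) = Minus (reversed_procedure n p) (reversed_procedure n q)"
| "reversed_procedure n (Times p q) = Times (reversed_procedure n p) (reversed_procedure n q)"
| "reversed_procedure n (Divide p q) = Divide (reversed_procedure n p) (reversed_procedure n q)"
| "reversed_procedure n (Conj p) = Conj (reversed_procedure n p)"
| "reversed_procedure n (Root p) = Root (reversed_procedure n p)"

lemma run_reversed_procedure:
  assumes "set Ms \<subseteq> carrier_mat n n"
  shows "run Ms (reversed_procedure n p) = run (map (reversal n) Ms) p"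
proof (induction p)
  case (Entry m i j)
  show ?case
  proof (cases "m < length Ms")
    case True
    then have "Ms ! m \<in> carrier_mat n n" using assms nth_mem by blast
    then show ?thesis using True by (auto simp: reversal_eq)
  qed auto
qed simp_all

lemma computable_reversed:
  assumes "computable D f" "\<And>Ms. Ms \<in> D' \<Longrightarrow> set Ms \<subseteq> carrier_mat n n \<and> map (reversal n) Ms \<in> D"
  shows "computable D' (\<lambda>Ms. f (map (reversal n) Ms))"
proof -
  obtain p where "\<forall>Ms\<in>D. run Ms p = Some (f Ms)" using assms(1) by (auto simp: computable_def)
  then show ?thesis
    unfolding computable_def using assms(2)
    by (intro exI[of _ "reversed_procedure n p"]) (auto simp: run_reversed_procedure)
qed

lemma computable_trailing_inv:
  assumes e: "signs n e" and ij: "i < n" "j < n"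
  shows "computable {[A, B] | A B. A \<in> TPM n e \<and> B \<in> TPM n e}
    (\<lambda>Ms. inv_into (Lmat n) (\<lambda>L. mat_adjoint L * (Ms ! 1) * L) (Ms ! 0) $$ (i,j))"
    (is "computable ?T _")
proof -
  let ?D = "{[A, B] | A B. A \<in> LPM n e \<and> B \<in> LPM n e}"
  \<comment> \<open>The reflected and conjugated position is entry (i,j) of the reversal of the
    leading solution.\<close>
  have "computable ?D (\<lambda>Ms. cnj (cong_inv n e (Ms ! 1) (Ms ! 0) $$ (n - 1 - j, n - 1 - i)))"
    using ij by (intro computable_cnj computable_cong_inv[OF e]) auto
  then have "computable ?T (\<lambda>Ms. cnj (cong_inv n e (map (reversal n) Ms ! 1) (map (reversal n) Ms ! 0) $$ (n - 1 - j, n - 1 - i)))"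
    by (rule computable_reversed[where n = n and f = "\<lambda>Ms. cnj (cong_inv n e (Ms ! 1) (Ms ! 0) $$ (n - 1 - j, n - 1 - i))"])
      (use TPMD[OF _ e] in auto)
  then show ?thesis
  proof (rule computable_cong)
    fix Ms assume "Ms \<in> ?T"
    then obtain A B where Ms: "Ms = [A, B]" "A \<in> TPM n e" "B \<in> TPM n e" by blast
    note BD = TPMD[OF Ms(3) e] and AD = TPMD[OF Ms(2) e]
    have "cong_inv n e (reversal n B) (reversal n A) \<in> carrier_mat n n"
      using congruence_bij(3)[OF e BD(2) AD(2)] LmatD(1) by blast
    then show "cnj (cong_inv n e (map (reversal n) Ms ! 1) (map (reversal n) Ms ! 0) $$ (n - 1 - j, n - 1 - i)) =
        inv_into (Lmat n) (\<lambda>L. mat_adjoint L * (Ms ! 1) * L) (Ms ! 0) $$ (i,j)"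
      using trailing_congruence_bij(2)[OF e Ms(3,2)] ij by (simp add: Ms(1) reversal_index)
  qed
qed

lemma algorithmic_trailing_congruence:
  assumes "signs n e"
  shows "algorithmic_inverse n (Lmat n) (TPM n e) (\<lambda>C L. mat_adjoint L * C * L)"
  by (rule algorithmic_inverseI) (rule computable_trailing_inv[OF assms])

subsection \<open>Diffeomorphisms\<close>

lemma smooth_domain_herm:
  assumes "openin (subtopology (mat_topology n) (herm n)) S"
  shows "smooth_domain n (herm n) S"
  using assms herm_carrier by unfold_locales (auto simp: herm_iff)

lemma smooth_domain_Lmat: "smooth_domain n (low n) (Lmat n)"
  using openin_Lmat low_carrier by unfold_locales (auto simp: low_def)

text \<open>B is an auxiliary matrix supplied to the procedures of both directions, typically the
  base point of a congruence.\<close>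

lemma smooth_diffeo_computable:
  assumes S: "smooth_domain n V S" and T: "smooth_domain n W T" and f: "bij_betw f S T"
    and "\<And>i j. i < n \<Longrightarrow> j < n \<Longrightarrow> computable ((\<lambda>A. [A, B]) ` S) (\<lambda>Ms. f (Ms ! 0) $$ (i,j))"
    and "\<And>i j. i < n \<Longrightarrow> j < n \<Longrightarrow> computable ((\<lambda>A. [A, B]) ` T) (\<lambda>Ms. inv_into S f (Ms ! 0) $$ (i,j))"
  shows "smooth_diffeo n V S W T f"
  unfolding smooth_diffeo_def
  using f smooth_domain.smooth_map_computable[OF S, of B f] smooth_domain.smooth_map_computable[OF T, of B "inv_into S f"]
    assms(4,5) by blast

lemma computable_subset: "computable D f \<Longrightarrow> D' \<subseteq> D \<Longrightarrow> computable D' f"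
  unfolding computable_def by blast

lemma smooth_diffeo_congruence:
  assumes e: "signs n e" and B: "B \<in> LPM n e"
  shows "smooth_diffeo n (low n) (Lmat n) (herm n) (LPM n e) (\<lambda>L. L * B * mat_adjoint L)"
proof (rule smooth_diffeo_computable[OF smooth_domain_Lmat smooth_domain_herm[OF openin_LPM[OF e]], where B = B])
  show "bij_betw (\<lambda>L. L * B * mat_adjoint L) (Lmat n) (LPM n e)"
    using congruence_bij(1)[OF e B] .
  fix i j assume ij: "i < n" "j < n"
  have Bc: "B \<in> carrier_mat n n" using LPMD(1)[OF B] .
  have "computable ((\<lambda>A. [A, B]) ` Lmat n)
      (\<lambda>Ms. \<Sum>k<n. (\<Sum>l<n. Ms ! 0 $$ (i,l) * Ms ! 1 $$ (l,k)) * cnj (Ms ! 0 $$ (j,k)))"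
    using ij Bc LmatD(1) by (intro computable_sum computable_mult computable_cnj computable_entry) fastforce+
  then show "computable ((\<lambda>A. [A, B]) ` Lmat n) (\<lambda>Ms. (Ms ! 0 * B * mat_adjoint (Ms ! 0)) $$ (i,j))"
  proof (rule computable_cong, clarsimp)
    fix L assume "L \<in> Lmat n"
    then have L: "L \<in> carrier_mat n n" by (rule LmatD)
    show "(\<Sum>k<n. (\<Sum>l<n. L $$ (i,l) * B $$ (l,k)) * cnj (L $$ (j,k))) = (L * B * mat_adjoint L) $$ (i,j)"
      unfolding mult_index_sum[OF mult_carrier_mat[OF L Bc] mat_adjoint_carrier[OF L] ij]
      using L ij by (intro sum.cong refl) (simp add: mult_index_sum[OF L Bc] del: index_mult_mat(1))
  qed
  have "computable ((\<lambda>A. [A, B]) ` LPM n e) (\<lambda>Ms. cong_inv n e (Ms ! 1) (Ms ! 0) $$ (i,j))"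
    using B by (intro computable_cong_inv[OF e _ ij]) auto
  then show "computable ((\<lambda>A. [A, B]) ` LPM n e)
      (\<lambda>Ms. inv_into (Lmat n) (\<lambda>L. L * B * mat_adjoint L) (Ms ! 0) $$ (i,j))"
    by (rule computable_cong) (use congruence_bij(2)[OF e B] in auto)
qed

lemma smooth_diffeo_trailing_congruence:
  assumes e: "signs n e" and C: "C \<in> TPM n e"
  shows "smooth_diffeo n (low n) (Lmat n) (herm n) (TPM n e) (\<lambda>L. mat_adjoint L * C * L)"
proof (rule smooth_diffeo_computable[OF smooth_domain_Lmat smooth_domain_herm[OF openin_TPM[OF e]], where B = C])
  show "bij_betw (\<lambda>L. mat_adjoint L * C * L) (Lmat n) (TPM n e)"
    using trailing_congruence_bij(1)[OF e C] .
  fix i j assume ij: "i < n" "j < n"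
  have Cc: "C \<in> carrier_mat n n" using TPMD(1)[OF C e] .
  have "computable ((\<lambda>A. [A, C]) ` Lmat n)
      (\<lambda>Ms. \<Sum>k<n. (\<Sum>l<n. cnj (Ms ! 0 $$ (l,i)) * Ms ! 1 $$ (l,k)) * Ms ! 0 $$ (k,j))"
    using ij Cc LmatD(1) by (intro computable_sum computable_mult computable_cnj computable_entry) fastforce+
  then show "computable ((\<lambda>A. [A, C]) ` Lmat n) (\<lambda>Ms. (mat_adjoint (Ms ! 0) * C * Ms ! 0) $$ (i,j))"
  proof (rule computable_cong, clarsimp)
    fix L assume "L \<in> Lmat n"
    then have L: "L \<in> carrier_mat n n" by (rule LmatD)
    note L' = mat_adjoint_carrier[OF L]
    show "(\<Sum>k<n. (\<Sum>l<n. cnj (L $$ (l,i)) * C $$ (l,k)) * L $$ (k,j)) = (mat_adjoint L * C * L) $$ (i,j)"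
      unfolding mult_index_sum[OF mult_carrier_mat[OF L' Cc] L ij]
      using L ij by (intro sum.cong refl) (simp add: mult_index_sum[OF L' Cc] del: index_mult_mat(1))
  qed
  have "computable ((\<lambda>A. [A, C]) ` TPM n e)
      (\<lambda>Ms. inv_into (Lmat n) (\<lambda>L. mat_adjoint L * (Ms ! 1) * L) (Ms ! 0) $$ (i,j))"
    by (rule computable_subset[OF computable_trailing_inv[OF e ij]]) (use C in auto)
  then show "computable ((\<lambda>A. [A, C]) ` TPM n e)
      (\<lambda>Ms. inv_into (Lmat n) (\<lambda>L. mat_adjoint L * C * L) (Ms ! 0) $$ (i,j))"
    by (rule computable_cong) auto
qed

lemma smooth_diffeo_reversal:
  assumes S: "smooth_domain n V S" and T: "smooth_domain n W T" and bij: "bij_betw (reversal n) S T"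
  shows "smooth_diffeo n V S W T (reversal n)"
\<comment> \<open>Reversal reads one matrix; the identity fills the second slot of the input
  list.\<close>
proof (rule smooth_diffeo_computable[OF S T bij, where B = "1\<^sub>m n"])
  note Sc = smooth_domain.S_carrier[OF S] and Tc = smooth_domain.S_carrier[OF T]
  have comp: "computable ((\<lambda>A. [A, 1\<^sub>m n]) ` U) (\<lambda>Ms. reversal n (Ms ! 0) $$ (i,j))"
    if U: "\<And>A. A \<in> U \<Longrightarrow> A \<in> carrier_mat n n" and ij: "i < n" "j < n" for U i j
  proof -
    have "computable ((\<lambda>A. [A, 1\<^sub>m n]) ` U) (\<lambda>Ms. cnj (Ms ! 0 $$ (n - 1 - j, n - 1 - i)))"
      using U ij by (intro computable_cnj computable_entry) fastforce
    then show ?thesis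
      by (rule computable_cong) (use U ij in \<open>auto simp: reversal_index\<close>)
  qed
  show "computable ((\<lambda>A. [A, 1\<^sub>m n]) ` S) (\<lambda>Ms. reversal n (Ms ! 0) $$ (i,j))"
    if "i < n" "j < n" for i j
    by (rule comp[OF Sc that])
  show "computable ((\<lambda>A. [A, 1\<^sub>m n]) ` T) (\<lambda>Ms. inv_into S (reversal n) (Ms ! 0) $$ (i,j))"
    if ij: "i < n" "j < n" for i j
  proof (rule computable_cong[OF comp[OF Tc ij]])
    fix Ms assume "Ms \<in> (\<lambda>A. [A, 1\<^sub>m n]) ` T"
    then obtain A' where "A' \<in> S" "Ms ! 0 = reversal n A'" using bij by (auto simp: bij_betw_def)
    then show "reversal n (Ms ! 0) $$ (i,j) = inv_into S (reversal n) (Ms ! 0) $$ (i,j)"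
      using bij Sc[of A'] by (simp add: bij_betw_def)
  qed
qed

lemma reversal_linear:
  assumes "A \<in> carrier_mat n n" "B \<in> carrier_mat n n"
  shows "reversal n (complex_of_real a \<cdot>\<^sub>m A + complex_of_real b \<cdot>\<^sub>m B) =
    complex_of_real a \<cdot>\<^sub>m reversal n A + complex_of_real b \<cdot>\<^sub>m reversal n B"
  using assms by (intro eq_matI) (auto simp: reversal_eq)

section \<open>Triangular matrices as inner product spaces\<close>

text \<open>Row-major numbering of the n by n grid by the numbers below n^2, undone by
  \<open>div\<close> and \<open>mod\<close>.\<close>

lemma square_index:
  fixes i j n :: nat
  assumes "i < n" "j < n"
  shows "i * n + j < n\<^sup>2" "(i * n + j) div n = i" "(i * n + j) mod n = j"
proof -
  have "i * n + j < Suc i * n" using assms by simp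
  also have "\<dots> \<le> n * n" using assms by (intro mult_le_mono1) simp
  finally show "i * n + j < n\<^sup>2" by (simp add: power2_eq_square)
qed (use assms in auto)

lemma square_index_bound:
  fixes k n :: nat
  assumes "k < n\<^sup>2"
  shows "k div n < n" "k mod n < n"
  using assms by (auto simp: power2_eq_square less_mult_imp_div_less intro!: mod_less_divisor gr0I)

lemma sum_square_index:
  fixes g :: "nat \<Rightarrow> nat \<Rightarrow> real"
  shows "(\<Sum>k<n\<^sup>2. g (k div n) (k mod n)) = (\<Sum>i<n. \<Sum>j<n. g i j)"
proof -
  have "(\<Sum>k<n\<^sup>2. g (k div n) (k mod n)) = (\<Sum>(i,j)\<in>{..<n} \<times> {..<n}. g i j)"
    by (rule sum.reindex_bij_witness[where i = "\<lambda>(i,j). i * n + j" and j = "\<lambda>k. (k div n, k mod n)"])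
      (auto simp: square_index square_index_bound simp del: div_mult_self3 mod_mult_self3)
  then show ?thesis by (simp add: sum.cartesian_product)
qed

lemma sum_below:
  fixes h :: "nat \<Rightarrow> real"
  assumes "i < n"
  shows "(\<Sum>j<n. if j < i then h j else 0) = (\<Sum>j<i. h j)"
  using assms by (intro sum.mono_neutral_cong_right) auto

text \<open>Each complex entry below the diagonal occupies two cells of the grid, its real part in
  place and its imaginary part in the mirror cell; the diagonal holds logarithms. This accounts for
  n + 2 * (n (n - 1) / 2) = n^2 real coordinates.\<close>

definition Lvec :: "nat \<Rightarrow> complex mat \<Rightarrow> real vec" where
  "Lvec n L = vec (n\<^sup>2) (\<lambda>k. let i = k div n; j = k mod n in
    if j < i then Re (L $$ (i,j)) else if i < j then Im (L $$ (j,i)) else ln (Re (L $$ (i,i))))"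

definition Lvec_inv :: "nat \<Rightarrow> real vec \<Rightarrow> complex mat" where
  "Lvec_inv n v = mat n n (\<lambda>(i,j).
    if j < i then Complex (v $ (i * n + j)) (v $ (j * n + i))
    else if i = j then complex_of_real (exp (v $ (i * n + i))) else 0)"

lemma Lspace_simps [simp]:
  "carrier (Lspace n) = Lmat n" "\<zero>\<^bsub>Lspace n\<^esub> = 1\<^sub>m n"
  by (simp_all add: Lspace_def)

lemma Lspace_add_index:
  "i < n \<Longrightarrow> j < n \<Longrightarrow> (L \<oplus>\<^bsub>Lspace n\<^esub> K) $$ (i,j) =
    (if j < i then L $$ (i,j) + K $$ (i,j) else if i = j then L $$ (i,i) * K $$ (i,i) else 0)"
  by (simp add: Lspace_def)

lemma Lspace_smult_index:
  "i < n \<Longrightarrow> j < n \<Longrightarrow> (r \<odot>\<^bsub>Lspace n\<^esub> L) $$ (i,j) =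
    (if j < i then complex_of_real r * L $$ (i,j)
     else if i = j then complex_of_real (Re (L $$ (i,i)) powr r) else 0)"
  by (simp add: Lspace_def)

lemma Lspace_op_carrier [simp]:
  "L \<oplus>\<^bsub>Lspace n\<^esub> K \<in> carrier_mat n n" "r \<odot>\<^bsub>Lspace n\<^esub> L \<in> carrier_mat n n"
  by (simp_all add: Lspace_def)

lemma Lspace_ip:
  "ip (Lspace n) L K = Re (\<Sum>i<n. \<Sum>j<i. cnj (L $$ (i,j)) * K $$ (i,j)) +
    (\<Sum>j<n. ln (Re (L $$ (j,j))) * ln (Re (K $$ (j,j))))"
  by (simp add: Lspace_def)

lemma Lspace_iso_Euclid: "isometric_iso (Lspace n) (Euclid (n\<^sup>2)) (Lvec n)"
proof (rule isometric_isoI[OF real_ips_Euclid])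
  have inv1: "Lvec_inv n (Lvec n L) = L" if L: "L \<in> Lmat n" for L
  proof (rule eq_matI)
    note LD = LmatD[OF L]
    fix i j assume "i < dim_row L" "j < dim_col L"
    then have ij: "i < n" "j < n" using LD(1) by auto
    have "complex_of_real (Re (L $$ (i,i))) = L $$ (i,i)" using LD(3)[OF ij(1)] by simp
    then show "Lvec_inv n (Lvec n L) $$ (i,j) = L $$ (i,j)"
      using ij LD(2)[of i j] LD(4)[of i]
      by (auto simp: Lvec_inv_def Lvec_def square_index complex_eq_iff)
  qed (use LmatD(1)[OF L] in \<open>auto simp: Lvec_inv_def\<close>)
  have inv2: "Lvec n (Lvec_inv n v) = v" if v: "v \<in> carrier_vec (n\<^sup>2)" for v
  proof (rule eq_vecI)
    fix k assume "k < dim_vec v"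
    then have k: "k < n\<^sup>2" using v by auto
    have "v $ (k div n * n + k div n) = v $ k" if "k mod n = k div n"
      using div_mult_mod_eq[of k n] that by metis
    then show "Lvec n (Lvec_inv n v) $ k = v $ k"
      using k square_index_bound[OF k] by (auto simp: Lvec_inv_def Lvec_def Let_def)
  qed (use v in \<open>auto simp: Lvec_def\<close>)
  show "bij_betw (Lvec n) (carrier (Lspace n)) (carrier (Euclid (n\<^sup>2)))"
  proof (rule bij_betw_byWitness[of _ "Lvec_inv n"])
    show "Lvec n ` carrier (Lspace n) \<subseteq> carrier (Euclid (n\<^sup>2))"
      by (auto simp: Lvec_def)
    show "Lvec_inv n ` carrier (Euclid (n\<^sup>2)) \<subseteq> carrier (Lspace n)"
      by (auto simp: Lvec_inv_def intro!: LmatI)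
  qed (simp_all add: inv1 inv2)
  show "\<zero>\<^bsub>Lspace n\<^esub> \<in> carrier (Lspace n)" by (simp add: Lmat_one)
  show "Lvec n \<zero>\<^bsub>Lspace n\<^esub> = \<zero>\<^bsub>Euclid (n\<^sup>2)\<^esub>"
    by (intro eq_vecI) (auto simp: Lvec_def Let_def square_index_bound)
  fix L K assume "L \<in> carrier (Lspace n)" "K \<in> carrier (Lspace n)"
  then have LK: "L \<in> Lmat n" "K \<in> Lmat n" by auto
  note LD = LmatD[OF LK(1)] and KD = LmatD[OF LK(2)]
  show "L \<oplus>\<^bsub>Lspace n\<^esub> K \<in> carrier (Lspace n)"
    using LD(3,4) KD(3,4) unfolding Lspace_simps
    by (intro LmatI) (simp_all add: Lspace_add_index complex_is_Real_iff)
  show "Lvec n (L \<oplus>\<^bsub>Lspace n\<^esub> K) = Lvec n L \<oplus>\<^bsub>Euclid (n\<^sup>2)\<^esub> Lvec n K"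
  proof (rule eq_vecI)
    fix k assume "k < dim_vec (Lvec n L \<oplus>\<^bsub>Euclid (n\<^sup>2)\<^esub> Lvec n K)"
    then have k: "k < n\<^sup>2" by (simp add: Lvec_def)
    define i j where "i = k div n" and "j = k mod n"
    have ij: "i < n" "j < n" using square_index_bound[OF k] by (auto simp: i_def j_def)
    have "ln (Re (L $$ (i,i) * K $$ (i,i))) = ln (Re (L $$ (i,i))) + ln (Re (K $$ (i,i)))"
      using LD(3,4)[OF ij(1)] KD(3,4)[OF ij(1)] by (auto elim!: Reals_cases simp: ln_mult)
    then show "Lvec n (L \<oplus>\<^bsub>Lspace n\<^esub> K) $ k = (Lvec n L \<oplus>\<^bsub>Euclid (n\<^sup>2)\<^esub> Lvec n K) $ k"
      using k ij by (simp add: Lvec_def Let_def Lspace_add_index i_def[symmetric] j_def[symmetric])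
  qed (simp add: Lvec_def)
  show "ip (Lspace n) L K = ip (Euclid (n\<^sup>2)) (Lvec n L) (Lvec n K)"
  proof -
    \<comment> \<open>Three summands with disjoint supports in place of nested conditionals, so that
      the double sum splits by \<open>sum.distrib\<close>.\<close>
    define g where "g = (\<lambda>i j. (if j < i then Re (L $$ (i,j)) * Re (K $$ (i,j)) else 0) +
      (if i < j then Im (L $$ (j,i)) * Im (K $$ (j,i)) else 0) +
      (if i = j then ln (Re (L $$ (i,i))) * ln (Re (K $$ (i,i))) else 0))"
    have "ip (Euclid (n\<^sup>2)) (Lvec n L) (Lvec n K) = (\<Sum>k<n\<^sup>2. g (k div n) (k mod n))"
      unfolding Euclid_simps scalar_prod_def
    proof (rule sum.cong)
      fix k assume "k \<in> {..<n\<^sup>2}"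
      then show "Lvec n L $ k * Lvec n K $ k = g (k div n) (k mod n)"
        by (auto simp: Lvec_def Let_def g_def)
    qed (auto simp: Lvec_def)
    also have "\<dots> = (\<Sum>i<n. \<Sum>j<n. g i j)"
      by (rule sum_square_index)
    also have "\<dots> = (\<Sum>i<n. \<Sum>j<n. if j < i then Re (L $$ (i,j)) * Re (K $$ (i,j)) else 0) +
        (\<Sum>i<n. \<Sum>j<n. if i < j then Im (L $$ (j,i)) * Im (K $$ (j,i)) else 0) +
        (\<Sum>i<n. ln (Re (L $$ (i,i))) * ln (Re (K $$ (i,i))))"
      by (simp add: g_def sum.distrib)
    \<comment> \<open>Exchanging the summations brings the imaginary parts below the diagonal, where
      they combine with the real parts to Re (cnj z * w).\<close>
    also have "(\<Sum>i<n. \<Sum>j<n. if i < j then Im (L $$ (j,i)) * Im (K $$ (j,i)) else 0) =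
        (\<Sum>i<n. \<Sum>j<n. if j < i then Im (L $$ (i,j)) * Im (K $$ (i,j)) else 0)"
      by (rule sum.swap)
    also have "(\<Sum>i<n. \<Sum>j<n. if j < i then Re (L $$ (i,j)) * Re (K $$ (i,j)) else 0) +
        (\<Sum>i<n. \<Sum>j<n. if j < i then Im (L $$ (i,j)) * Im (K $$ (i,j)) else 0) =
        Re (\<Sum>i<n. \<Sum>j<i. cnj (L $$ (i,j)) * K $$ (i,j))"
      by (simp add: sum_below sum.distrib Re_sum)
    finally show ?thesis by (simp add: Lspace_ip)
  qed
next
  fix r L assume "L \<in> carrier (Lspace n)"
  then have L: "L \<in> Lmat n" by simp
  note LD = LmatD[OF L]
  show "r \<odot>\<^bsub>Lspace n\<^esub> L \<in> carrier (Lspace n)"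
    using Lmat_diag_nonzero[OF L] LD(3,4) unfolding Lspace_simps
    by (intro LmatI) (auto simp: Lspace_smult_index complex_is_Real_iff complex_eq_iff)
  show "Lvec n (r \<odot>\<^bsub>Lspace n\<^esub> L) = r \<odot>\<^bsub>Euclid (n\<^sup>2)\<^esub> Lvec n L"
  proof (rule eq_vecI)
    fix k assume "k < dim_vec (r \<odot>\<^bsub>Euclid (n\<^sup>2)\<^esub> Lvec n L)"
    then have k: "k < n\<^sup>2" by (simp add: Lvec_def)
    define i j where "i = k div n" and "j = k mod n"
    have ij: "i < n" "j < n" using square_index_bound[OF k] by (auto simp: i_def j_def)
    show "Lvec n (r \<odot>\<^bsub>Lspace n\<^esub> L) $ k = (r \<odot>\<^bsub>Euclid (n\<^sup>2)\<^esub> Lvec n L) $ k"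
      using k ij LD(4)[OF ij(1)]
      by (simp add: Lvec_def Let_def Lspace_smult_index i_def[symmetric] j_def[symmetric] ln_powr)
  qed (simp add: Lvec_def)
qed

lemma real_ips_Lspace: "real_ips (Lspace n)"
  using Lspace_iso_Euclid by (rule isometric_isoD)

lemma LPMspace_iso: "signs n e \<Longrightarrow> isometric_iso (Lspace n) (LPMspace n e) (LDL n e)"
  unfolding LPMspace_def
  by (intro isometric_iso_transport real_ips_Lspace) (simp add: bij_betw_LDL)

text \<open>D is real and diagonal, so P D P is its reversal, and D itself is \<open>LDL\<close> of
  the identity. Hence \<open>LPDPL\<close> is the trailing congruence with this base point.\<close>

lemma LPDPL_TPM: "signs n e \<Longrightarrow> Pmat n * Dmat n e * Pmat n \<in> TPM n e"
proof -
  assume e: "signs n e"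
  have D: "Dmat n e \<in> LPM n e"
  proof -
    have "mat_adjoint (1\<^sub>m n) = (1\<^sub>m n :: complex mat)" by (intro eq_matI) auto
    then have "LDL n e (1\<^sub>m n) = Dmat n e"
      unfolding LDL_def using left_mult_one_mat[OF Dmat_carrier] right_mult_one_mat[OF Dmat_carrier] by simp
    then show ?thesis using LDL_LPM[OF e Lmat_one] by simp
  qed
  have "reversal n (Dmat n e) = Pmat n * Dmat n e * Pmat n"
    unfolding reversal_eq[OF Dmat_carrier] Pmat_sandwich[OF Dmat_carrier]
    by (intro eq_matI) (auto simp: Dmat_def mat_diag_def)
  then show ?thesis using LPM_reversal[OF D e] by simp
qed

lemma TPMspace_iso: "signs n e \<Longrightarrow> isometric_iso (Lspace n) (TPMspace n e) (LPDPL n e)"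
  unfolding TPMspace_def
  using trailing_congruence_bij(1)[OF _ LPDPL_TPM]
  by (intro isometric_iso_transport real_ips_Lspace) (simp add: LPDPL_def[abs_def])

lemma isometrically_isomorphic_via:
  "isometric_iso X Y f \<Longrightarrow> isometric_iso X Z g \<Longrightarrow> isometrically_isomorphic Y Z"
  unfolding isometrically_isomorphic_def using isometric_iso_comp isometric_iso_inv by blast

subsection \<open>Semi-infinite triangular matrices\<close>

text \<open>Cantor's pairing as an enumeration of the strict lower triangle: i - j - 1 and j are the
  two free coordinates of a position (i,j).\<close>

definition below :: "nat \<Rightarrow> nat \<times> nat" where
  "below k = (case prod_decode k of (a, b) \<Rightarrow> (a + b + 1, b))"

definition below_inv :: "nat \<times> nat \<Rightarrow> nat" where
  "below_inv = (\<lambda>(i, j). prod_encode (i - j - 1, j))"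

lemma below_inv_below [simp]: "below_inv (below k) = k"
  by (auto simp: below_def below_inv_def split: prod.splits) (metis prod_decode_inverse)

lemma below_below_inv [simp]: "j < i \<Longrightarrow> below (below_inv (i, j)) = (i, j)"
  by (simp add: below_def below_inv_def)

lemma below_less: "below k = (i, j) \<Longrightarrow> j < i"
  by (auto simp: below_def split: prod.splits)

lemma bij_betw_below: "bij_betw below UNIV {(i,j). j < i}"
  by (rule bij_betw_byWitness[of _ below_inv]) (auto dest: below_less[OF sym])

definition diag_seq :: "smat \<Rightarrow> nat \<Rightarrow> real" where
  "diag_seq L = (\<lambda>i. ln (Re (L i i)))"

definition off_seq :: "smat \<Rightarrow> nat \<Rightarrow> complex" where
  "off_seq L = (\<lambda>k. case below k of (i, j) \<Rightarrow> L i j)"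

definition smat_of_seqs :: "(nat \<Rightarrow> real) \<Rightarrow> (nat \<Rightarrow> complex) \<Rightarrow> smat" where
  "smat_of_seqs x y = (\<lambda>i j. if j < i then y (below_inv (i, j))
    else if i = j then complex_of_real (exp (x i)) else 0)"

lemma LsmatD:
  assumes "L \<in> Lsmat"
  shows "i < j \<Longrightarrow> L i j = 0" "L i i \<in> \<real>" "0 < Re (L i i)"
  using assms by (auto simp: Lsmat_def)

lemma smat_of_seqs_Lsmat: "smat_of_seqs x y \<in> Lsmat"
  by (auto simp: Lsmat_def smat_of_seqs_def)

lemma diag_seq_smat_of_seqs [simp]: "diag_seq (smat_of_seqs x y) = x"
  by (auto simp: diag_seq_def smat_of_seqs_def)

lemma off_seq_smat_of_seqs [simp]: "off_seq (smat_of_seqs x y) = y"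
proof
  fix k
  obtain i j where ij: "below k = (i, j)" by fastforce
  then have "below_inv (i, j) = k" by (metis below_inv_below)
  then show "off_seq (smat_of_seqs x y) k = y k"
    using ij below_less[OF ij] by (simp add: off_seq_def smat_of_seqs_def)
qed

lemma smat_of_seqs_seqs [simp]:
  assumes "L \<in> Lsmat"
  shows "smat_of_seqs (diag_seq L) (off_seq L) = L"
proof (intro ext)
  fix i j
  have "complex_of_real (Re (L i i)) = L i i" using LsmatD(2)[OF assms] by simp
  then show "smat_of_seqs (diag_seq L) (off_seq L) i j = L i j"
    using LsmatD(1,3)[OF assms] by (auto simp: smat_of_seqs_def diag_seq_def off_seq_def neq_iff)
qed

lemma sLspace_simps [simp]:
  "carrier (sLspace S) = S"
  "\<zero>\<^bsub>sLspace S\<^esub> = (\<lambda>i j. if i = j then 1 else 0)"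
  "L \<oplus>\<^bsub>sLspace S\<^esub> K = (\<lambda>i j. if j < i then L i j + K i j else if i = j then L i i * K i i else 0)"
  "r \<odot>\<^bsub>sLspace S\<^esub> L = (\<lambda>i j. if j < i then complex_of_real r * L i j
     else if i = j then complex_of_real (Re (L i i) powr r) else 0)"
  by (simp_all add: sLspace_def)

lemma sLspace_ip:
  "ip (sLspace S) L K = Re (\<Sum>\<^sub>\<infinity>(i,j)\<in>{(i,j). j < i}. cnj (L i j) * K i j) +
    (\<Sum>\<^sub>\<infinity>j. ln (Re (L j j)) * ln (Re (K j j)))"
  by (simp add: sLspace_def)

lemma off_seq_apply: "off_seq L k = L (fst (below k)) (snd (below k))"
  by (simp add: off_seq_def case_prod_unfold)

lemma snd_below_less [simp]: "snd (below k) < fst (below k)"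
  using below_less[of k "fst (below k)" "snd (below k)"] by simp

lemma Lsmat_add: "L \<in> Lsmat \<Longrightarrow> K \<in> Lsmat \<Longrightarrow> L \<oplus>\<^bsub>sLspace S\<^esub> K \<in> Lsmat"
  using LsmatD(2,3)[of L] LsmatD(2,3)[of K] by (auto simp: Lsmat_def complex_is_Real_iff)

lemma Lsmat_smult: "L \<in> Lsmat \<Longrightarrow> r \<odot>\<^bsub>sLspace S\<^esub> L \<in> Lsmat"
  using LsmatD(3)[of L] by (auto simp: Lsmat_def less_imp_neq[symmetric])

lemma seqs_add:
  assumes "L \<in> Lsmat" "K \<in> Lsmat"
  shows "diag_seq (L \<oplus>\<^bsub>sLspace S\<^esub> K) = (\<lambda>i. diag_seq L i + diag_seq K i)"
    "off_seq (L \<oplus>\<^bsub>sLspace S\<^esub> K) = (\<lambda>k. off_seq L k + off_seq K k)"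
  using LsmatD(2,3)[OF assms(1)] LsmatD(2,3)[OF assms(2)]
  by (auto simp: diag_seq_def off_seq_apply complex_is_Real_iff ln_mult_pos simp del: ln_mult)

lemma seqs_smult:
  assumes "L \<in> Lsmat"
  shows "diag_seq (r \<odot>\<^bsub>sLspace S\<^esub> L) = (\<lambda>i. r *\<^sub>R diag_seq L i)"
    "off_seq (r \<odot>\<^bsub>sLspace S\<^esub> L) = (\<lambda>k. r *\<^sub>R off_seq L k)"
  using LsmatD(3)[OF assms]
  by (auto simp: diag_seq_def off_seq_apply ln_powr scaleR_conv_of_real)

text \<open>Square summability makes the complex off-diagonal series summable, which is what allows
  \<open>Re\<close> to move inside it. The enumeration \<open>below\<close> then turns a sum over
  positions into a sum over the naturals.\<close>

lemma sLspace_ip_seqs: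
  assumes "square_summable (off_seq L) UNIV" "square_summable (off_seq K) UNIV"
  shows "ip (sLspace S) L K =
    (\<Sum>\<^sub>\<infinity>i. inner (diag_seq L i) (diag_seq K i)) + (\<Sum>\<^sub>\<infinity>k. inner (off_seq L k) (off_seq K k))"
proof -
  have inner: "inner z w = Re (cnj z * w)" for z w :: complex
    by (simp add: inner_complex_def)
  have "(\<lambda>k. cnj (off_seq L k) * off_seq K k) summable_on UNIV"
  proof (rule Infinite_Sum.abs_summable_summable, rule Infinite_Sum.abs_summable_on_comparison_test')
    show "(\<lambda>k. (norm (off_seq L k))\<^sup>2 + (norm (off_seq K k))\<^sup>2) summable_on UNIV"
      using assms unfolding square_summable_def by (rule summable_on_add)
    show "norm (cnj (off_seq L k) * off_seq K k) \<le> (norm (off_seq L k))\<^sup>2 + (norm (off_seq K k))\<^sup>2" for k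
    proof -
      have "norm (cnj (off_seq L k) * off_seq K k) \<le> 2 * norm (off_seq L k) * norm (off_seq K k)"
        by (simp add: norm_mult)
      also have "\<dots> \<le> (norm (off_seq L k))\<^sup>2 + (norm (off_seq K k))\<^sup>2" by (rule sum_squares_bound)
      finally show ?thesis .
    qed
  qed
  then have "(\<Sum>\<^sub>\<infinity>k. inner (off_seq L k) (off_seq K k)) = Re (\<Sum>\<^sub>\<infinity>k. cnj (off_seq L k) * off_seq K k)"
    unfolding inner by (rule infsum_Re)
  also have "(\<Sum>\<^sub>\<infinity>k. cnj (off_seq L k) * off_seq K k) = (\<Sum>\<^sub>\<infinity>(i,j)\<in>{(i,j). j < i}. cnj (L i j) * K i j)"
    using infsum_reindex_bij_betw[OF bij_betw_below, of "\<lambda>(i,j). cnj (L i j) * K i j"]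
    by (simp add: off_seq_apply case_prod_unfold)
  finally show ?thesis by (simp add: sLspace_ip diag_seq_def)
qed

text \<open>One statement for both semi-infinite spaces: each is cut out of \<open>Lsmat\<close> by
  a condition on the logarithms of the diagonal and a condition on the enumerated off-diagonal
  entries.\<close>

lemma sLspace_iso:
  assumes S: "S = {L \<in> Lsmat. diag_seq L \<in> T1 \<and> off_seq L \<in> T2}"
    and ips: "real_ips (seq_space T1)" "real_ips (seq_space T2)"
    and summable: "\<And>y. y \<in> T2 \<Longrightarrow> square_summable y UNIV"
  shows "isometric_iso (sLspace S) (ips_sum (seq_space T1) (seq_space T2)) (\<lambda>L. (diag_seq L, off_seq L))"
proof (rule isometric_isoI[OF real_ips_sum[OF ips]])
  interpret T1: real_ips "seq_space T1" by (rule ips)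
  interpret T2: real_ips "seq_space T2" by (rule ips)
  have SD: "L \<in> Lsmat" "diag_seq L \<in> T1" "off_seq L \<in> T2" if "L \<in> S" for L
    using that by (auto simp: S)
  have zero: "diag_seq (\<lambda>i j. if i = j then 1 else 0) = (\<lambda>_. 0)"
    "off_seq (\<lambda>i j. if i = j then 1 else 0) = (\<lambda>_. 0)"
    using less_imp_neq[OF snd_below_less] by (auto simp: diag_seq_def off_seq_apply fun_eq_iff eq_commute)
  show "bij_betw (\<lambda>L. (diag_seq L, off_seq L)) (carrier (sLspace S)) (carrier (ips_sum (seq_space T1) (seq_space T2)))"
    by (rule bij_betw_byWitness[of _ "\<lambda>(x, y). smat_of_seqs x y"])
      (auto simp: S smat_of_seqs_Lsmat)
  have "(\<lambda>i j. if i = j then 1 else 0) \<in> Lsmat" by (simp add: Lsmat_def)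
  then show "\<zero>\<^bsub>sLspace S\<^esub> \<in> carrier (sLspace S)"
    using T1.M.zero_closed T2.M.zero_closed by (simp add: S zero)
  show "(diag_seq \<zero>\<^bsub>sLspace S\<^esub>, off_seq \<zero>\<^bsub>sLspace S\<^esub>) = \<zero>\<^bsub>ips_sum (seq_space T1) (seq_space T2)\<^esub>"
    by (simp add: zero)
  fix L K assume "L \<in> carrier (sLspace S)" "K \<in> carrier (sLspace S)"
  then have LK: "L \<in> S" "K \<in> S" by auto
  note LD = SD[OF LK(1)] and KD = SD[OF LK(2)]
  show "L \<oplus>\<^bsub>sLspace S\<^esub> K \<in> carrier (sLspace S)"
    using Lsmat_add[OF LD(1) KD(1), where S = S] seqs_add[OF LD(1) KD(1), where S = S]
      T1.M.add.m_closed[of "diag_seq L" "diag_seq K"] T2.M.add.m_closed[of "off_seq L" "off_seq K"] LD KD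
    unfolding seq_space_simps sLspace_simps(1) by (subst S) (simp del: sLspace_simps)
  show "(diag_seq (L \<oplus>\<^bsub>sLspace S\<^esub> K), off_seq (L \<oplus>\<^bsub>sLspace S\<^esub> K)) =
      (diag_seq L, off_seq L) \<oplus>\<^bsub>ips_sum (seq_space T1) (seq_space T2)\<^esub> (diag_seq K, off_seq K)"
    unfolding seqs_add[OF LD(1) KD(1)] by simp
  show "ip (sLspace S) L K = ip (ips_sum (seq_space T1) (seq_space T2)) (diag_seq L, off_seq L) (diag_seq K, off_seq K)"
    using sLspace_ip_seqs[OF summable[OF LD(3)] summable[OF KD(3)]] by simp
next
  fix r L assume "L \<in> carrier (sLspace S)"
  then have L: "L \<in> Lsmat" "diag_seq L \<in> T1" "off_seq L \<in> T2" by (auto simp: S)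
  interpret T1: real_ips "seq_space T1" by (rule ips)
  interpret T2: real_ips "seq_space T2" by (rule ips)
  show "r \<odot>\<^bsub>sLspace S\<^esub> L \<in> carrier (sLspace S)"
    using Lsmat_smult[OF L(1), where r = r and S = S] seqs_smult[OF L(1), where r = r and S = S]
      T1.smult_closed'[of "diag_seq L" r] T2.smult_closed'[of "off_seq L" r] L
    unfolding seq_space_simps sLspace_simps(1) by (subst S) (simp del: sLspace_simps)
  show "(diag_seq (r \<odot>\<^bsub>sLspace S\<^esub> L), off_seq (r \<odot>\<^bsub>sLspace S\<^esub> L)) =
      r \<odot>\<^bsub>ips_sum (seq_space T1) (seq_space T2)\<^esub> (diag_seq L, off_seq L)"
    unfolding seqs_smult[OF L(1)] by simp
qed

lemma LH_eq: "LH = {L \<in> Lsmat. diag_seq L \<in> {x. square_summable x UNIV} \<and> off_seq L \<in> {x. square_summable x UNIV}}"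
proof -
  have "(\<lambda>(i,j). (cmod (L i j))\<^sup>2) summable_on {(i,j). j < i} \<longleftrightarrow> square_summable (off_seq L) UNIV" for L
    using summable_on_reindex_bij_betw[OF bij_betw_below, of "\<lambda>(i,j). (cmod (L i j))\<^sup>2"]
    by (simp add: square_summable_def off_seq_apply case_prod_unfold)
  then show ?thesis by (auto simp: LH_def square_summable_def diag_seq_def)
qed

text \<open>A positive real diagonal entry is 1 iff its logarithm is 0, so finitely many exceptions
  become finite support.\<close>

lemma L00_eq: "L00 = {L \<in> Lsmat. diag_seq L \<in> {x. finite {i. x i \<noteq> 0}} \<and> off_seq L \<in> {x. finite {i. x i \<noteq> 0}}}"
proof -
  have "{j. L j j \<noteq> 1} = {j. diag_seq L j \<noteq> 0}" if "L \<in> Lsmat" for L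
    using LsmatD(2,3)[OF that] by (auto simp: diag_seq_def complex_eq_iff complex_is_Real_iff)
  moreover have "finite {(i,j). j < i \<and> L i j \<noteq> 0} \<longleftrightarrow> finite {k. off_seq L k \<noteq> 0}" for L
  proof -
    have "{(i,j). j < i \<and> L i j \<noteq> 0} = below ` {k. off_seq L k \<noteq> 0}"
    proof safe
      fix i j assume "j < i" "L i j \<noteq> 0"
      then show "(i, j) \<in> below ` {k. off_seq L k \<noteq> 0}"
        by (intro image_eqI[of _ _ "below_inv (i, j)"]) (auto simp: off_seq_def)
    next
      fix i j k assume "(i, j) = below k" "off_seq L k \<noteq> 0"
      then show "j < i" "L i j = 0 \<Longrightarrow> False"
        using below_less[of k i j] by (auto simp: off_seq_def split: prod.splits)
    qed
    moreover have "inj below" using bij_betw_below by (simp add: bij_betw_def)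
    ultimately show ?thesis by (metis finite_image_iff inj_on_subset subset_UNIV)
  qed
  ultimately show ?thesis by (auto simp: L00_def)
qed

lemma LHspace_iso:
  "isometric_iso LHspace (ips_sum ell2 ell2) (\<lambda>L. (diag_seq L, off_seq L))"
  unfolding LHspace_def ell2_eq
  by (intro sLspace_iso LH_eq real_ips_ell2[unfolded ell2_eq]) auto

lemma L00space_iso:
  "isometric_iso L00space (ips_sum c00 c00) (\<lambda>L. (diag_seq L, off_seq L))"
  unfolding L00space_def c00_def
  by (intro sLspace_iso L00_eq real_ips_c00[unfolded c00_def]) (auto intro: square_summable_finite_support)

lemma splits_entries_seqs: "splits_entries S (\<lambda>L. (diag_seq L, off_seq L))"
  unfolding splits_entries_def by (auto simp: diag_seq_def off_seq_apply)

section \<open>The factorization for semi-infinite matrices\<close>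

definition truncate :: "nat \<Rightarrow> smat \<Rightarrow> complex mat" where
  "truncate n L = mat n n (\<lambda>(i,j). L i j)"

lemma truncate_Lmat: "L \<in> Lsmat \<Longrightarrow> truncate n L \<in> Lmat n"
  by (rule LmatI) (auto simp: truncate_def LsmatD)

text \<open>Both infinite sums collapse: the inner one because D is diagonal, the outer one because
  row i of L is zero from column n on.\<close>

lemma sLDL_index:
  assumes L: "\<And>i k. i < k \<Longrightarrow> L i k = 0" and i: "i < n"
  shows "sLDL e L i j = (\<Sum>k<n. L i k * complex_of_real (dsign e k) * cnj (L j k))"
proof -
  have 1: "smat_mult L (Dsmat e) i k = L i k * complex_of_real (dsign e k)" for k
  proof -
    have "smat_mult L (Dsmat e) i k = (\<Sum>\<^sub>\<infinity>p\<in>{k}. L i p * Dsmat e p k)"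
      unfolding smat_mult_def by (rule infsum_cong_neutral) (auto simp: Dsmat_def)
    then show ?thesis by (simp add: Dsmat_def)
  qed
  have "sLDL e L i j = (\<Sum>\<^sub>\<infinity>k. L i k * complex_of_real (dsign e k) * cnj (L j k))"
    unfolding sLDL_def smat_mult_def[of "smat_mult L (Dsmat e)"] 1 smat_adjoint_def ..
  also have "\<dots> = (\<Sum>\<^sub>\<infinity>k\<in>{..<n}. L i k * complex_of_real (dsign e k) * cnj (L j k))"
    using L i by (intro infsum_cong_neutral) auto
  finally show ?thesis by simp
qed

lemma truncate_sLDL:
  assumes "L \<in> Lsmat"
  shows "truncate n (sLDL e L) = LDL n e (truncate n L)"
proof (rule eq_matI)
  have carr: "truncate n L \<in> carrier_mat n n" by (simp add: truncate_def)
  then have dim: "LDL n e (truncate n L) \<in> carrier_mat n n" by simp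
  fix i j assume "i < dim_row (LDL n e (truncate n L))" "j < dim_col (LDL n e (truncate n L))"
  then have ij: "i < n" "j < n" using dim by auto
  show "truncate n (sLDL e L) $$ (i,j) = LDL n e (truncate n L) $$ (i,j)"
    using ij sLDL_index[where L = L and e = e and j = j, OF LsmatD(1)[OF assms] ij(1)] carr
    by (simp add: LDL_index) (simp add: truncate_def)
qed (auto simp: truncate_def LDL_def)

text \<open>Truncation commutes with the factorization map, so equal images have equal finite
  factors at every size. A block of order \<open>Suc (max i j)\<close> contains entry (i,j).\<close>

lemma inj_on_sLDL:
  assumes "inf_sign_pattern e"
  shows "inj_on (sLDL e) Lsmat"
proof
  fix L K assume LK: "L \<in> Lsmat" "K \<in> Lsmat" "sLDL e L = sLDL e K"
  show "L = K"
  proof (intro ext)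
    fix i j
    define n where "n = Suc (max i j)"
    have "LDL n e (truncate n L) = LDL n e (truncate n K)"
      using LK by (simp flip: truncate_sLDL)
    then have "truncate n L = truncate n K"
      using inj_onD[OF bij_betw_imp_inj_on[OF bij_betw_LDL[OF signs_inf_sign_pattern[OF assms, of n]]]]
        truncate_Lmat LK by blast
    then have "truncate n L $$ (i,j) = truncate n K $$ (i,j)" by simp
    then show "L i j = K i j" by (simp add: truncate_def n_def)
  qed
qed

subsection \<open>Direct limits\<close>

lemma bordered_index:
  "A \<in> carrier_mat n n \<Longrightarrow> i < Suc n \<Longrightarrow> j < Suc n \<Longrightarrow>
    bordered n c A $$ (i,j) = (if i < n \<and> j < n then A $$ (i,j) else if i = j then c else 0)"
  by (auto simp: bordered_def)

lemma bordered_carrier [simp]: "A \<in> carrier_mat n n \<Longrightarrow> bordered n c A \<in> carrier_mat (Suc n) (Suc n)"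
  by (auto simp: bordered_def)

lemma bordered_Lmat: "L \<in> Lmat n \<Longrightarrow> bordered n 1 L \<in> Lmat (Suc n)"
  using LmatD[of L n] by (intro LmatI) (auto simp: bordered_index)

text \<open>A diagonal entry 1 is the zero of the logarithmic coordinate: it is stable under
  products and powers and contributes ln 1 = 0 to the inner product.\<close>

lemma isometric_map_bordered: "isometric_map (Lspace n) (Lspace (Suc n)) (bordered n 1)"
proof (rule isometric_mapI[OF real_ips_Lspace real_ips_Lspace])
  fix L K assume "L \<in> carrier (Lspace n)" "K \<in> carrier (Lspace n)"
  then have carr: "L \<in> carrier_mat n n" "K \<in> carrier_mat n n" using LmatD(1) by auto
  show "bordered n 1 (L \<oplus>\<^bsub>Lspace n\<^esub> K) = bordered n 1 L \<oplus>\<^bsub>Lspace (Suc n)\<^esub> bordered n 1 K"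
    using carrier_matD[OF bordered_carrier[OF Lspace_op_carrier(1)[of n L K], of 1]]
      carrier_matD[OF Lspace_op_carrier(1)[of "Suc n" "bordered n 1 L" "bordered n 1 K"]]
    by (intro eq_matI) (auto simp: bordered_index carr Lspace_add_index)
  have "(\<Sum>j<i. cnj (bordered n 1 L $$ (i,j)) * bordered n 1 K $$ (i,j)) =
      (\<Sum>j<i. cnj (L $$ (i,j)) * K $$ (i,j))" if "i < n" for i
    using that carr by (intro sum.cong) (auto simp: bordered_index)
  moreover have "(\<Sum>j<n. cnj (bordered n 1 L $$ (n,j)) * bordered n 1 K $$ (n,j)) = 0"
    using carr by (intro sum.neutral) (auto simp: bordered_index)
  ultimately show "ip (Lspace (Suc n)) (bordered n 1 L) (bordered n 1 K) = ip (Lspace n) L K"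
    using carr by (simp add: Lspace_ip bordered_index)
next
  fix r L assume "L \<in> carrier (Lspace n)"
  then have carr: "L \<in> carrier_mat n n" using LmatD(1) by auto
  show "bordered n 1 (r \<odot>\<^bsub>Lspace n\<^esub> L) = r \<odot>\<^bsub>Lspace (Suc n)\<^esub> bordered n 1 L"
    using carrier_matD[OF bordered_carrier[OF Lspace_op_carrier(2)[where n = n and r = r and L = L], of 1]]
      carrier_matD[OF Lspace_op_carrier(2)[where n = "Suc n" and r = r and L = "bordered n 1 L"]]
    by (intro eq_matI) (auto simp: bordered_index carr Lspace_smult_index)
qed (simp add: bordered_Lmat)

lemma real_ips_L00space: "real_ips L00space"
  using L00space_iso by (rule isometric_isoD)

lemma pad_L00:
  assumes "L \<in> Lmat n"
  shows "pad n (\<lambda>_. 1) L \<in> L00"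
proof -
  have "pad n (\<lambda>_. 1) L \<in> Lsmat"
    using LmatD[OF assms] by (auto simp: Lsmat_def pad_def)
  moreover have "finite {j. pad n (\<lambda>_. 1) L j j \<noteq> 1}"
    by (rule finite_subset[of _ "{..<n}"]) (auto simp: pad_def)
  moreover have "finite {(i,j). j < i \<and> pad n (\<lambda>_. 1) L i j \<noteq> 0}"
    by (rule finite_subset[of _ "{..<n} \<times> {..<n}"]) (auto simp: pad_def split: if_splits)
  ultimately show ?thesis by (simp add: L00_def)
qed

lemma L00_cover:
  assumes "L \<in> L00"
  shows "\<exists>n\<ge>1. truncate n L \<in> Lmat n \<and> L = pad n (\<lambda>_. 1) (truncate n L)"
proof -
  have L: "L \<in> Lsmat" and fin: "finite {j. L j j \<noteq> 1}" "finite {(i,j). j < i \<and> L i j \<noteq> 0}"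
    using assms by (auto simp: L00_def)
  have "finite (fst ` {(i,j). j < i \<and> L i j \<noteq> 0} \<union> {j. L j j \<noteq> 1})" using fin by blast
  then obtain m where m: "\<And>k. k \<in> fst ` {(i,j). j < i \<and> L i j \<noteq> 0} \<union> {j. L j j \<noteq> 1} \<Longrightarrow> k < m"
    unfolding finite_nat_iff_bounded by blast
  \<comment> \<open>m bounds all rows with a nonzero entry below the diagonal and all positions of
    diagonal entries other than 1; the successor ensures 1 \<le> n.\<close>
  define n where "n = Suc m"
  have diag: "L i i = 1" if "n \<le> i" for i
    using m[of i] that by (force simp: n_def)
  have off: "L i j = 0" if "n \<le> i" "j < i" for i j
    using m[of i] that by (force simp: n_def)
  have "L = pad n (\<lambda>_. 1) (truncate n L)"
  proof (intro ext)
    fix i j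
    show "L i j = pad n (\<lambda>_. 1) (truncate n L) i j"
      using diag[of i] off[of i j] LsmatD(1)[OF L, of i j]
      by (cases "i < n \<and> j < n"; cases i j rule: linorder_cases) (auto simp: pad_def truncate_def)
  qed
  then show ?thesis using truncate_Lmat[OF L, of n] by (intro exI[of _ n]) (simp add: n_def)
qed

lemma isometric_map_pad: "isometric_map (Lspace n) L00space (pad n (\<lambda>_. 1))"
proof (rule isometric_mapI[OF real_ips_Lspace real_ips_L00space])
  show "pad n (\<lambda>_. 1) L \<in> carrier L00space" if "L \<in> carrier (Lspace n)" for L
    using that by (simp add: L00space_def pad_L00)
  fix L K assume "L \<in> carrier (Lspace n)" "K \<in> carrier (Lspace n)"
  show "pad n (\<lambda>_. 1) (L \<oplus>\<^bsub>Lspace n\<^esub> K) = pad n (\<lambda>_. 1) L \<oplus>\<^bsub>L00space\<^esub> pad n (\<lambda>_. 1) K"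
    unfolding L00space_def sLspace_simps by (auto simp: pad_def Lspace_add_index fun_eq_iff)
  have "(\<Sum>\<^sub>\<infinity>(i,j)\<in>{(i,j). j < i}. cnj (pad n (\<lambda>_. 1) L i j) * pad n (\<lambda>_. 1) K i j) =
      (\<Sum>\<^sub>\<infinity>(i,j)\<in>Sigma {..<n} (\<lambda>i. {..<i}). cnj (L $$ (i,j)) * K $$ (i,j))"
    by (rule infsum_cong_neutral) (auto simp: pad_def split: if_splits)
  also have "\<dots> = (\<Sum>i<n. \<Sum>j<i. cnj (L $$ (i,j)) * K $$ (i,j))"
    by (simp add: sum.Sigma)
  finally have off: "(\<Sum>\<^sub>\<infinity>(i,j)\<in>{(i,j). j < i}. cnj (pad n (\<lambda>_. 1) L i j) * pad n (\<lambda>_. 1) K i j) =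
      (\<Sum>i<n. \<Sum>j<i. cnj (L $$ (i,j)) * K $$ (i,j))" .
  have "(\<Sum>\<^sub>\<infinity>j. ln (Re (pad n (\<lambda>_. 1) L j j)) * ln (Re (pad n (\<lambda>_. 1) K j j))) =
      (\<Sum>\<^sub>\<infinity>j\<in>{..<n}. ln (Re (L $$ (j,j))) * ln (Re (K $$ (j,j))))"
    by (rule infsum_cong_neutral) (auto simp: pad_def)
  then show "ip L00space (pad n (\<lambda>_. 1) L) (pad n (\<lambda>_. 1) K) = ip (Lspace n) L K"
    unfolding L00space_def sLspace_ip off Lspace_ip by simp
next
  fix r L assume "L \<in> carrier (Lspace n)"
  show "pad n (\<lambda>_. 1) (r \<odot>\<^bsub>Lspace n\<^esub> L) = r \<odot>\<^bsub>L00space\<^esub> pad n (\<lambda>_. 1) L"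
    unfolding L00space_def sLspace_simps by (auto simp: pad_def Lspace_smult_index fun_eq_iff)
qed

lemma pad_bordered: "A \<in> carrier_mat n n \<Longrightarrow> pad (Suc n) d (bordered n (d n) A) = pad n d A"
  by (auto simp: pad_def bordered_index fun_eq_iff less_Suc_eq)

lemma direct_limit_L00:
  "direct_limit TYPE('c) Lspace (\<lambda>m. bordered m 1) L00space (\<lambda>m. pad m (\<lambda>_. 1))"
proof (rule direct_limitI)
  show "pad (Suc n) (\<lambda>_. 1) (bordered n 1 x) = pad n (\<lambda>_. 1) x" if "x \<in> carrier (Lspace n)" for n x
    using pad_bordered[of x n "\<lambda>_. 1"] LmatD(1)[of x n] that by simp
  fix L assume "L \<in> carrier L00space"
  then show "\<exists>n\<ge>1. L \<in> pad n (\<lambda>_. 1) ` carrier (Lspace n)"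
    using L00_cover[of L] by (auto simp: L00space_def)
qed (rule isometric_map_bordered isometric_map_pad)+

text \<open>The border is decoupled from the block, so the new diagonal entry is 1 * dsign e n * 1.
  For 1 \<le> n this is the product of the signs n and n + 1 that borders LPM matrices.\<close>

lemma LDL_bordered:
  assumes "L \<in> carrier_mat n n"
  shows "LDL (Suc n) e (bordered n 1 L) = bordered n (complex_of_real (dsign e n)) (LDL n e L)"
proof (rule eq_matI)
  have carr: "LDL n e L \<in> carrier_mat n n" using assms by simp
  have dim: "bordered n (complex_of_real (dsign e n)) (LDL n e L) \<in> carrier_mat (Suc n) (Suc n)"
    "LDL (Suc n) e (bordered n 1 L) \<in> carrier_mat (Suc n) (Suc n)"
    using assms by simp_all
  fix i j assume "i < dim_row (bordered n (complex_of_real (dsign e n)) (LDL n e L))"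
    "j < dim_col (bordered n (complex_of_real (dsign e n)) (LDL n e L))"
  then have ij: "i < Suc n" "j < Suc n" using dim by auto
  have 0: "(\<Sum>k<n. bordered n 1 L $$ (i,k) * complex_of_real (dsign e k) * cnj (bordered n 1 L $$ (j,k))) =
      (if i < n \<and> j < n then \<Sum>k<n. L $$ (i,k) * complex_of_real (dsign e k) * cnj (L $$ (j,k)) else 0)"
    using ij assms by (auto simp: bordered_index less_Suc_eq intro!: sum.cong sum.neutral)
  show "LDL (Suc n) e (bordered n 1 L) $$ (i,j) = bordered n (complex_of_real (dsign e n)) (LDL n e L) $$ (i,j)"
    unfolding LDL_index[OF bordered_carrier[OF assms] ij] sum.lessThan_Suc 0
    using ij assms carr by (auto simp: bordered_index LDL_index less_Suc_eq)
qed (use assms in \<open>auto simp: bordered_def LDL_def\<close>)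

lemma sLDL_pad:
  assumes L: "L \<in> Lmat n"
  shows "sLDL e (pad n (\<lambda>_. 1) L) = pad n (\<lambda>i. complex_of_real (dsign e i)) (LDL n e L)"
proof (intro ext)
  fix i j
  let ?P = "pad n (\<lambda>_. 1) L"
  have P: "?P i k = 0" if "i < k" for i k using LmatD(2)[OF L, of i k] that by (auto simp: pad_def)
  have "sLDL e ?P i j = (\<Sum>k<Suc i. ?P i k * complex_of_real (dsign e k) * cnj (?P j k))"
    by (rule sLDL_index[OF P]) auto
  also have "\<dots> = pad n (\<lambda>i. complex_of_real (dsign e i)) (LDL n e L) i j"
  proof (cases "i < n")
    case True
    show ?thesis
    proof (cases "j < n")
      case j: True
      have "(\<Sum>k<Suc i. ?P i k * complex_of_real (dsign e k) * cnj (?P j k)) =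
          (\<Sum>k<n. L $$ (i,k) * complex_of_real (dsign e k) * cnj (L $$ (j,k)))"
        using True j LmatD(2)[OF L, of i]
        by (intro sum.mono_neutral_cong_left) (auto simp: pad_def)
      then show ?thesis using True j LmatD(1)[OF L] by (simp add: pad_def LDL_index)
    next
      case False
      have "(\<Sum>k<Suc i. ?P i k * complex_of_real (dsign e k) * cnj (?P j k)) = 0"
        using True False by (intro sum.neutral) (auto simp: pad_def)
      then show ?thesis using True False by (simp add: pad_def)
    qed
  next
    case False
    have "(\<Sum>k<i. ?P i k * complex_of_real (dsign e k) * cnj (?P j k)) = 0"
      using False by (intro sum.neutral) (auto simp: pad_def)
    then show ?thesis using False by (simp add: pad_def)
  qed
  finally show "sLDL e ?P i j = pad n (\<lambda>i. complex_of_real (dsign e i)) (LDL n e L) i j" .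
qed

lemma sLDL_image_L00:
  assumes e: "inf_sign_pattern e"
  shows "sLDL e ` L00 = LPM00 e"
proof safe
  fix L assume "L \<in> L00"
  then obtain n where n: "1 \<le> n" "truncate n L \<in> Lmat n" "L = pad n (\<lambda>_. 1) (truncate n L)"
    using L00_cover by blast
  have "sLDL e L = pad n (\<lambda>i. complex_of_real (dsign e i)) (LDL n e (truncate n L))"
    using sLDL_pad[OF n(2), of e] n(3) by simp
  then show "sLDL e L \<in> LPM00 e"
    using n LDL_LPM[OF signs_inf_sign_pattern[OF e] n(2)] by (auto simp: LPM00_def)
next
  fix A assume "A \<in> LPM00 e"
  then obtain n B where B: "A = pad n (\<lambda>i. complex_of_real (dsign e i)) B" "1 \<le> n" "B \<in> LPM n e"
    by (auto simp: LPM00_def)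
  note signs = signs_inf_sign_pattern[OF e, of n]
  have "A = sLDL e (pad n (\<lambda>_. 1) (chol_mat n e B))"
    using sLDL_pad[OF chol_mat_Lmat[OF signs B(3)], of e] LDL_chol_mat[OF signs B(3)] B(1) by simp
  then show "A \<in> sLDL e ` L00" using pad_L00[OF chol_mat_Lmat[OF signs B(3)]] by blast
qed

lemma LPM00space_iso:
  assumes "inf_sign_pattern e"
  shows "isometric_iso L00space (LPM00space e) (sLDL e)"
  unfolding LPM00space_def
proof (rule isometric_iso_transport[OF real_ips_L00space])
  have "L00 \<subseteq> Lsmat" by (auto simp: L00_def)
  then show "bij_betw (sLDL e) (carrier L00space) (LPM00 e)"
    using inj_on_subset[OF inj_on_sLDL[OF assms]] sLDL_image_L00[OF assms]
    by (simp add: L00space_def bij_betw_def)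
qed

text \<open>The target is the image by definition, so injectivity of the factorization map is what
  remains.\<close>

lemma LPMHspace_iso:
  assumes "inf_sign_pattern e"
  shows "isometric_iso LHspace (LPMHspace e) (sLDL e)"
  unfolding LPMHspace_def
proof (rule isometric_iso_transport)
  show "real_ips LHspace" using LHspace_iso by (rule isometric_isoD)
  have "LH \<subseteq> Lsmat" by (auto simp: LH_def)
  then show "bij_betw (sLDL e) (carrier LHspace) (sLDL e ` LH)"
    using inj_on_subset[OF inj_on_sLDL[OF assms]] by (simp add: LHspace_def bij_betw_def)
qed

lemma LPMspace_carrier [simp]: "carrier (LPMspace n e) = LPM n e"
  by (simp add: LPMspace_def transport_def Let_def)

text \<open>Under the factorizations, bordering and padding of LPM matrices become bordering and padding
  of triangular matrices, so isometry is inherited.\<close>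

lemma isometric_map_conjugate:
  assumes f: "isometric_iso X Y f" and h: "isometric_map X Z h"
    and g: "\<And>x. x \<in> carrier X \<Longrightarrow> g (f x) = h x"
  shows "isometric_map Y Z g"
proof (rule isometric_map_cong)
  let ?i = "inv_into (carrier X) f"
  show "isometric_map Y Z (h \<circ> ?i)"
    by (rule isometric_map_comp[OF isometric_isoD(1)[OF isometric_iso_inv[OF f]] h])
  fix y assume "y \<in> carrier Y"
  then have "y \<in> f ` carrier X" using isometric_isoD(2)[OF f] by (simp add: bij_betw_def)
  then show "g y = (h \<circ> ?i) y"
    using g[of "?i y"] by (simp add: f_inv_into_f inv_into_into)
qed

lemma direct_limit_LPM00:
  assumes e: "inf_sign_pattern e"
  shows "direct_limit TYPE('c) (\<lambda>m. LPMspace m e) (\<lambda>m. bordered m (complex_of_real (e m * e (Suc m))))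
    (LPM00space e) (\<lambda>m. pad m (\<lambda>i. complex_of_real (dsign e i)))"
proof (rule direct_limitI)
  note signs = signs_inf_sign_pattern[OF e]
  \<comment> \<open>At index 0 \<open>dsign\<close> has the separate value e 1, so the identity
    starts with the first level.\<close>
  have dsign: "e m * e (Suc m) = dsign e m" if "1 \<le> m" for m
    using that by (simp add: dsign_def)
  show "isometric_map (LPMspace n e) (LPMspace (Suc n) e) (bordered n (complex_of_real (e n * e (Suc n))))"
    if n: "1 \<le> n" for n
  proof (rule isometric_map_conjugate[OF LPMspace_iso[OF signs]])
    show "isometric_map (Lspace n) (LPMspace (Suc n) e) (LDL (Suc n) e \<circ> bordered n 1)"
      by (rule isometric_map_comp[OF isometric_map_bordered isometric_isoD(1)[OF LPMspace_iso[OF signs]]])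
    fix L assume "L \<in> carrier (Lspace n)"
    then show "bordered n (complex_of_real (e n * e (Suc n))) (LDL n e L) = (LDL (Suc n) e \<circ> bordered n 1) L"
      unfolding dsign[OF n] by (simp add: LDL_bordered LmatD(1))
  qed
  show "isometric_map (LPMspace n e) (LPM00space e) (pad n (\<lambda>i. complex_of_real (dsign e i)))" for n
  proof (rule isometric_map_conjugate[OF LPMspace_iso[OF signs]])
    show "isometric_map (Lspace n) (LPM00space e) (sLDL e \<circ> pad n (\<lambda>_. 1))"
      by (rule isometric_map_comp[OF isometric_map_pad isometric_isoD(1)[OF LPM00space_iso[OF e]]])
  qed (simp add: sLDL_pad)
  show "pad (Suc n) (\<lambda>i. complex_of_real (dsign e i)) (bordered n (complex_of_real (e n * e (Suc n))) A) =
      pad n (\<lambda>i. complex_of_real (dsign e i)) A" if "1 \<le> n" "A \<in> carrier (LPMspace n e)" for n A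
    unfolding dsign[OF that(1)] using that(2) LPMD(1)
    by (intro pad_bordered[where d = "\<lambda>i. complex_of_real (dsign e i)"]) simp
  show "\<exists>n\<ge>1. A \<in> pad n (\<lambda>i. complex_of_real (dsign e i)) ` carrier (LPMspace n e)"
    if "A \<in> carrier (LPM00space e)" for A
  proof -
    have "A \<in> LPM00 e" using that by (simp add: LPM00space_def transport_def Let_def)
    then show ?thesis by (auto simp: LPM00_def)
  qed
qed

section \<open>Coordinates that separate diagonal and off-diagonal entries\<close>

lemma splits_entries_cong:
  assumes g: "splits_entries S g" and eq: "\<And>L. L \<in> S \<Longrightarrow> f L = g L"
  shows "splits_entries S f"
  unfolding splits_entries_def
proof (intro ballI)
  fix L K assume LK: "L \<in> S" "K \<in> S"
  show "((\<forall>j. L j j = K j j) \<longrightarrow> fst (f L) = fst (f K)) \<and>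
    ((\<forall>i j. j < i \<longrightarrow> L i j = K i j) \<longrightarrow> snd (f L) = snd (f K))"
    unfolding eq[OF LK(1)] eq[OF LK(2)]
    using g[unfolded splits_entries_def, THEN bspec, THEN bspec, OF LK] .
qed

text \<open>The isomorphism undoes f and then takes coordinates. Composed with f it is the
  coordinate map again, whose components visibly separate the two kinds of entries.\<close>

lemma isometric_iso_splits_entries:
  assumes f: "isometric_iso X Y f" and X: "carrier X = S"
    and g: "isometric_iso X Z (\<lambda>L. (diag_seq L, off_seq L))"
  shows "\<exists>h. isometric_iso Y Z h \<and> splits_entries S (h \<circ> f)"
proof (intro exI conjI)
  let ?g = "\<lambda>L. (diag_seq L, off_seq L)"
  show "isometric_iso Y Z (?g \<circ> inv_into (carrier X) f)"
    by (rule isometric_iso_comp[OF isometric_iso_inv[OF f] g])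
  have "inv_into (carrier X) f (f L) = L" if "L \<in> S" for L
    using isometric_isoD(2)[OF f] that X by (simp add: bij_betw_def)
  then have "((?g \<circ> inv_into (carrier X) f) \<circ> f) L = ?g L" if "L \<in> S" for L
    using that by simp
  then show "splits_entries S ((?g \<circ> inv_into (carrier X) f) \<circ> f)"
    by (rule splits_entries_cong[OF splits_entries_seqs])
qed

theorem theorem5:
  fixes n :: nat and \<epsilon> :: "nat \<Rightarrow> real"
  assumes n: "1 \<le> n" and eps: "\<epsilon> \<in> sign_patterns n"
  shows
    "((\<forall>\<delta>\<in>sign_patterns n. LPM n \<delta> \<noteq> {}) \<and>
      disjoint_family_on (LPM n) (sign_patterns n) \<and>
      open_dense_in (subtopology (mat_topology n) (herm n)) (\<Union>\<delta>\<in>sign_patterns n. LPM n \<delta>))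
     \<and>
     ((\<forall>B\<in>LPM n \<epsilon>.
         smooth_diffeo n (low n) (Lmat n) (herm n) (LPM n \<epsilon>) (\<lambda>L. L * B * mat_adjoint L)) \<and>
      algorithmic_inverse n (Lmat n) (LPM n \<epsilon>) (\<lambda>B L. L * B * mat_adjoint L))
     \<and>
     ((\<forall>\<delta>\<in>sign_patterns n. TPM n \<delta> \<noteq> {}) \<and>
      disjoint_family_on (TPM n) (sign_patterns n) \<and>
      open_dense_in (subtopology (mat_topology n) (herm n)) (\<Union>\<delta>\<in>sign_patterns n. TPM n \<delta>) \<and>
      (\<forall>C\<in>TPM n \<epsilon>.
         smooth_diffeo n (low n) (Lmat n) (herm n) (TPM n \<epsilon>) (\<lambda>L. mat_adjoint L * C * L)) \<and>
      algorithmic_inverse n (Lmat n) (TPM n \<epsilon>) (\<lambda>C L. mat_adjoint L * C * L) \<and>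
      (\<forall>A\<in>carrier_mat n n. \<forall>B\<in>carrier_mat n n. \<forall>a b :: real.
         reversal n (complex_of_real a \<cdot>\<^sub>m A + complex_of_real b \<cdot>\<^sub>m B)
           = complex_of_real a \<cdot>\<^sub>m reversal n A + complex_of_real b \<cdot>\<^sub>m reversal n B) \<and>
      smooth_diffeo n (herm n) (LPM n \<epsilon>) (herm n) (TPM n \<epsilon>) (reversal n) \<and>
      smooth_diffeo n (herm n) (TPM n \<epsilon>) (herm n) (LPM n \<epsilon>) (reversal n) \<and>
      smooth_diffeo n (low n) (Lmat n) (low n) (Lmat n) (reversal n) \<and>
      (\<forall>L\<in>Lmat n. \<forall>B\<in>LPM n \<epsilon>.
         reversal n (L * B * mat_adjoint L)
           = mat_adjoint (reversal n L) * reversal n B * reversal n L))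
     \<and>
     (isometrically_isomorphic (Lspace n) (Euclid (n\<^sup>2)) \<and>
      isometric_iso (Lspace n) (LPMspace n \<epsilon>) (LDL n \<epsilon>) \<and>
      isometrically_isomorphic (LPMspace n \<epsilon>) (Euclid (n\<^sup>2)) \<and>
      isometric_iso (Lspace n) (TPMspace n \<epsilon>) (LPDPL n \<epsilon>) \<and>
      isometrically_isomorphic (TPMspace n \<epsilon>) (Euclid (n\<^sup>2)) \<and>
      (\<forall>e. inf_sign_pattern e \<longrightarrow>
         direct_limit TYPE('c) Lspace (\<lambda>m. bordered m 1) L00space (\<lambda>m. pad m (\<lambda>_. 1)) \<and>
         direct_limit TYPE('c) (\<lambda>m. LPMspace m e)
           (\<lambda>m. bordered m (complex_of_real (e m * e (Suc m))))
           (LPM00space e) (\<lambda>m. pad m (\<lambda>i. complex_of_real (dsign e i))) \<and>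
         (\<exists>f. isometric_iso L00space
                (ips_sum (c00 :: (nat \<Rightarrow> real) ips) (c00 :: (nat \<Rightarrow> complex) ips)) f \<and>
              splits_entries L00 f) \<and>
         isometric_iso L00space (LPM00space e) (sLDL e) \<and>
         (\<exists>f. isometric_iso (LPM00space e)
                (ips_sum (c00 :: (nat \<Rightarrow> real) ips) (c00 :: (nat \<Rightarrow> complex) ips)) f \<and>
              splits_entries L00 (f \<circ> sLDL e)) \<and>
         real_hilbert_space LHspace \<and>
         real_hilbert_space (LPMHspace e) \<and>
         real_hilbert_space (ips_sum (ell2 :: (nat \<Rightarrow> real) ips) (ell2 :: (nat \<Rightarrow> complex) ips)) \<and>
         (\<exists>f. isometric_iso LHspace
                (ips_sum (ell2 :: (nat \<Rightarrow> real) ips) (ell2 :: (nat \<Rightarrow> complex) ips)) f \<and>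
              splits_entries LH f) \<and>
         isometric_iso LHspace (LPMHspace e) (sLDL e) \<and>
         (\<exists>f. isometric_iso (LPMHspace e)
                (ips_sum (ell2 :: (nat \<Rightarrow> real) ips) (ell2 :: (nat \<Rightarrow> complex) ips)) f \<and>
              splits_entries LH (f \<circ> sLDL e))))"
    (is "?strata \<and> ?leading \<and> ?trailing \<and> ?spaces")
proof -
  note e = signs_sign_patterns[OF eps]
  have strata: ?strata
    by (intro conjI ballI LPM_nonempty signs_sign_patterns disjoint_LPM open_dense_LPM)
  have leading: ?leading
    by (intro conjI ballI smooth_diffeo_congruence[OF e] algorithmic_congruence[OF e])
  have trailing: ?trailing
  proof (intro conjI ballI allI)
    show "smooth_diffeo n (herm n) (LPM n \<epsilon>) (herm n) (TPM n \<epsilon>) (reversal n)"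
      "smooth_diffeo n (herm n) (TPM n \<epsilon>) (herm n) (LPM n \<epsilon>) (reversal n)"
      "smooth_diffeo n (low n) (Lmat n) (low n) (Lmat n) (reversal n)"
      by (intro smooth_diffeo_reversal smooth_domain_herm smooth_domain_Lmat
          openin_LPM[OF e] openin_TPM[OF e] bij_betw_reversal[OF e])+
    show "reversal n (L * B * mat_adjoint L) = mat_adjoint (reversal n L) * reversal n B * reversal n L"
      if "L \<in> Lmat n" "B \<in> LPM n \<epsilon>" for L B
      using reversal_congruence[OF LmatD(1)[OF that(1)] LPMD(1)[OF that(2)]] .
  qed (rule TPM_nonempty[OF signs_sign_patterns] disjoint_TPM open_dense_TPM reversal_linear
      smooth_diffeo_trailing_congruence[OF e] algorithmic_trailing_congruence[OF e]; assumption)+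
  have hilbert: "real_hilbert_space (ips_sum (ell2 :: (nat \<Rightarrow> real) ips) (ell2 :: (nat \<Rightarrow> complex) ips))"
    by (intro real_hilbert_space_sum real_hilbert_space_ell2)
  have LH: "real_hilbert_space LHspace"
    by (rule real_hilbert_space_isometric_iso[OF LHspace_iso hilbert])
  have carriers: "carrier L00space = L00" "carrier LHspace = LH"
    by (simp_all add: L00space_def LHspace_def)
  have spaces: ?spaces
  proof (intro conjI allI impI)
    show "isometrically_isomorphic (Lspace n) (Euclid (n\<^sup>2))"
      using Lspace_iso_Euclid isometrically_isomorphic_def by blast
    show "isometric_iso (Lspace n) (LPMspace n \<epsilon>) (LDL n \<epsilon>)"
      by (rule LPMspace_iso[OF e])
    then show "isometrically_isomorphic (LPMspace n \<epsilon>) (Euclid (n\<^sup>2))"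
      by (rule isometrically_isomorphic_via[OF _ Lspace_iso_Euclid])
    show "isometric_iso (Lspace n) (TPMspace n \<epsilon>) (LPDPL n \<epsilon>)"
      by (rule TPMspace_iso[OF e])
    then show "isometrically_isomorphic (TPMspace n \<epsilon>) (Euclid (n\<^sup>2))"
      by (rule isometrically_isomorphic_via[OF _ Lspace_iso_Euclid])
    fix e assume e: "inf_sign_pattern e"
    show "direct_limit TYPE('c) Lspace (\<lambda>m. bordered m 1) L00space (\<lambda>m. pad m (\<lambda>_. 1))"
      by (rule direct_limit_L00)
    show "direct_limit TYPE('c) (\<lambda>m. LPMspace m e) (\<lambda>m. bordered m (complex_of_real (e m * e (Suc m))))
        (LPM00space e) (\<lambda>m. pad m (\<lambda>i. complex_of_real (dsign e i)))"
      by (rule direct_limit_LPM00[OF e])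
    show "isometric_iso L00space (LPM00space e) (sLDL e)" by (rule LPM00space_iso[OF e])
    show "isometric_iso LHspace (LPMHspace e) (sLDL e)" by (rule LPMHspace_iso[OF e])
    show "real_hilbert_space (LPMHspace e)"
      by (rule real_hilbert_space_isometric_iso[OF isometric_iso_inv[OF LPMHspace_iso[OF e]] LH])
    show "\<exists>f. isometric_iso (LPM00space e)
          (ips_sum (c00 :: (nat \<Rightarrow> real) ips) (c00 :: (nat \<Rightarrow> complex) ips)) f \<and> splits_entries L00 (f \<circ> sLDL e)"
      by (rule isometric_iso_splits_entries[OF LPM00space_iso[OF e] carriers(1) L00space_iso])
    show "\<exists>f. isometric_iso (LPMHspace e)
          (ips_sum (ell2 :: (nat \<Rightarrow> real) ips) (ell2 :: (nat \<Rightarrow> complex) ips)) f \<and> splits_entries LH (f \<circ> sLDL e)"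
      by (rule isometric_iso_splits_entries[OF LPMHspace_iso[OF e] carriers(2) LHspace_iso])
    show "\<exists>f. isometric_iso L00space
          (ips_sum (c00 :: (nat \<Rightarrow> real) ips) (c00 :: (nat \<Rightarrow> complex) ips)) f \<and> splits_entries L00 f"
      by (rule exI, rule conjI, rule L00space_iso, rule splits_entries_seqs)
    show "\<exists>f. isometric_iso LHspace
          (ips_sum (ell2 :: (nat \<Rightarrow> real) ips) (ell2 :: (nat \<Rightarrow> complex) ips)) f \<and> splits_entries LH f"
      by (rule exI, rule conjI, rule LHspace_iso, rule splits_entries_seqs)
  qed (rule LH hilbert)+
  show ?thesis
    by (rule conjI[OF strata conjI[OF leading conjI[OF trailing spaces]]])
qed

end
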